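(* Let $\mathcal{H}$ be a separable infinite-dimensional Hilbert space, with Calkin algebra $\mathcal{Q}(\mathcal{H})=\mathcal{B}(\mathcal{H})/\mathcal{K}(\mathcal{H})$. Suppose that $\mathcal{A}$ is a finitely generated unital $C^*$-algebra such that $\mathrm{Ext}(\mathcal{A})$ is not a group. Let $\rho:\mathcal{A}\to\mathcal{Q}(\mathcal{H})$ be an injective unital $*$-homomorphism with no ucp lift to $\mathcal{B}(\mathcal{H})$. Then there exists an $n\in\mathbb{N}$, a $4$-dimensional operator subsystem $\mathcal{S}$ of $M_{n+1}(\mathcal{A})$ and a unitary $V:\mathcal{H}\otimes\mathbb{C}^{n+1}\to\mathcal{H}$ such that the mapping $V(\rho\otimes\mathrm{id}_{n+1})(\cdot)V^*:\mathcal{S}\to\mathcal{Q}(\mathcal{H})$ has no ucp lift to $\mathcal{B}(\mathcal{H})$.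
   Context: "Ucp" means unital completely positive. $\mathcal{K}(\mathcal{H})$ is the ideal of compact operators and $\pi:\mathcal{B}(\mathcal{H})\to\mathcal{Q}(\mathcal{H})$ is the canonical quotient map. A ucp lift to $\mathcal{B}(\mathcal{H})$ of a ucp map $\varphi:\mathcal{T}\to\mathcal{Q}(\mathcal{H})$ on an operator system (or unital $C^*$-algebra) $\mathcal{T}$ is a ucp map $\psi:\mathcal{T}\to\mathcal{B}(\mathcal{H})$ with $\pi\circ\psi=\varphi$. An operator subsystem of a unital $C^*$-algebra is a self-adjoint linear subspace containing the unit. $M_{n+1}(\mathcal{A})$ is identified with $\mathcal{A}\otimes M_{n+1}$, and $\mathrm{id}_{n+1}$ is the identity map on $M_{n+1}=M_{n+1}(\mathbb{C})$. "Finitely generated" means finitely generated as a $C^*$-algebra. $\mathrm{Ext}(\mathcal{A})$ is the semigroup of equivalence classes $[\rho]$ of injective unital $*$-homomorphisms $\rho:\mathcal{A}\to\mathcal{Q}(\mathcal{H})$, where two such maps are equivalent if they are conjugate by $\pi(U)$ for some unitary $U\in\mathcal{B}(\mathcal{H})$, with addition induced by direct sum (using an identification $\mathcal{H}\oplus\mathcal{H}\simeq\mathcal{H}$). Given a unitary $V:\mathcal{H}\otimes\mathbb{C}^{n+1}\to\mathcal{H}$, the $*$-isomorphism $X\mapsto VXV^*$ from $\mathcal{B}(\mathcal{H})\otimes M_{n+1}\simeq\mathcal{B}(\mathcal{H}\otimes\mathbb{C}^{n+1})$ onto $\mathcal{B}(\mathcal{H})$ carries $\mathcal{K}(\mathcal{H})\otimes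 M_{n+1}$ onto $\mathcal{K}(\mathcal{H})$, hence induces a $*$-isomorphism $\mathcal{Q}(\mathcal{H})\otimes M_{n+1}\to\mathcal{Q}(\mathcal{H})$, which is also written $x\mapsto VxV^*$. *)

theory Defs
  imports "HOL-Analysis.Analysis" "HOL-Algebra.Group"
begin

section \<open>Complex vector spaces, *-algebras, C*-algebras, Hilbert spaces\<close>

class scaleC =
  fixes scaleC :: "complex \<Rightarrow> 'a \<Rightarrow> 'a"  (infixr \<open>*\<^sub>C\<close> 75)

class complex_vector = scaleC + ab_group_add +
  assumes scaleC_add_right: "c *\<^sub>C (x + y) = c *\<^sub>C x + c *\<^sub>C y"
    and scaleC_add_left: "(c + d) *\<^sub>C x = c *\<^sub>C x + d *\<^sub>C x"
    and scaleC_scaleC [simp]: "c *\<^sub>C (d *\<^sub>C x) = (c * d) *\<^sub>C x"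
    and scaleC_one [simp]: "1 *\<^sub>C x = x"

global_interpretation complex_vector:
  vector_space "scaleC :: complex \<Rightarrow> 'a \<Rightarrow> 'a::complex_vector"
  defines csubspace = complex_vector.subspace
    and cspan = complex_vector.span
    and cdependent = complex_vector.dependent
    and cdim = complex_vector.dim
  by unfold_locales (simp_all add: scaleC_add_right scaleC_add_left)

class star =
  fixes star :: "'a \<Rightarrow> 'a"

class star_algebra = complex_vector + ring + star +
  assumes mult_scaleC_left: "(c *\<^sub>C x) * y = c *\<^sub>C (x * y)"
    and mult_scaleC_right: "x * (c *\<^sub>C y) = c *\<^sub>C (x * y)"
    and star_add: "star (x + y) = star x + star y"
    and star_scaleC: "star (c *\<^sub>C x) = cnj c *\<^sub>C star x"
    and star_mult: "star (x * y) = star y * star x"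
    and star_star [simp]: "star (star x) = x"

text \<open>Unlike \<^class>\<open>ring_1\<close>, this class admits the zero algebra, which is the Calkin algebra
  of a finite-dimensional space.\<close>

class unital_star_algebra = star_algebra + monoid_mult

class unital_cstar_algebra = unital_star_algebra + real_normed_algebra_1 + banach +
  assumes scaleR_eq_scaleC: "r *\<^sub>R x = complex_of_real r *\<^sub>C x"
    and norm_scaleC: "norm (c *\<^sub>C x) = cmod c * norm x"
    and norm_star_mult_self: "norm (star x * x) = (norm x)\<^sup>2"

class chilbert_space = complex_vector + banach +
  fixes cinner :: "'a \<Rightarrow> 'a \<Rightarrow> complex"
  assumes scaleR_eq_scaleC': "r *\<^sub>R x = complex_of_real r *\<^sub>C x"
    and cinner_add_right: "cinner x (y + z) = cinner x y + cinner x z"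
    and cinner_scaleC_right: "cinner x (c *\<^sub>C y) = c * cinner x y"
    and cinner_commute: "cinner x y = cnj (cinner y x)"
    and cinner_self: "cinner x x = complex_of_real ((norm x)\<^sup>2)"

lemma star_zero [simp]: "star (0::'a::star_algebra) = 0"
  using star_add[of "0::'a" 0] by simp

lemma star_minus: "star (- x) = - star (x::'a::star_algebra)"
  by (metis add_eq_0_iff star_add star_zero)

lemma star_diff: "star (x - y) = star x - star (y::'a::star_algebra)"
  by (metis diff_conv_add_uminus star_add star_minus)

lemma star_sum: "star (\<Sum>i\<in>I. f i) = (\<Sum>i\<in>I. star (f i :: 'a::star_algebra))"
  by (induction I rule: infinite_finite_induct) (simp_all add: star_add)

lemma star_one [simp]: "star (1::'a::unital_star_algebra) = 1"
  by (metis mult.right_neutral star_mult star_star)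

lemma scaleC_zero_right [simp]: "c *\<^sub>C (0::'a::complex_vector) = 0"
  by (rule complex_vector.scale_zero_right)

lemma scaleC_zero_left [simp]: "0 *\<^sub>C (x::'a::complex_vector) = 0"
  by (rule complex_vector.scale_zero_left)

lemma scaleC_minus_right: "c *\<^sub>C (- x) = - (c *\<^sub>C (x::'a::complex_vector))"
  by (rule complex_vector.scale_minus_right)

lemma scaleC_diff_right: "c *\<^sub>C (x - y) = c *\<^sub>C x - c *\<^sub>C (y::'a::complex_vector)"
  by (rule complex_vector.scale_right_diff_distrib)

lemma scaleC_sum_right: "c *\<^sub>C (\<Sum>i\<in>I. f i) = (\<Sum>i\<in>I. c *\<^sub>C (f i :: 'a::complex_vector))"
  by (rule complex_vector.scale_sum_right)

definition unitary :: "'a::unital_star_algebra \<Rightarrow> bool" where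
  "unitary u \<longleftrightarrow> star u * u = 1 \<and> u * star u = 1"

definition unital_star_hom :: "('a::unital_star_algebra \<Rightarrow> 'b::unital_star_algebra) \<Rightarrow> bool" where
  "unital_star_hom f \<longleftrightarrow>
     (\<forall>x y. f (x + y) = f x + f y) \<and> (\<forall>c x. f (c *\<^sub>C x) = c *\<^sub>C f x) \<and>
     (\<forall>x y. f (x * y) = f x * f y) \<and> (\<forall>x. f (star x) = star (f x)) \<and> f 1 = 1"

definition cstar_subalgebra :: "'a::unital_cstar_algebra set \<Rightarrow> bool" where
  "cstar_subalgebra B \<longleftrightarrow> csubspace B \<and> closed B \<and>
     (\<forall>x\<in>B. \<forall>y\<in>B. x * y \<in> B) \<and> (\<forall>x\<in>B. star x \<in> B)"

definition finitely_generated_cstar :: "'a::unital_cstar_algebra itself \<Rightarrow> bool" where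
  "finitely_generated_cstar _ \<longleftrightarrow>
     (\<exists>G::'a set. finite G \<and> cstar_subalgebra hull G = UNIV)"


section \<open>Bounded operators on a Hilbert space\<close>

lemma cinner_add_left: "cinner (x + y) z = cinner x z + cinner y (z::'h::chilbert_space)"
  by (metis cinner_add_right cinner_commute complex_cnj_add)

lemma cinner_scaleC_left: "cinner (c *\<^sub>C x) (y::'h::chilbert_space) = cnj c * cinner x y"
  by (metis cinner_commute cinner_scaleC_right complex_cnj_mult)

lemma cinner_zero_right [simp]: "cinner (x::'h::chilbert_space) 0 = 0"
  using cinner_add_right[of x 0 0] by simp

lemma cinner_zero_left [simp]: "cinner 0 (x::'h::chilbert_space) = 0"
  using cinner_add_left[of 0 0 x] by simp

lemma cinner_minus_right: "cinner (x::'h::chilbert_space) (- y) = - cinner x y"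
  by (metis add_eq_0_iff cinner_add_right cinner_zero_right)

lemma cinner_diff_right: "cinner (x::'h::chilbert_space) (y - z) = cinner x y - cinner x z"
  by (metis cinner_add_right cinner_minus_right diff_conv_add_uminus)

lemma cinner_diff_left: "cinner (x - y) (z::'h::chilbert_space) = cinner x z - cinner y z"
  by (metis cinner_commute cinner_diff_right complex_cnj_diff)

lemma cinner_sum_right:
  "cinner (x::'h::chilbert_space) (\<Sum>i\<in>I. f i) = (\<Sum>i\<in>I. cinner x (f i))"
  by (induction I rule: infinite_finite_induct) (simp_all add: cinner_add_right)

lemma cinner_eq_zero: "cinner x x = 0 \<longleftrightarrow> (x::'h::chilbert_space) = 0"
  by (simp add: cinner_self)

lemma cinner_ext: "(\<And>z. cinner z x = cinner z y) \<Longrightarrow> x = (y::'h::chilbert_space)"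
  by (metis cinner_diff_right cinner_eq_zero eq_iff_diff_eq_0)

lemma cinner_ext_left: "(\<And>z. cinner x z = cinner y z) \<Longrightarrow> x = (y::'h::chilbert_space)"
  by (metis cinner_commute cinner_ext)

lemma norm_scaleC_hilbert: "norm (c *\<^sub>C (x::'h::chilbert_space)) = cmod c * norm x"
proof -
  have "complex_of_real ((norm (c *\<^sub>C x))\<^sup>2) = cnj c * c * complex_of_real ((norm x)\<^sup>2)"
    by (simp only: cinner_self[symmetric] cinner_scaleC_left cinner_scaleC_right mult_ac)
  also have "\<dots> = complex_of_real ((cmod c * norm x)\<^sup>2)"
    by (simp add: power_mult_distrib complex_norm_square mult.commute
        flip: of_real_power)
  finally have "(norm (c *\<^sub>C x))\<^sup>2 = (cmod c * norm x)\<^sup>2"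
    using of_real_eq_iff by blast
  then show ?thesis by simp
qed

lemma norm_add_sq:
  "(norm (x + y :: 'h::chilbert_space))\<^sup>2 = (norm x)\<^sup>2 + (norm y)\<^sup>2 + 2 * Re (cinner x y)"
proof -
  have "complex_of_real ((norm (x + y))\<^sup>2) =
      complex_of_real ((norm x)\<^sup>2) + complex_of_real ((norm y)\<^sup>2) + (cinner x y + cinner y x)"
    by (simp only: cinner_self[symmetric] cinner_add_left cinner_add_right algebra_simps)
  moreover have "cinner x y + cinner y x = complex_of_real (2 * Re (cinner x y))"
    by (subst cinner_commute[of y]) (simp add: complex_add_cnj)
  ultimately have "complex_of_real ((norm (x + y))\<^sup>2)
      = complex_of_real ((norm x)\<^sup>2 + (norm y)\<^sup>2 + 2 * Re (cinner x y))"
    by simp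
  then show ?thesis using of_real_eq_iff by blast
qed

lemma cauchy_schwarz: "cmod (cinner x y) \<le> norm x * norm (y::'h::chilbert_space)"
proof -
  have re: "Re (cinner x y) \<le> norm x * norm y" for x y :: 'h
  proof -
    have "(norm (x + y))\<^sup>2 \<le> (norm x + norm y)\<^sup>2"
      by (simp add: norm_triangle_ineq power_mono)
    then show ?thesis unfolding norm_add_sq by (simp add: power2_sum)
  qed
  define c where "c = cnj (sgn (cinner x y))"
  have "c * cinner x y = complex_of_real (cmod (cinner x y))"
  proof (cases "cinner x y = 0")
    case False
    have "cnj (cinner x y) * cinner x y = complex_of_real ((cmod (cinner x y))\<^sup>2)"
      by (metis complex_norm_square mult.commute)
    with False show ?thesis
      by (simp add: c_def sgn_div_norm scaleR_conv_of_real power2_eq_square field_simps)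
  qed simp
  then have "cmod (cinner x y) = Re (cinner x (c *\<^sub>C y))"
    by (simp add: cinner_scaleC_right)
  also have "\<dots> \<le> norm x * norm (c *\<^sub>C y)" by (rule re)
  also have "\<dots> \<le> norm x * norm y"
    by (auto simp: norm_scaleC_hilbert c_def norm_sgn)
  finally show ?thesis .
qed

definition bounded_clinear :: "('h::chilbert_space \<Rightarrow> 'k::chilbert_space) \<Rightarrow> bool" where
  "bounded_clinear f \<longleftrightarrow> (\<forall>x y. f (x + y) = f x + f y) \<and> (\<forall>c x. f (c *\<^sub>C x) = c *\<^sub>C f x) \<and>
     (\<exists>K. \<forall>x. norm (f x) \<le> K * norm x)"

lemma riesz:
  fixes f :: "'h::chilbert_space \<Rightarrow> complex"
  assumes add: "\<And>x y. f (x + y) = f x + f y"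
    and scale: "\<And>c x. f (c *\<^sub>C x) = c * f x"
    and bd: "\<And>x. cmod (f x) \<le> K * norm x"
  shows "\<exists>y. \<forall>x. f x = cinner y x"
proof -
  define P where "P x = (norm x)\<^sup>2 - 2 * Re (f x)" for x
  have lower: "- K\<^sup>2 \<le> P x" for x
  proof -
    have "Re (f x) \<le> K * norm x" using bd[of x] complex_Re_le_cmod order_trans by blast
    moreover have "0 \<le> (norm x - K)\<^sup>2" by simp
    ultimately show ?thesis unfolding P_def by (simp add: power2_diff algebra_simps)
  qed
  have bb: "bdd_below (range P)" using lower by (auto simp: bdd_below_def)
  define m where "m = Inf (range P)"
  have mle: "m \<le> P x" for x unfolding m_def by (rule cInf_lower[OF _ bb]) simp
  have "\<exists>x. P x < m + e" if "e > 0" for e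
    using that cInf_lessD[of "range P" "m + e"] unfolding m_def by auto
  then have "\<forall>n::nat. \<exists>x. P x < m + inverse (real (Suc n))"
    by (metis inverse_positive_iff_positive of_nat_0_less_iff zero_less_Suc)
  then obtain X where X: "\<And>n::nat. P (X n) < m + inverse (real (Suc n))" by metis
  have fdiff: "f (x - y) = f x - f y" for x y
    by (metis add add_diff_cancel diff_add_cancel)
  have f0: "f (r *\<^sub>R x) = complex_of_real r * f x" for r x by (simp add: scaleR_eq_scaleC' scale)
  have par: "(norm (x - y))\<^sup>2 \<le> 2 * (P x + P y - 2 * m)" for x y
  proof -
    have 1: "(norm (x - y))\<^sup>2 + (norm (x + y))\<^sup>2 = 2 * (norm x)\<^sup>2 + 2 * (norm y)\<^sup>2"
      using norm_add_sq[of x y] norm_add_sq[of x "- y"] by (simp add: cinner_minus_right)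
    have "P ((1/2) *\<^sub>R (x + y)) = (norm (x + y))\<^sup>2 / 4 - Re (f x) - Re (f y)"
      unfolding P_def by (simp add: f0 add power_mult_distrib power2_eq_square add_divide_distrib)
    with 1 mle[of "(1/2) *\<^sub>R (x + y)"] show ?thesis by (simp add: P_def)
  qed
  have "Cauchy X"
  proof (rule metric_CauchyI)
    fix e :: real assume "e > 0"
    then obtain N where N: "inverse (real (Suc N)) < e\<^sup>2 / 4"
      using reals_Archimedean[of "e\<^sup>2/4"] by auto
    have "dist (X p) (X q) < e" if "p \<ge> N" "q \<ge> N" for p q
    proof -
      have s: "P (X k) < m + e\<^sup>2/4" if "k \<ge> N" for k
      proof -
        have "inverse (real (Suc k)) \<le> inverse (real (Suc N))" using that by (simp add: le_imp_inverse_le)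
        with X[of k] N show ?thesis by linarith
      qed
      have "(dist (X p) (X q))\<^sup>2 < e\<^sup>2"
        using par[of "X p" "X q"] s[OF that(1)] s[OF that(2)] by (simp add: dist_norm)
      then show ?thesis using \<open>e > 0\<close> by (simp add: power2_less_imp_less)
    qed
    then show "\<exists>M. \<forall>p\<ge>M. \<forall>q\<ge>M. dist (X p) (X q) < e" by blast
  qed
  then obtain y where y: "X \<longlonglongrightarrow> y" using Cauchy_convergent convergent_def by blast
  have "bounded_linear f"
    by (rule bounded_linear_intro[where K=K])
       (simp_all add: add f0 scaleR_conv_of_real bd mult.commute)
  then have "(\<lambda>n. f (X n)) \<longlonglongrightarrow> f y" using y bounded_linear.tendsto by blast
  then have lim1: "(\<lambda>n. P (X n)) \<longlonglongrightarrow> P y" unfolding P_def by (intro tendsto_intros y)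
  have lim2: "(\<lambda>n. m + inverse (real (Suc n))) \<longlonglongrightarrow> m + 0"
    by (intro tendsto_intros LIMSEQ_inverse_real_of_nat)
  have "P y \<le> m + 0"
    by (rule LIMSEQ_le[OF lim1 lim2]) (use X less_imp_le in blast)
  then have Py: "P y = m" using mle[of y] by simp
  have re: "Re (cinner y x) = Re (f x)" for x
  proof (rule ccontr)
    define d where "d = Re (cinner y x) - Re (f x)"
    assume "Re (cinner y x) \<noteq> Re (f x)"
    then have d: "d \<noteq> 0" by (simp add: d_def)
    have q: "0 \<le> 2 * t * d + t\<^sup>2 * (norm x)\<^sup>2" for t :: real
    proof -
      have "P (y + t *\<^sub>R x) = P y + 2 * t * d + t\<^sup>2 * (norm x)\<^sup>2"
        unfolding P_def norm_add_sq d_def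
        by (simp add: f0 add scaleR_eq_scaleC'[of t] cinner_scaleC_right norm_scaleC_hilbert
            power_mult_distrib scale algebra_simps)
      then show ?thesis using mle[of "y + t *\<^sub>R x"] Py by simp
    qed
    define s where "s = (norm x)\<^sup>2 + 1"
    have s: "s > 0" "(norm x)\<^sup>2 \<le> s" by (auto simp: s_def add_nonneg_pos)
    have "2 * (- d / s) * d + (- d / s)\<^sup>2 * (norm x)\<^sup>2 \<le> 2 * (- d / s) * d + (- d / s)\<^sup>2 * s"
      using s by (simp add: mult_left_mono)
    also have "\<dots> = - (d\<^sup>2 / s)" using s by (simp add: power2_eq_square field_simps)
    also have "\<dots> < 0" using d s by simp
    finally show False using q[of "- d / s"] by simp
  qed
  have "f x = cinner y x" for x
  proof (rule complex_eqI)
    show "Re (f x) = Re (cinner y x)" by (simp add: re)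
    have "Im z = - Re (\<i> * z)" for z by simp
    then show "Im (f x) = Im (cinner y x)"
      using re[of "\<i> *\<^sub>C x"] by (simp add: scale cinner_scaleC_right)
  qed
  then show ?thesis by blast
qed

typedef (overloaded) ('h::chilbert_space) bop = "{T :: 'h \<Rightarrow> 'h. bounded_clinear T}"
  morphisms ap Abs_bop
  by (rule exI[of _ "\<lambda>_. 0"]) (auto simp: bounded_clinear_def intro!: exI[of _ 0])

setup_lifting type_definition_bop

lemma ap_add: "ap T (x + y) = ap T x + ap T y"
  and ap_scaleC: "ap T (c *\<^sub>C x) = c *\<^sub>C ap T x"
  and ap_bounded: "\<exists>K. \<forall>x. norm (ap T x) \<le> K * norm x"
  using ap[of T] by (auto simp: bounded_clinear_def)

lemma ap_bounded_pos: "\<exists>K>0. \<forall>x. norm (ap T x) \<le> K * norm x"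
proof -
  obtain K where K: "\<And>x. norm (ap T x) \<le> K * norm x" using ap_bounded by blast
  have "norm (ap T x) \<le> max K 1 * norm x" for x
    using K[of x] by (meson max.cobounded1 mult_right_mono norm_ge_zero order_trans)
  then show ?thesis by (intro exI[of _ "max K 1"]) auto
qed

lemma ap_bounded_linear: "bounded_linear (ap T)"
proof -
  obtain K where "\<And>x. norm (ap T x) \<le> K * norm x" using ap_bounded by blast
  then show ?thesis
    by (intro bounded_linear_intro[where K=K])
       (simp_all add: ap_add ap_scaleC scaleR_eq_scaleC' mult.commute)
qed

lemmas ap_zero_right [simp] = bounded_linear.linear[OF ap_bounded_linear, THEN linear_0]
lemmas ap_diff_right = bounded_linear.linear[OF ap_bounded_linear, THEN linear_diff]
lemmas ap_sum_right = bounded_linear.linear[OF ap_bounded_linear, THEN linear_sum]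

lemma bop_eqI: "(\<And>x. ap S x = ap T x) \<Longrightarrow> S = T"
  by (simp add: ap_inject[symmetric] fun_eq_iff)

lemma adjoint_exists: "\<exists>S. \<forall>x y. cinner (ap S x) y = cinner x (ap T y)"
proof -
  obtain K where K: "K > 0" "\<And>x. norm (ap T x) \<le> K * norm x" using ap_bounded_pos by blast
  have "\<exists>z. \<forall>y. cinner x (ap T y) = cinner z y" for x
  proof (rule riesz[where K="norm x * K"])
    show "cmod (cinner x (ap T y)) \<le> norm x * K * norm y" for y
    proof -
      have "cmod (cinner x (ap T y)) \<le> norm x * norm (ap T y)" by (rule cauchy_schwarz)
      also have "\<dots> \<le> norm x * (K * norm y)" using K by (intro mult_left_mono) auto
      finally show ?thesis by simp
    qed
  qed (simp_all add: ap_add ap_scaleC cinner_add_right cinner_scaleC_right)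
  then obtain g where g: "\<And>x y. cinner x (ap T y) = cinner (g x) y" by metis
  have "bounded_clinear g" unfolding bounded_clinear_def
  proof (intro conjI allI exI)
    show "g (x + y) = g x + g y" for x y
      by (rule cinner_ext_left) (simp add: g[symmetric] cinner_add_left)
    show "g (c *\<^sub>C x) = c *\<^sub>C g x" for c x
      by (rule cinner_ext_left) (simp add: g[symmetric] cinner_scaleC_left)
    show "norm (g x) \<le> K * norm x" for x
    proof (cases "norm (g x) = 0")
      case False
      have "(norm (g x))\<^sup>2 = cmod (cinner (g x) (g x))"
        by (simp only: cinner_self norm_of_real) simp
      also have "\<dots> = cmod (cinner x (ap T (g x)))" by (simp add: g)
      also have "\<dots> \<le> norm x * norm (ap T (g x))" by (rule cauchy_schwarz)
      also have "\<dots> \<le> norm x * (K * norm (g x))" using K by (intro mult_left_mono) auto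
      finally have "norm (g x) * norm (g x) \<le> (K * norm x) * norm (g x)"
        by (simp add: power2_eq_square mult_ac)
      with False show ?thesis by simp
    qed (use K in simp)
  qed
  then show ?thesis by (intro exI[of _ "Abs_bop g"]) (simp add: Abs_bop_inverse g)
qed

instantiation bop :: (chilbert_space) unital_star_algebra
begin

lift_definition zero_bop :: "'a bop" is "\<lambda>_. 0"
  by (auto simp: bounded_clinear_def intro!: exI[of _ 0])

lift_definition one_bop :: "'a bop" is "\<lambda>x. x"
  by (auto simp: bounded_clinear_def intro!: exI[of _ 1])

lift_definition plus_bop :: "'a bop \<Rightarrow> 'a bop \<Rightarrow> 'a bop" is "\<lambda>S T x. S x + T x"
proof -
  fix S T :: "'a \<Rightarrow> 'a" assume *: "bounded_clinear S" "bounded_clinear T"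
  obtain K L where KL: "\<And>x. norm (S x) \<le> K * norm x" "\<And>x. norm (T x) \<le> L * norm x"
    using * unfolding bounded_clinear_def by blast
  have "norm (S x + T x) \<le> (K + L) * norm x" for x
    using norm_triangle_ineq[of "S x" "T x"] KL(1)[of x] KL(2)[of x] by (simp add: algebra_simps)
  with * show "bounded_clinear (\<lambda>x. S x + T x)"
    unfolding bounded_clinear_def by (auto simp: scaleC_add_right algebra_simps intro!: exI[of _ "K + L"])
qed

lift_definition scaleC_bop :: "complex \<Rightarrow> 'a bop \<Rightarrow> 'a bop" is "\<lambda>c T x. c *\<^sub>C T x"
proof -
  fix c and T :: "'a \<Rightarrow> 'a" assume *: "bounded_clinear T"
  obtain K where K: "\<And>x. norm (T x) \<le> K * norm x"
    using * unfolding bounded_clinear_def by blast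
  have "norm (c *\<^sub>C T x) \<le> (cmod c * K) * norm x" for x
    using mult_left_mono[OF K[of x], of "cmod c"] by (simp add: norm_scaleC_hilbert mult_ac)
  with * show "bounded_clinear (\<lambda>x. c *\<^sub>C T x)"
    unfolding bounded_clinear_def
    by (auto simp: scaleC_add_right mult.commute intro!: exI[of _ "cmod c * K"])
qed

definition uminus_bop :: "'a bop \<Rightarrow> 'a bop" where "uminus_bop T = (- 1) *\<^sub>C T"

definition minus_bop :: "'a bop \<Rightarrow> 'a bop \<Rightarrow> 'a bop" where "minus_bop S T = S + (- T :: 'a bop)"

lift_definition times_bop :: "'a bop \<Rightarrow> 'a bop \<Rightarrow> 'a bop" is "\<lambda>S T x. S (T x)"
proof -
  fix S T :: "'a \<Rightarrow> 'a" assume *: "bounded_clinear S" "bounded_clinear T"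
  obtain K L where KL: "\<And>x. norm (S x) \<le> K * norm x" "\<And>x. norm (T x) \<le> L * norm x"
    using * unfolding bounded_clinear_def by blast
  have "norm (S (T x)) \<le> (\<bar>K\<bar> * L) * norm x" for x
  proof -
    have "norm (S (T x)) \<le> \<bar>K\<bar> * norm (T x)"
      using KL(1)[of "T x"] by (meson abs_ge_self mult_right_mono norm_ge_zero order_trans)
    also have "\<dots> \<le> \<bar>K\<bar> * (L * norm x)" using KL(2) by (intro mult_left_mono) auto
    finally show ?thesis by simp
  qed
  with * show "bounded_clinear (\<lambda>x. S (T x))" unfolding bounded_clinear_def by auto
qed

definition star_bop :: "'a bop \<Rightarrow> 'a bop" where
  "star_bop T = (THE S. \<forall>x y. cinner (ap S x) y = cinner x (ap T y))"

lemma star_bop_cinner: "cinner (ap (star T) x) y = cinner x (ap (T :: 'a bop) y)"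
proof -
  have "\<exists>!S. \<forall>x y. cinner (ap S x) y = cinner x (ap T y)"
  proof (rule ex_ex1I[OF adjoint_exists])
    fix S S' assume *: "\<forall>x y. cinner (ap S x) y = cinner x (ap T y)"
      "\<forall>x y. cinner (ap S' x) y = cinner x (ap T y)"
    show "S = S'" by (intro bop_eqI cinner_ext_left) (simp add: *)
  qed
  from theI'[OF this] show ?thesis unfolding star_bop_def by blast
qed

lemma star_bop_eqI: "(\<And>x y. cinner (ap S x) y = cinner x (ap (T :: 'a bop) y)) \<Longrightarrow> star T = S"
  by (intro bop_eqI cinner_ext_left) (simp add: star_bop_cinner)

instance
proof
  fix a b c :: "'a bop" and r s :: complex
  show "a + b + c = a + (b + c)" by transfer (simp add: add.assoc)
  show "a + b = b + a" by transfer (simp add: add.commute)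
  show "0 + a = a" by transfer simp
  show "- a + a = 0" unfolding uminus_bop_def
    by transfer (metis (no_types, opaque_lifting) add.left_inverse scaleC_add_left scaleC_one scaleC_zero_left)
  show "a - b = a + - b" by (simp add: minus_bop_def)
  show "a * b * c = a * (b * c)" by transfer simp
  show "(a + b) * c = a * c + b * c" by transfer simp
  show "a * (b + c) = a * b + a * c" by transfer (simp add: bounded_clinear_def)
  show "1 * a = a" "a * 1 = a" by (transfer; simp)+
  show "r *\<^sub>C (a + b) = r *\<^sub>C a + r *\<^sub>C b" by transfer (simp add: scaleC_add_right)
  show "(r + s) *\<^sub>C a = r *\<^sub>C a + s *\<^sub>C a" by transfer (simp add: scaleC_add_left)
  show "r *\<^sub>C s *\<^sub>C a = (r * s) *\<^sub>C a" by transfer simp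
  show "1 *\<^sub>C a = a" by transfer simp
  show "r *\<^sub>C a * b = r *\<^sub>C (a * b)" by transfer simp
  show "a * r *\<^sub>C b = r *\<^sub>C (a * b)" by transfer (simp add: bounded_clinear_def)
  show "star (a + b) = star a + star b"
    by (rule star_bop_eqI) (simp add: plus_bop.rep_eq cinner_add_left cinner_add_right star_bop_cinner)
  show "star (r *\<^sub>C a) = cnj r *\<^sub>C star a"
    by (rule star_bop_eqI)
       (simp add: scaleC_bop.rep_eq cinner_scaleC_left cinner_scaleC_right star_bop_cinner)
  show "star (a * b) = star b * star a"
    by (rule star_bop_eqI) (simp add: times_bop.rep_eq star_bop_cinner)
  show "star (star a) = a"
    by (rule star_bop_eqI) (metis cinner_commute star_bop_cinner)
qed

end

lemma ap_minus_left: "ap (S - T) x = ap S x - ap T x"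
proof -
  have "ap (S - T + T) x = ap (S - T) x + ap T x" by (rule plus_bop.rep_eq[THEN fun_cong])
  then show ?thesis by (simp add: eq_diff_eq)
qed

lemma ap_sum_left: "ap (\<Sum>i\<in>I. T i) x = (\<Sum>i\<in>I. ap (T i) x)"
  by (induction I rule: infinite_finite_induct) (simp_all add: plus_bop.rep_eq zero_bop.rep_eq)


section \<open>Compact operators and the Calkin algebra\<close>

definition compact_op :: "'h::chilbert_space bop \<Rightarrow> bool" where
  "compact_op T \<longleftrightarrow> compact (closure (ap T ` cball 0 1))"

lemma compact_op_seq:
  "compact_op T \<longleftrightarrow>
     (\<forall>x::nat \<Rightarrow> 'h::chilbert_space. (\<forall>n. norm (x n) \<le> 1) \<longrightarrow>
        (\<exists>r. strict_mono r \<and> convergent (\<lambda>n. ap T (x (r n)))))"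
proof (intro iffI allI impI)
  fix x :: "nat \<Rightarrow> 'h" assume T: "compact_op T" and x: "\<forall>n. norm (x n) \<le> 1"
  have "\<forall>n. (\<lambda>n. ap T (x n)) n \<in> closure (ap T ` cball 0 1)"
    using x closure_subset[of "ap T ` cball 0 1"] by auto
  then have "\<exists>l\<in>closure (ap T ` cball 0 1). \<exists>r. strict_mono r \<and> ((\<lambda>n. ap T (x n)) \<circ> r) \<longlonglongrightarrow> l"
    using T unfolding compact_op_def compact_def by (elim allE[of _ "\<lambda>n. ap T (x n)"] mp)
  then show "\<exists>r. strict_mono r \<and> convergent (\<lambda>n. ap T (x (r n)))"
    by (auto simp: convergent_def o_def)
next
  assume R: "\<forall>x::nat \<Rightarrow> 'h. (\<forall>n. norm (x n) \<le> 1) \<longrightarrow>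
        (\<exists>r. strict_mono r \<and> convergent (\<lambda>n. ap T (x (r n))))"
  show "compact_op T" unfolding compact_op_def compact_def
  proof (intro allI impI)
    fix f :: "nat \<Rightarrow> 'h" assume f: "\<forall>n. f n \<in> closure (ap T ` cball 0 1)"
    have "\<forall>n. \<exists>x. norm x \<le> 1 \<and> dist (ap T x) (f n) < inverse (real (Suc n))"
    proof
      fix n
      have "\<exists>y\<in>ap T ` cball 0 1. dist y (f n) < inverse (real (Suc n))"
        using f by (metis closure_approachable inverse_positive_iff_positive of_nat_0_less_iff zero_less_Suc)
      then show "\<exists>x. norm x \<le> 1 \<and> dist (ap T x) (f n) < inverse (real (Suc n))" by auto
    qed
    then obtain x where x: "\<And>n. norm (x n) \<le> 1"
      "\<And>n. dist (ap T (x n)) (f n) < inverse (real (Suc n))" by metis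
    from R x(1) obtain r l where r: "strict_mono r" "(\<lambda>n. ap T (x (r n))) \<longlonglongrightarrow> l"
      unfolding convergent_def by blast
    have z: "(\<lambda>n. inverse (real (Suc (r n)))) \<longlonglongrightarrow> 0"
      using LIMSEQ_subseq_LIMSEQ[OF LIMSEQ_inverse_real_of_nat r(1)] by (simp add: o_def)
    have "(\<lambda>n. dist (ap T (x (r n))) (f (r n))) \<longlonglongrightarrow> 0"
      by (rule real_tendsto_sandwich[OF _ _ tendsto_const z])
         (simp_all add: less_imp_le[OF x(2)] del: of_nat_Suc)
    then have "(\<lambda>n. ap T (x (r n)) - f (r n)) \<longlonglongrightarrow> 0"
      by (simp add: dist_norm tendsto_norm_zero_iff)
    from tendsto_diff[OF r(2) this] have "(f \<circ> r) \<longlonglongrightarrow> l" by (simp add: o_def)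
    moreover have "l \<in> closure (ap T ` cball 0 1)"
      using calculation f closed_sequentially[OF closed_closure] by (metis comp_apply)
    ultimately show "\<exists>l\<in>closure (ap T ` cball 0 1). \<exists>r. strict_mono r \<and> (f \<circ> r) \<longlonglongrightarrow> l"
      using r(1) by blast
  qed
qed

lemma compact_op_zero: "compact_op 0"
  unfolding compact_op_seq zero_bop.rep_eq by (auto intro: strict_mono_id convergent_const)

lemma compact_op_add:
  assumes "compact_op S" "compact_op T" shows "compact_op (S + T)"
  unfolding compact_op_seq
proof (intro allI impI)
  fix x :: "nat \<Rightarrow> 'a" assume x: "\<forall>n. norm (x n) \<le> 1"
  from assms(1) x obtain r where r: "strict_mono r" "convergent (\<lambda>n. ap S (x (r n)))"
    unfolding compact_op_seq by blast
  from assms(2) x obtain q where q: "strict_mono q" "convergent (\<lambda>n. ap T (x (r (q n))))"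
    unfolding compact_op_seq by (elim allE[of _ "\<lambda>n. x (r n)"]) blast
  have "convergent (\<lambda>n. ap S (x (r (q n))))"
    using convergent_subseq_convergent[OF r(2) q(1)] by (simp add: o_def)
  then have "convergent (\<lambda>n. ap (S + T) (x ((r \<circ> q) n)))"
    using q(2) by (simp add: plus_bop.rep_eq convergent_add)
  then show "\<exists>r. strict_mono r \<and> convergent (\<lambda>n. ap (S + T) (x (r n)))"
    using strict_mono_o[OF r(1) q(1)] by blast
qed

lemma compact_op_mult_left:
  assumes "compact_op T" shows "compact_op (S * T)"
  unfolding compact_op_seq
proof (intro allI impI)
  fix x :: "nat \<Rightarrow> 'a" assume "\<forall>n. norm (x n) \<le> 1"
  then obtain r where r: "strict_mono r" "convergent (\<lambda>n. ap T (x (r n)))"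
    using assms unfolding compact_op_seq by blast
  from r(2) have "convergent (\<lambda>n. ap (S * T) (x (r n)))"
    unfolding convergent_def times_bop.rep_eq
    using bounded_linear.tendsto[OF ap_bounded_linear] by blast
  with r(1) show "\<exists>r. strict_mono r \<and> convergent (\<lambda>n. ap (S * T) (x (r n)))" by blast
qed

lemma compact_op_mult_right:
  assumes "compact_op T" shows "compact_op (T * S)"
  unfolding compact_op_seq
proof (intro allI impI)
  fix x :: "nat \<Rightarrow> 'a" assume x: "\<forall>n. norm (x n) \<le> 1"
  obtain K where K: "K > 0" "\<And>x. norm (ap S x) \<le> K * norm x" using ap_bounded_pos by blast
  define y where "y n = inverse K *\<^sub>R ap S (x n)" for n
  have "norm (y n) \<le> 1" for n
  proof -
    have "norm (ap S (x n)) \<le> K * 1"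
      using K(2)[of "x n"] x K(1) by (meson less_imp_le mult_left_mono order_trans)
    then show ?thesis using K(1) by (simp add: y_def field_simps)
  qed
  then obtain r where r: "strict_mono r" "convergent (\<lambda>n. ap T (y (r n)))"
    using assms unfolding compact_op_seq by blast
  have "ap (T * S) (x n) = K *\<^sub>R ap T (y n)" for n
    using K(1) by (simp add: times_bop.rep_eq y_def linear_cmul[OF bounded_linear.linear[OF ap_bounded_linear]])
  moreover have "convergent (\<lambda>n. K *\<^sub>R ap T (y (r n)))"
    using r(2) tendsto_scaleR[OF tendsto_const] unfolding convergent_def by blast
  ultimately show "\<exists>r. strict_mono r \<and> convergent (\<lambda>n. ap (T * S) (x (r n)))"
    using r(1) by auto
qed

lemma compact_op_scaleC: "compact_op T \<Longrightarrow> compact_op (c *\<^sub>C T)"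
  using compact_op_mult_left[of T "c *\<^sub>C 1"] by (simp add: mult_scaleC_left)

lemma compact_op_uminus: "compact_op T \<Longrightarrow> compact_op (- T)"
  unfolding uminus_bop_def by (rule compact_op_scaleC)

lemma compact_op_diff: "compact_op S \<Longrightarrow> compact_op T \<Longrightarrow> compact_op (S - T)"
  using compact_op_add[of S "- T"] compact_op_uminus[of T] by simp

lemma compact_op_star:
  assumes "compact_op T" shows "compact_op (star T)"
  unfolding compact_op_seq
proof (intro allI impI)
  fix x :: "nat \<Rightarrow> 'a" assume x: "\<forall>n. norm (x n) \<le> 1"
  obtain r where r: "strict_mono r" "convergent (\<lambda>n. ap (T * star T) (x (r n)))"
    using compact_op_mult_right[OF assms] x unfolding compact_op_seq by blast
  define z where "z n = ap (T * star T) (x (r n))" for n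
  have z: "Cauchy z" using r(2) convergent_Cauchy unfolding z_def by blast
  have est: "(norm (ap (star T) (x (r p)) - ap (star T) (x (r q))))\<^sup>2 \<le> 2 * norm (z p - z q)" for p q
  proof -
    define d where "d = x (r p) - x (r q)"
    have "complex_of_real ((norm (ap (star T) d))\<^sup>2) = cinner d (ap T (ap (star T) d))"
      by (simp only: cinner_self[symmetric] star_bop_cinner)
    also have "ap T (ap (star T) d) = z p - z q"
      by (simp add: z_def times_bop.rep_eq d_def ap_diff_right)
    finally have "(norm (ap (star T) d))\<^sup>2 = cmod (cinner d (z p - z q))"
      by (metis abs_norm_cancel norm_of_real power2_abs power_abs)
    also have "\<dots> \<le> norm d * norm (z p - z q)" by (rule cauchy_schwarz)
    also have "\<dots> \<le> 2 * norm (z p - z q)"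
    proof (rule mult_right_mono)
      show "norm d \<le> 2" unfolding d_def
        using norm_triangle_ineq4[of "x (r p)" "x (r q)"] x by (smt (verit))
    qed simp
    finally show ?thesis by (simp add: d_def ap_diff_right)
  qed
  have "Cauchy (\<lambda>n. ap (star T) (x (r n)))"
  proof (rule metric_CauchyI)
    fix e :: real assume e: "e > 0"
    then obtain M where M: "\<And>p q. p \<ge> M \<Longrightarrow> q \<ge> M \<Longrightarrow> dist (z p) (z q) < e\<^sup>2 / 2"
      using metric_CauchyD[OF z, of "e\<^sup>2/2"] by auto
    have "dist (ap (star T) (x (r p))) (ap (star T) (x (r q))) < e" if "p \<ge> M" "q \<ge> M" for p q
    proof -
      have "(dist (ap (star T) (x (r p))) (ap (star T) (x (r q))))\<^sup>2 < e\<^sup>2"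
        using est[of p q] M[OF that] by (simp add: dist_norm)
      then show ?thesis using e by (simp add: power2_less_imp_less)
    qed
    then show "\<exists>M. \<forall>p\<ge>M. \<forall>q\<ge>M. dist (ap (star T) (x (r p))) (ap (star T) (x (r q))) < e"
      by blast
  qed
  then show "\<exists>r. strict_mono r \<and> convergent (\<lambda>n. ap (star T) (x (r n)))"
    using r(1) Cauchy_convergent by blast
qed

quotient_type (overloaded) 'h calkin =
  "'h::chilbert_space bop" / "\<lambda>S T. compact_op (S - T)"
  morphisms rep_calkin calkin_proj
proof (intro equivpI reflpI sympI transpI)
  fix S T R :: "'h bop"
  show "compact_op (S - S)" by (simp add: compact_op_zero)
  show "compact_op (T - S)" if "compact_op (S - T)"
    using compact_op_uminus[OF that] by simp
  show "compact_op (S - R)" if "compact_op (S - T)" "compact_op (T - R)"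
    using compact_op_add[OF that] by simp
qed

instantiation calkin :: (chilbert_space) unital_star_algebra
begin

lift_definition zero_calkin :: "'a calkin" is 0 .

lift_definition one_calkin :: "'a calkin" is 1 .

lift_definition plus_calkin :: "'a calkin \<Rightarrow> 'a calkin \<Rightarrow> 'a calkin" is "(+)"
proof -
  fix S S' T T' :: "'a bop" assume "compact_op (S - S')" "compact_op (T - T')"
  from compact_op_add[OF this] show "compact_op ((S + T) - (S' + T'))" by (simp add: algebra_simps)
qed

lift_definition uminus_calkin :: "'a calkin \<Rightarrow> 'a calkin" is uminus
proof -
  fix S T :: "'a bop" assume "compact_op (S - T)"
  from compact_op_uminus[OF this] show "compact_op (- S - - T)" by simp
qed

lift_definition minus_calkin :: "'a calkin \<Rightarrow> 'a calkin \<Rightarrow> 'a calkin" is "(-)"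
proof -
  fix S S' T T' :: "'a bop" assume "compact_op (S - S')" "compact_op (T - T')"
  from compact_op_diff[OF this] show "compact_op ((S - T) - (S' - T'))" by (simp add: algebra_simps)
qed

lift_definition scaleC_calkin :: "complex \<Rightarrow> 'a calkin \<Rightarrow> 'a calkin" is scaleC
  by (simp add: compact_op_scaleC flip: scaleC_diff_right)

lift_definition times_calkin :: "'a calkin \<Rightarrow> 'a calkin \<Rightarrow> 'a calkin" is "(*)"
proof -
  fix S S' T T' :: "'a bop" assume *: "compact_op (S - S')" "compact_op (T - T')"
  have "S * T - S' * T' = (S - S') * T + S' * (T - T')" by (simp add: algebra_simps)
  then show "compact_op (S * T - S' * T')"
    using * by (simp add: compact_op_add compact_op_mult_left compact_op_mult_right)
qed

lift_definition star_calkin :: "'a calkin \<Rightarrow> 'a calkin" is star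
  by (simp add: compact_op_star flip: star_diff)

lemma calkin_eqI: "S = T \<Longrightarrow> compact_op (S - T :: 'a bop)"
  by (simp add: compact_op_zero)

instance
proof
  fix a b c :: "'a calkin" and r s :: complex
  show "a + b + c = a + (b + c)" by transfer (rule calkin_eqI, simp add: add.assoc)
  show "a + b = b + a" by transfer (rule calkin_eqI, simp add: add.commute)
  show "0 + a = a" by transfer (rule calkin_eqI, simp)
  show "- a + a = 0" by transfer (rule calkin_eqI, simp)
  show "a - b = a + - b" by transfer (rule calkin_eqI, simp)
  show "a * b * c = a * (b * c)" by transfer (rule calkin_eqI, simp add: mult.assoc)
  show "(a + b) * c = a * c + b * c" by transfer (rule calkin_eqI, simp add: distrib_right)
  show "a * (b + c) = a * b + a * c" by transfer (rule calkin_eqI, simp add: distrib_left)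
  show "1 * a = a" by transfer (rule calkin_eqI, simp)
  show "a * 1 = a" by transfer (rule calkin_eqI, simp)
  show "r *\<^sub>C (a + b) = r *\<^sub>C a + r *\<^sub>C b" by transfer (rule calkin_eqI, rule scaleC_add_right)
  show "(r + s) *\<^sub>C a = r *\<^sub>C a + s *\<^sub>C a" by transfer (rule calkin_eqI, rule scaleC_add_left)
  show "r *\<^sub>C s *\<^sub>C a = (r * s) *\<^sub>C a" by transfer (rule calkin_eqI, simp)
  show "1 *\<^sub>C a = a" by transfer (rule calkin_eqI, simp)
  show "r *\<^sub>C a * b = r *\<^sub>C (a * b)" by transfer (rule calkin_eqI, rule mult_scaleC_left)
  show "a * r *\<^sub>C b = r *\<^sub>C (a * b)" by transfer (rule calkin_eqI, rule mult_scaleC_right)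
  show "star (a + b) = star a + star b" by transfer (rule calkin_eqI, rule star_add)
  show "star (r *\<^sub>C a) = cnj r *\<^sub>C star a" by transfer (rule calkin_eqI, rule star_scaleC)
  show "star (a * b) = star b * star a" by transfer (rule calkin_eqI, rule star_mult)
  show "star (star a) = a" by transfer (rule calkin_eqI, simp)
qed

end

lemma calkin_proj_star_hom: "unital_star_hom calkin_proj"
  unfolding unital_star_hom_def
  by (simp add: plus_calkin.abs_eq scaleC_calkin.abs_eq times_calkin.abs_eq star_calkin.abs_eq one_calkin_def)

lemma calkin_proj_eq_iff: "calkin_proj S = calkin_proj T \<longleftrightarrow> compact_op (S - T)"
  by (rule calkin.abs_eq_iff)


section \<open>Matrix algebras, positivity and ucp maps\<close>

text \<open>All matrix algebras over \<open>'a\<close> live in the type \<open>'a fmat\<close> of infinite matrices with finitely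
  many nonzero entries: \<open>Mat k A\<close> below is the copy of $M_k(A)$ in the upper left corner.
  This allows the size \<open>k\<close> to be a quantified natural number while iterated matrix algebras
  $M_k(M_m(A))$, whose elements have type \<open>'a fmat fmat\<close>, stay available.\<close>

typedef (overloaded) ('a::zero) fmat =
  "{f :: nat \<Rightarrow> nat \<Rightarrow> 'a. \<exists>N. \<forall>i j. N \<le> i \<or> N \<le> j \<longrightarrow> f i j = 0}"
  morphisms entry Abs_fmat
  by (rule exI[of _ "\<lambda>_ _. 0"]) simp

setup_lifting type_definition_fmat

lemma fmat_eqI: "(\<And>i j. entry x i j = entry y i j) \<Longrightarrow> x = y"
  by (simp add: entry_inject[symmetric] fun_eq_iff)

lemma entry_bound: "\<exists>N. \<forall>i j. N \<le> i \<or> N \<le> j \<longrightarrow> entry x i j = 0"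
  using entry[of x] by simp

lift_definition mk_fmat :: "nat \<Rightarrow> (nat \<Rightarrow> nat \<Rightarrow> 'a::zero) \<Rightarrow> 'a fmat" is
  "\<lambda>k f i j. if i < k \<and> j < k then f i j else 0"
  by (metis not_less)

instantiation fmat :: (star_algebra) star_algebra
begin

lift_definition zero_fmat :: "'a fmat" is "\<lambda>_ _. 0"
  by simp

lift_definition plus_fmat :: "'a fmat \<Rightarrow> 'a fmat \<Rightarrow> 'a fmat" is "\<lambda>x y i j. x i j + y i j"
proof -
  fix x y :: "nat \<Rightarrow> nat \<Rightarrow> 'a"
  assume "\<exists>N. \<forall>i j. N \<le> i \<or> N \<le> j \<longrightarrow> x i j = 0" "\<exists>N. \<forall>i j. N \<le> i \<or> N \<le> j \<longrightarrow> y i j = 0"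
  then obtain M N where "\<forall>i j. M \<le> i \<or> M \<le> j \<longrightarrow> x i j = 0" "\<forall>i j. N \<le> i \<or> N \<le> j \<longrightarrow> y i j = 0"
    by blast
  then show "\<exists>N. \<forall>i j. N \<le> i \<or> N \<le> j \<longrightarrow> x i j + y i j = 0"
    by (intro exI[of _ "max M N"]) auto
qed

lift_definition uminus_fmat :: "'a fmat \<Rightarrow> 'a fmat" is "\<lambda>x i j. - x i j"
  by auto

definition minus_fmat :: "'a fmat \<Rightarrow> 'a fmat \<Rightarrow> 'a fmat" where
  "minus_fmat x y = x + (- y)"

lift_definition scaleC_fmat :: "complex \<Rightarrow> 'a fmat \<Rightarrow> 'a fmat" is "\<lambda>c x i j. c *\<^sub>C x i j"
  by (metis scaleC_zero_right)

lift_definition star_fmat :: "'a fmat \<Rightarrow> 'a fmat" is "\<lambda>x i j. star (x j i)"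
  by (metis star_zero)

text \<open>The sum is the usual one \<open>\<Sum>l. x i l * y l j\<close>, restricted to the finitely many \<open>l\<close> for which
  \<open>x i l\<close> is nonzero.\<close>

lift_definition times_fmat :: "'a fmat \<Rightarrow> 'a fmat \<Rightarrow> 'a fmat" is
  "\<lambda>x y i j. \<Sum>l | x i l \<noteq> 0. x i l * y l j"
proof -
  fix x y :: "nat \<Rightarrow> nat \<Rightarrow> 'a"
  assume "\<exists>N. \<forall>i j. N \<le> i \<or> N \<le> j \<longrightarrow> x i j = 0" "\<exists>N. \<forall>i j. N \<le> i \<or> N \<le> j \<longrightarrow> y i j = 0"
  then obtain M N where "\<forall>i j. M \<le> i \<or> M \<le> j \<longrightarrow> x i j = 0" "\<forall>i j. N \<le> i \<or> N \<le> j \<longrightarrow> y i j = 0"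
    by blast
  then show "\<exists>N. \<forall>i j. N \<le> i \<or> N \<le> j \<longrightarrow> (\<Sum>l | x i l \<noteq> 0. x i l * y l j) = 0"
    by (intro exI[of _ "max M N"]) auto
qed

lemma entry_times:
  assumes "\<And>l. N \<le> l \<Longrightarrow> entry x i l = 0 \<or> entry y l j = 0"
  shows "entry (x * y) i j = (\<Sum>l<N. entry x i l * entry y l j)"
proof -
  obtain M where M: "\<And>i l. M \<le> l \<Longrightarrow> entry x i l = 0" using entry_bound[of x] by blast
  have fin: "finite {l. entry x i l \<noteq> 0}"
    by (rule finite_subset[of _ "{..<M}"]) (auto simp flip: not_le intro: M)
  have "(\<Sum>l | entry x i l \<noteq> 0. entry x i l * entry y l j)
      = (\<Sum>l\<in>{l. entry x i l \<noteq> 0} \<union> {..<N}. entry x i l * entry y l j)"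
    by (rule sum.mono_neutral_left) (auto simp: fin)
  also have "\<dots> = (\<Sum>l<N. entry x i l * entry y l j)"
  proof (rule sum.mono_neutral_right)
    show "\<forall>l\<in>({l. entry x i l \<noteq> 0} \<union> {..<N}) - {..<N}. entry x i l * entry y l j = 0"
      using assms by (metis DiffD2 lessThan_iff mult_zero_left mult_zero_right not_less)
  qed (auto simp: fin)
  finally show ?thesis by (simp add: times_fmat.rep_eq)
qed

instance
proof
  fix a b c :: "'a fmat" and r s :: complex
  obtain A B C where *: "\<And>i j. A \<le> i \<or> A \<le> j \<Longrightarrow> entry a i j = 0"
    "\<And>i j. B \<le> i \<or> B \<le> j \<Longrightarrow> entry b i j = 0" "\<And>i j. C \<le> i \<or> C \<le> j \<Longrightarrow> entry c i j = 0"
    using entry_bound by metis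
  define N where "N = max A (max B C)"
  have 0: "entry x i j = 0" if "N \<le> i \<or> N \<le> j" "x = a \<or> x = b \<or> x = c" for x i j
    using that * unfolding N_def by auto
  note sums = plus_fmat.rep_eq scaleC_fmat.rep_eq star_fmat.rep_eq
  show "a + b + c = a + (b + c)" by transfer (simp add: add.assoc)
  show "a + b = b + a" by transfer (simp add: add.commute)
  show "0 + a = a" by transfer simp
  show "- a + a = 0" by transfer simp
  show "a - b = a + - b" by (simp add: minus_fmat_def)
  show "r *\<^sub>C (a + b) = r *\<^sub>C a + r *\<^sub>C b" by transfer (simp add: scaleC_add_right)
  show "(r + s) *\<^sub>C a = r *\<^sub>C a + s *\<^sub>C a" by transfer (simp add: scaleC_add_left)
  show "r *\<^sub>C s *\<^sub>C a = (r * s) *\<^sub>C a" by transfer simp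
  show "1 *\<^sub>C a = a" by transfer simp
  show "star (a + b) = star a + star b" by transfer (simp add: star_add)
  show "star (r *\<^sub>C a) = cnj r *\<^sub>C star a" by transfer (simp add: star_scaleC)
  show "star (star a) = a" by transfer simp
  have ab: "entry (a * b) i j = (\<Sum>l<N. entry a i l * entry b l j)" for i j
    by (rule entry_times) (simp add: 0)
  have bc: "entry (b * c) i j = (\<Sum>l<N. entry b i l * entry c l j)" for i j
    by (rule entry_times) (simp add: 0)
  have ac: "entry (a * c) i j = (\<Sum>l<N. entry a i l * entry c l j)" for i j
    by (rule entry_times) (simp add: 0)
  show "a * b * c = a * (b * c)"
  proof (rule fmat_eqI)
    fix i j
    have "entry (a * b * c) i j = (\<Sum>l<N. entry (a * b) i l * entry c l j)"
      by (rule entry_times) (simp add: 0)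
    also have "\<dots> = (\<Sum>m<N. entry a i m * entry (b * c) m j)"
      by (simp add: ab bc sum_distrib_left sum_distrib_right mult.assoc) (rule sum.swap)
    also have "\<dots> = entry (a * (b * c)) i j"
      by (rule entry_times[symmetric]) (simp add: 0)
    finally show "entry (a * b * c) i j = entry (a * (b * c)) i j" .
  qed
  show "(a + b) * c = a * c + b * c"
  proof (rule fmat_eqI)
    fix i j
    have "entry ((a + b) * c) i j = (\<Sum>l<N. entry (a + b) i l * entry c l j)"
      by (rule entry_times) (simp add: 0)
    then show "entry ((a + b) * c) i j = entry (a * c + b * c) i j"
      by (simp add: sums ac bc distrib_right sum.distrib)
  qed
  show "a * (b + c) = a * b + a * c"
  proof (rule fmat_eqI)
    fix i j
    have "entry (a * (b + c)) i j = (\<Sum>l<N. entry a i l * entry (b + c) l j)"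
      by (rule entry_times) (simp add: 0)
    then show "entry (a * (b + c)) i j = entry (a * b + a * c) i j"
      by (simp add: sums ac ab distrib_left sum.distrib)
  qed
  show "r *\<^sub>C a * b = r *\<^sub>C (a * b)"
  proof (rule fmat_eqI)
    fix i j
    have "entry (r *\<^sub>C a * b) i j = (\<Sum>l<N. entry (r *\<^sub>C a) i l * entry b l j)"
      by (rule entry_times) (simp add: 0)
    then show "entry (r *\<^sub>C a * b) i j = entry (r *\<^sub>C (a * b)) i j"
      by (simp add: sums ab scaleC_sum_right mult_scaleC_left)
  qed
  show "a * r *\<^sub>C b = r *\<^sub>C (a * b)"
  proof (rule fmat_eqI)
    fix i j
    have "entry (a * r *\<^sub>C b) i j = (\<Sum>l<N. entry a i l * entry (r *\<^sub>C b) l j)"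
      by (rule entry_times) (simp add: 0)
    then show "entry (a * r *\<^sub>C b) i j = entry (r *\<^sub>C (a * b)) i j"
      by (simp add: sums ab scaleC_sum_right mult_scaleC_right)
  qed
  show "star (a * b) = star b * star a"
  proof (rule fmat_eqI)
    fix i j
    have "entry (star b * star a) i j = (\<Sum>l<N. entry (star b) i l * entry (star a) l j)"
      by (rule entry_times) (simp add: 0 sums)
    then show "entry (star (a * b)) i j = entry (star b * star a) i j"
      by (simp add: sums ab star_sum star_mult)
  qed
qed

end

definition Mat :: "nat \<Rightarrow> 'a::star_algebra set \<Rightarrow> 'a fmat set" where
  "Mat k A = {mk_fmat k f | f. \<forall>i<k. \<forall>j<k. f i j \<in> A}"

definition amplify :: "nat \<Rightarrow> ('a::star_algebra \<Rightarrow> 'b::star_algebra) \<Rightarrow> 'a fmat \<Rightarrow> 'b fmat" where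
  "amplify k \<phi> x = mk_fmat k (\<lambda>i j. \<phi> (entry x i j))"

text \<open>In what follows a C*-algebra is given as a *-subalgebra \<open>A\<close> of a type; its unit need not be
  a unit of the type. Order and complete positivity only depend on the *-algebra structure:
  the positive elements of a C*-algebra are those of the form $y^*y$.\<close>

definition unit_of :: "'a::star_algebra set \<Rightarrow> 'a" where
  "unit_of A = (THE e. e \<in> A \<and> (\<forall>x\<in>A. e * x = x \<and> x * e = x))"

definition positive_in :: "'a::star_algebra set \<Rightarrow> 'a \<Rightarrow> bool" where
  "positive_in A x \<longleftrightarrow> (\<exists>y\<in>A. x = star y * y)"

definition operator_subsystem :: "'a::star_algebra set \<Rightarrow> 'a set \<Rightarrow> bool" where
  "operator_subsystem A S \<longleftrightarrow>
     S \<subseteq> A \<and> csubspace S \<and> (\<forall>x\<in>S. star x \<in> S) \<and> unit_of A \<in> S"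

definition completely_positive ::
    "'a::star_algebra set \<Rightarrow> 'a set \<Rightarrow> ('a \<Rightarrow> 'b::star_algebra) \<Rightarrow> bool" where
  "completely_positive A S \<phi> \<longleftrightarrow>
     (\<forall>k. \<forall>x\<in>Mat k S. positive_in (Mat k A) x \<longrightarrow> positive_in (Mat k UNIV) (amplify k \<phi> x))"

definition ucp :: "'a::star_algebra set \<Rightarrow> 'a set \<Rightarrow> ('a \<Rightarrow> 'b::unital_star_algebra) \<Rightarrow> bool" where
  "ucp A S \<phi> \<longleftrightarrow>
     (\<forall>x\<in>S. \<forall>y\<in>S. \<phi> (x + y) = \<phi> x + \<phi> y) \<and> (\<forall>c. \<forall>x\<in>S. \<phi> (c *\<^sub>C x) = c *\<^sub>C \<phi> x) \<and>
     \<phi> (unit_of A) = 1 \<and> completely_positive A S \<phi>"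

definition has_ucp_lift ::
    "'a::star_algebra set \<Rightarrow> 'a set \<Rightarrow> ('a \<Rightarrow> 'h::chilbert_space calkin) \<Rightarrow> bool" where
  "has_ucp_lift A S \<phi> \<longleftrightarrow>
     (\<exists>\<psi> :: 'a \<Rightarrow> 'h bop. ucp A S \<psi> \<and> (\<forall>x\<in>S. calkin_proj (\<psi> x) = \<phi> x))"

lemma mem_Mat_iff:
  "x \<in> Mat k A \<longleftrightarrow> (\<forall>i<k. \<forall>j<k. entry x i j \<in> A) \<and> (\<forall>i j. \<not> (i < k \<and> j < k) \<longrightarrow> entry x i j = 0)"
proof
  assume "(\<forall>i<k. \<forall>j<k. entry x i j \<in> A) \<and> (\<forall>i j. \<not> (i < k \<and> j < k) \<longrightarrow> entry x i j = 0)"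
  then have "x = mk_fmat k (entry x)" "\<forall>i<k. \<forall>j<k. entry x i j \<in> A"
    by (auto intro!: fmat_eqI simp: mk_fmat.rep_eq)
  then show "x \<in> Mat k A" unfolding Mat_def by blast
qed (auto simp: Mat_def mk_fmat.rep_eq)

lemma unit_of_eqI:
  assumes "e \<in> A" "\<And>x. x \<in> A \<Longrightarrow> e * x = x" "\<And>x. x \<in> A \<Longrightarrow> x * e = x"
  shows "unit_of A = e"
  unfolding unit_of_def by (rule the_equality) (use assms in metis)+

lemma unit_of_UNIV: "unit_of (UNIV :: 'a::unital_star_algebra set) = 1"
  by (rule unit_of_eqI) auto

lemma unit_of_Mat:
  "unit_of (Mat k (UNIV :: 'a::unital_star_algebra set)) = mk_fmat k (\<lambda>i j. if i = j then 1 else 0)"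
proof (rule unit_of_eqI)
  let ?e = "mk_fmat k (\<lambda>i j. if i = j then 1 else 0) :: 'a fmat"
  show "?e \<in> Mat k UNIV" by (simp add: mem_Mat_iff mk_fmat.rep_eq)
  fix x :: "'a fmat" assume "x \<in> Mat k UNIV"
  then have x: "\<And>i j. \<not> (i < k \<and> j < k) \<Longrightarrow> entry x i j = 0" by (simp add: mem_Mat_iff)
  have e: "entry ?e i j = (if i = j \<and> i < k then 1 else 0)" for i j by (simp add: mk_fmat.rep_eq)
  show "?e * x = x"
  proof (rule fmat_eqI)
    fix i j
    have "entry (?e * x) i j = (\<Sum>l<k. entry ?e i l * entry x l j)"
      by (rule entry_times) (auto simp: e)
    also have "\<dots> = (\<Sum>l<k. if l = i then entry x i j else 0)"
      by (rule sum.cong) (auto simp: e)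
    finally show "entry (?e * x) i j = entry x i j" by (simp add: x)
  qed
  show "x * ?e = x"
  proof (rule fmat_eqI)
    fix i j
    have "entry (x * ?e) i j = (\<Sum>l<k. entry x i l * entry ?e l j)"
      by (rule entry_times) (simp add: e)
    also have "\<dots> = (\<Sum>l<k. if l = j then entry x i j else 0)"
      by (rule sum.cong) (auto simp: e)
    finally show "entry (x * ?e) i j = entry x i j" by (simp add: x)
  qed
qed


section \<open>Conjugation by a unitary from the m-fold sum of a Hilbert space\<close>

text \<open>The Hilbert space $H \otimes \mathbb{C}^m$ is the space \<open>hsum m\<close> of sequences in \<open>H\<close> that vanish
  from index \<open>m\<close> on, with the inner product \<open>hsum_inner m\<close>. Maps out of it are only
  considered on \<open>hsum m\<close>.\<close>

definition hsum :: "nat \<Rightarrow> (nat \<Rightarrow> 'h::chilbert_space) set" where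
  "hsum m = {f. \<forall>i\<ge>m. f i = 0}"

definition hsum_inner :: "nat \<Rightarrow> (nat \<Rightarrow> 'h::chilbert_space) \<Rightarrow> (nat \<Rightarrow> 'h) \<Rightarrow> complex" where
  "hsum_inner m f g = (\<Sum>i<m. cinner (f i) (g i))"

definition hsum_unitary :: "nat \<Rightarrow> ((nat \<Rightarrow> 'h::chilbert_space) \<Rightarrow> 'h) \<Rightarrow> bool" where
  "hsum_unitary m V \<longleftrightarrow>
     (\<forall>f\<in>hsum m. \<forall>g\<in>hsum m. V (\<lambda>i. f i + g i) = V f + V g) \<and>
     (\<forall>c. \<forall>f\<in>hsum m. V (\<lambda>i. c *\<^sub>C f i) = c *\<^sub>C V f) \<and>
     (\<forall>f\<in>hsum m. \<forall>g\<in>hsum m. cinner (V f) (V g) = hsum_inner m f g) \<and>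
     V ` hsum m = UNIV"

definition hsum_adjoint :: "nat \<Rightarrow> ((nat \<Rightarrow> 'h::chilbert_space) \<Rightarrow> 'h) \<Rightarrow> 'h \<Rightarrow> nat \<Rightarrow> 'h" where
  "hsum_adjoint m V h = (THE f. f \<in> hsum m \<and> (\<forall>g\<in>hsum m. hsum_inner m f g = cinner h (V g)))"

definition fmat_ap :: "nat \<Rightarrow> 'h::chilbert_space bop fmat \<Rightarrow> (nat \<Rightarrow> 'h) \<Rightarrow> nat \<Rightarrow> 'h" where
  "fmat_ap m X f = (\<lambda>i. if i < m then \<Sum>j<m. ap (entry X i j) (f j) else 0)"

definition conj_bop ::
    "nat \<Rightarrow> ((nat \<Rightarrow> 'h::chilbert_space) \<Rightarrow> 'h) \<Rightarrow> 'h bop fmat \<Rightarrow> 'h bop" where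
  "conj_bop m V X = Abs_bop (\<lambda>h. V (fmat_ap m X (hsum_adjoint m V h)))"

text \<open>The induced map \<open>Mat m (UNIV :: 'h calkin set) \<rightarrow> 'h calkin\<close>, computed on an arbitrary entrywise
  representative; see \<open>amplify_calkin_proj_surj\<close> and
  \<open>conj_calkin_amplify\<close> for existence and independence of the choice.\<close>

definition conj_calkin ::
    "nat \<Rightarrow> ((nat \<Rightarrow> 'h::chilbert_space) \<Rightarrow> 'h) \<Rightarrow> 'h calkin fmat \<Rightarrow> 'h calkin" where
  "conj_calkin m V x =
     calkin_proj (conj_bop m V (SOME X. X \<in> Mat m UNIV \<and> amplify m calkin_proj X = x))"

lemma hsum_adjoint_eq:
  assumes V: "hsum_unitary m V" and f: "f \<in> hsum m"
  shows "hsum_adjoint m V (V f) = f"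
  unfolding hsum_adjoint_def
proof (rule the_equality)
  show "f \<in> hsum m \<and> (\<forall>g\<in>hsum m. hsum_inner m f g = cinner (V f) (V g))"
    using V f by (simp add: hsum_unitary_def)
  fix f' assume f': "f' \<in> hsum m \<and> (\<forall>g\<in>hsum m. hsum_inner m f' g = cinner (V f) (V g))"
  have *: "hsum_inner m f' g = hsum_inner m f g" if "g \<in> hsum m" for g
    using V f f' that by (simp add: hsum_unitary_def)
  show "f' = f"
  proof
    fix i
    show "f' i = f i"
    proof (cases "i < m")
      case True
      show ?thesis
      proof (rule cinner_ext_left)
        fix z
        have "hsum_inner m h (\<lambda>j. if j = i then z else 0) = cinner (h i) z" for h :: "nat \<Rightarrow> 'a"
        proof -
          have "hsum_inner m h (\<lambda>j. if j = i then z else 0) = (\<Sum>j<m. if j = i then cinner (h i) z else 0)"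
            unfolding hsum_inner_def by (rule sum.cong) auto
          then show ?thesis using True by simp
        qed
        moreover have "(\<lambda>j. if j = i then z else 0) \<in> hsum m" using True by (auto simp: hsum_def)
        ultimately show "cinner (f' i) z = cinner (f i) z" using * by metis
      qed
    next
      case False
      then show ?thesis using f f' by (auto simp: hsum_def)
    qed
  qed
qed

lemma conj_bop_eq_sum:
  assumes V: "hsum_unitary m V"
  shows "\<exists>W. (\<forall>h i. i < m \<longrightarrow> ap (W i) h = V (\<lambda>j. if j = i then h else 0)) \<and>
    (\<forall>X. conj_bop m V X = (\<Sum>i<m. \<Sum>j<m. W i * entry X i j * star (W j))) \<and>
    (\<forall>X h. ap (conj_bop m V X) h = V (fmat_ap m X (hsum_adjoint m V h)))"
proof -
  have Vadd: "V (\<lambda>i. f i + g i) = V f + V g" if "f \<in> hsum m" "g \<in> hsum m" for f g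
    using V that by (simp add: hsum_unitary_def)
  have Vscale: "V (\<lambda>i. c *\<^sub>C f i) = c *\<^sub>C V f" if "f \<in> hsum m" for c f
    using V that by (simp add: hsum_unitary_def)
  have Vinner: "cinner (V f) (V g) = hsum_inner m f g" if "f \<in> hsum m" "g \<in> hsum m" for f g
    using V that by (simp add: hsum_unitary_def)
  define e where "e i h = (\<lambda>j. if j = i then h else (0::'a))" for i :: nat and h
  have e: "e i h \<in> hsum m" if "i < m" for i h using that by (auto simp: e_def hsum_def)
  have e_add: "e i (h + k) = (\<lambda>j. e i h j + e i k j)" for i h k by (auto simp: e_def)
  have e_scale: "e i (c *\<^sub>C h) = (\<lambda>j. c *\<^sub>C e i h j)" for i c h by (auto simp: e_def)
  have e_inner: "hsum_inner m (e i h) g = cinner h (g i)" if "i < m" for i h g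
  proof -
    have "hsum_inner m (e i h) g = (\<Sum>j<m. if j = i then cinner h (g i) else 0)"
      unfolding hsum_inner_def e_def by (rule sum.cong) auto
    then show ?thesis using that by simp
  qed
  define W where "W i = Abs_bop (\<lambda>h. V (e i h))" for i
  have W: "ap (W i) h = V (e i h)" if i: "i < m" for i h
  proof -
    have "complex_of_real ((norm (V (e i h)))\<^sup>2) = complex_of_real ((norm h)\<^sup>2)" for h
      using i by (simp only: cinner_self[symmetric] Vinner e e_inner) (simp add: e_def)
    then have "(norm (V (e i h)))\<^sup>2 = (norm h)\<^sup>2" for h using of_real_eq_iff by blast
    then have "norm (V (e i h)) \<le> 1 * norm h" for h by simp
    then have "bounded_clinear (\<lambda>h. V (e i h))" unfolding bounded_clinear_def
      using i by (auto simp only: e_add e_scale Vadd Vscale e)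
    then show ?thesis by (simp add: W_def Abs_bop_inverse)
  qed
  have Vsum: "V f = (\<Sum>i<m. ap (W i) (f i))" if f: "f \<in> hsum m" for f
  proof -
    define t where "t n = (\<lambda>j. if j < n then f j else 0)" for n
    have t: "t n \<in> hsum m" for n using f by (auto simp: t_def hsum_def)
    have z: "(\<lambda>_. 0) \<in> hsum m" by (simp add: hsum_def)
    have V0: "V (\<lambda>_. 0) = 0" using Vadd[OF z z] by simp
    have "n \<le> m \<Longrightarrow> V (t n) = (\<Sum>i<n. ap (W i) (f i))" for n
    proof (induction n)
      case 0
      show ?case using V0 by (simp add: t_def)
    next
      case (Suc n)
      have "t (Suc n) = (\<lambda>j. t n j + e n (f n) j)" by (auto simp: t_def e_def)
      with Suc show ?case by (simp add: Vadd t e W)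
    qed
    moreover have "t m = f" using f by (auto simp: t_def hsum_def)
    ultimately show ?thesis by (metis order_refl)
  qed
  have adj: "hsum_adjoint m V h \<in> hsum m" "V (hsum_adjoint m V h) = h" for h
  proof -
    obtain f where "f \<in> hsum m" "h = V f" using V unfolding hsum_unitary_def by blast
    then show "hsum_adjoint m V h \<in> hsum m" "V (hsum_adjoint m V h) = h"
      by (simp_all add: hsum_adjoint_eq[OF V])
  qed
  have adjW: "hsum_adjoint m V h i = ap (star (W i)) h" if i: "i < m" for h i
  proof (rule cinner_ext)
    fix z
    have "cinner z (hsum_adjoint m V h i) = hsum_inner m (e i z) (hsum_adjoint m V h)"
      using i by (simp add: e_inner)
    also have "\<dots> = cinner (ap (W i) z) h"
      using i by (simp add: Vinner[symmetric] e adj W)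
    also have "\<dots> = cinner z (ap (star (W i)) h)"
      using star_bop_cinner[of "star (W i)" z h] by simp
    finally show "cinner z (hsum_adjoint m V h i) = cinner z (ap (star (W i)) h)" .
  qed
  have "conj_bop m V X = (\<Sum>i<m. \<Sum>j<m. W i * entry X i j * star (W j))" (is "_ = ?S")
    and "\<forall>h. ap (conj_bop m V X) h = V (fmat_ap m X (hsum_adjoint m V h))" for X
  proof -
    have "V (fmat_ap m X (hsum_adjoint m V h)) = ap ?S h" for h
    proof -
      have "fmat_ap m X (hsum_adjoint m V h) \<in> hsum m" by (simp add: fmat_ap_def hsum_def)
      then have "V (fmat_ap m X (hsum_adjoint m V h))
          = (\<Sum>i<m. ap (W i) (\<Sum>j<m. ap (entry X i j) (hsum_adjoint m V h j)))"
        by (simp add: Vsum fmat_ap_def)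
      also have "\<dots> = ap ?S h"
        by (simp add: ap_sum_right ap_sum_left times_bop.rep_eq adjW)
      finally show ?thesis .
    qed
    then have "(\<lambda>h. V (fmat_ap m X (hsum_adjoint m V h))) = ap ?S" by auto
    then show "conj_bop m V X = ?S" "\<forall>h. ap (conj_bop m V X) h = V (fmat_ap m X (hsum_adjoint m V h))"
      unfolding conj_bop_def by (simp_all add: ap_inverse fun_eq_iff)
  qed
  then show ?thesis using W unfolding e_def by blast
qed

lemma calkin_proj_zero: "calkin_proj S = 0 \<longleftrightarrow> compact_op S"
  using calkin_proj_eq_iff[of S 0] by (simp add: zero_calkin_def)

lemma compact_op_sum: "(\<And>i. i \<in> I \<Longrightarrow> compact_op (T i)) \<Longrightarrow> compact_op (\<Sum>i\<in>I. T i)"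
  by (induction I rule: infinite_finite_induct) (simp_all add: compact_op_zero compact_op_add)

lemma amplify_calkin_proj_surj:
  assumes "x \<in> Mat m UNIV"
  shows "\<exists>X\<in>Mat m UNIV. amplify m calkin_proj X = x"
proof (intro bexI fmat_eqI)
  show "amplify m rep_calkin x \<in> Mat m UNIV" by (auto simp: amplify_def Mat_def)
  show "entry (amplify m calkin_proj (amplify m rep_calkin x)) i j = entry x i j" for i j
    using assms Quotient3_abs_rep[OF Quotient3_calkin]
    by (auto simp: amplify_def mk_fmat.rep_eq mem_Mat_iff)
qed

lemma conj_calkin_amplify:
  assumes V: "hsum_unitary m V" and X: "X \<in> Mat m UNIV"
  shows "conj_calkin m V (amplify m calkin_proj X) = calkin_proj (conj_bop m V X)"
proof -
  define Y where "Y = (SOME Y. Y \<in> Mat m UNIV \<and> amplify m calkin_proj Y = amplify m calkin_proj X)"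
  have Y: "Y \<in> Mat m UNIV \<and> amplify m calkin_proj Y = amplify m calkin_proj X"
    unfolding Y_def by (rule someI[of _ X]) (simp add: X)
  obtain W where W: "\<And>X. conj_bop m V X = (\<Sum>i<m. \<Sum>j<m. W i * entry X i j * star (W j))"
    using conj_bop_eq_sum[OF V] by blast
  have c: "compact_op (entry Y i j - entry X i j)" if "i < m" "j < m" for i j
  proof -
    have "entry (amplify m calkin_proj Y) i j = entry (amplify m calkin_proj X) i j" using Y by simp
    then show ?thesis using that by (simp add: amplify_def mk_fmat.rep_eq calkin_proj_eq_iff)
  qed
  have "conj_bop m V Y - conj_bop m V X
      = (\<Sum>i<m. \<Sum>j<m. W i * (entry Y i j - entry X i j) * star (W j))"
    by (simp add: W sum_subtractf left_diff_distrib right_diff_distrib)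
  also have "compact_op \<dots>"
    by (intro compact_op_sum compact_op_mult_right compact_op_mult_left c) auto
  finally show ?thesis
    unfolding conj_calkin_def Y_def[symmetric] by (simp add: calkin_proj_eq_iff)
qed


section \<open>The semigroup Ext\<close>

definition extensions :: "('a::unital_cstar_algebra \<Rightarrow> 'h::chilbert_space calkin) set" where
  "extensions = {\<rho>. unital_star_hom \<rho> \<and> inj \<rho>}"

definition ext_rel ::
    "(('a::unital_cstar_algebra \<Rightarrow> 'h::chilbert_space calkin) \<times> ('a \<Rightarrow> 'h calkin)) set" where
  "ext_rel = {(\<rho>, \<sigma>). \<rho> \<in> extensions \<and> \<sigma> \<in> extensions \<and>
     (\<exists>U. unitary U \<and> (\<forall>a. \<sigma> a = calkin_proj U * \<rho> a * star (calkin_proj U)))}"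

definition direct_sum ::
    "('a \<Rightarrow> 'b::star_algebra) \<Rightarrow> ('a \<Rightarrow> 'b) \<Rightarrow> 'a \<Rightarrow> 'b fmat" where
  "direct_sum \<rho> \<sigma> a =
     mk_fmat 2 (\<lambda>i j. if i = 0 \<and> j = 0 then \<rho> a else if i = 1 \<and> j = 1 then \<sigma> a else 0)"

text \<open>The class $[\rho] + [\sigma]$ consists of all $W(\rho' \oplus \sigma')W^*$ with $\rho' \in [\rho]$,
  $\sigma' \in [\sigma]$ and a unitary $W : H \oplus H \to H$; no choice of representatives or of the identification
  of $H \oplus H$ with $H$ is needed.\<close>

definition ext_add ::
    "('a::unital_cstar_algebra \<Rightarrow> 'h::chilbert_space calkin) set \<Rightarrow> ('a \<Rightarrow> 'h calkin) set
      \<Rightarrow> ('a \<Rightarrow> 'h calkin) set" where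
  "ext_add P Q =
     {\<lambda>a. conj_calkin 2 W (direct_sum \<rho> \<sigma> a) | W \<rho> \<sigma>. hsum_unitary 2 W \<and> \<rho> \<in> P \<and> \<sigma> \<in> Q}"

text \<open>The library's monoid records carry a designated unit, which a semigroup does not have a priori:
  \<open>e\<close> is a candidate for it.\<close>

definition Ext ::
    "('a::unital_cstar_algebra \<Rightarrow> 'h::chilbert_space calkin) set
      \<Rightarrow> ('a \<Rightarrow> 'h calkin) set monoid" where
  "Ext e = \<lparr>carrier = extensions // ext_rel, mult = ext_add, one = e\<rparr>"

definition Ext_is_group ::
    "'a::unital_cstar_algebra itself \<Rightarrow> 'h::chilbert_space itself \<Rightarrow> bool" where
  "Ext_is_group _ _ \<longleftrightarrow> (\<exists>e :: ('a \<Rightarrow> 'h calkin) set. group (Ext e))"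

end

theory Submission
  imports Defs
begin

text \<open>
  A lift on a small operator system is forced to be multiplicative modulo the compact operators
  as soon as the system contains enough unitaries, and it then yields a lift of the whole algebra.

  Every element of the algebra \<open>A\<close> is a combination of unitaries, so finitely many unitaries
  \<open>v 0, \<dots>, v (r - 1)\<close> generate \<open>A\<close>. Over \<open>A\<close> consider the matrices of size
  \<open>m = r + 3\<close>: a scalar diagonal unitary \<open>u\<close> with distinct eigenvalues, and the self-adjoint
  matrix \<open>y\<close> that has \<open>1\<close> at the places \<open>(0, j)\<close> and \<open>v i\<close> at \<open>(i + 1, i + 2)\<close>. Together
  with the unit and \<open>star u\<close> they span a four-dimensional operator system \<open>S\<close>. Let \<open>\<sigma>\<close>
  be the *-homomorphism $V(\rho\otimes\mathrm{id}_m)(\cdot)V^*$, and suppose that a ucp map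
  \<open>\<psi>\<close> lifts it on \<open>S\<close>. By Arveson's theorem (\<open>arveson_extension\<close>) \<open>\<psi>\<close> extends to a
  ucp map \<open>\<Psi>\<close> on all matrices.

  Write \<open>\<tau>\<close> for \<open>\<Psi>\<close> modulo the compact operators. At a unitary of \<open>S\<close> the Schwarz
  inequality for \<open>\<Psi>\<close> is an equality modulo compact operators, and by the Cauchy-Schwarz
  inequality for the defect of multiplicativity, \<open>\<tau>\<close> is multiplicative with respect to that
  unitary (\<open>mult_domI\<close>). Thus \<open>u\<close> lies in the multiplicative domain, and so do the diagonal matrix
  units $E_{kk}$, which are polynomials in \<open>u\<close>. Hence \<open>\<tau>\<close> and \<open>\<sigma>\<close> agree at
  $E_{ii} y E_{jj}$, that is, at the partial isometries $E_{0j}$ and $v_i E_{i+1,i+2}$, whose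
  initial and final projections are diagonal matrix units; so these lie in the multiplicative domain
  too. They generate all matrices over a dense *-subalgebra of \<open>A\<close>, and a continuity
  argument gives \<open>\<tau> = \<sigma>\<close> at all $a\otimes 1$. The compression of $\Psi(a\otimes 1)$
  by the isometry $h\mapsto V(h\otimes e_0)$ is therefore a ucp lift of \<open>\<rho>\<close>
  (\<open>lift_from_linking_system\<close>), contrary to the hypothesis.

  Arveson's theorem is obtained in a single extension step. In terms of an orthonormal basis \<open>e\<close>,
  a ucp map \<open>\<psi>\<close> on \<open>S\<close> is the same as the functional
  $X\mapsto\sum_{i,j}\langle e_i,\psi(X_{ij})e_j\rangle$ on the finitely supported infinite matrices over \<open>S\<close>. The
  Riesz extension theorem (\<open>riesz_extension\<close>) extends it to all finitely supported matrices over the matrix algebra,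
  nonnegative on sums of squares, and the values of the extension are the
  matrix coefficients of \<open>\<Psi>\<close>. Complete positivity only speaks of elements \<open>star w * w\<close>, while the cone
  consists of sums of such elements. The gap is closed by \<open>sos_plus_unit_square\<close>: in
  a matrix algebra over a C*-algebra, a sum of squares plus a positive multiple of the unit is a
  single square. By a Cholesky factorization over \<open>A\<close> (\<open>gram_plus_scalar_factor\<close>) this reduces
  to the same statement in \<open>A\<close> itself, which is the theorem that \<open>star c * c\<close> has
  a self-adjoint square root (\<open>star_mult_self_square\<close>).
\<close>

section \<open>Square roots in a complete normed *-algebra\<close>

text \<open>Square roots are needed twice, in an abstract C*-algebra and in the bounded operators on a Hilbert
  space. The latter need not be an instance of the class of unital C*-algebras, since the norm of
  the unit is \<open>0\<close> on the zero space; the locale covers both.\<close>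

locale complete_star_norm =
  fixes N :: "'b::unital_star_algebra \<Rightarrow> real"
  assumes N_add: "N (x + y) \<le> N x + N y"
    and N_mult: "N (x * y) \<le> N x * N y"
    and N_scaleC: "N (c *\<^sub>C x) = cmod c * N x"
    and N_star: "N (star x) = N x"
    and N_zero: "N x = 0 \<Longrightarrow> x = 0"
    and N_complete: "(\<And>e. e > 0 \<Longrightarrow> \<exists>k. \<forall>p\<ge>k. \<forall>q\<ge>k. N (X p - X q) < e) \<Longrightarrow>
      \<exists>L. (\<lambda>n. N (X n - L)) \<longlonglongrightarrow> 0"
begin

lemma N_0 [simp]: "N 0 = 0"
  using N_scaleC[of 0 0] by simp

lemma N_uminus: "N (- x) = N x"
  using N_scaleC[of "-1" x] by (simp add: complex_vector.scale_minus_left)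

lemma N_nonneg: "0 \<le> N x"
  using N_add[of x "- x"] by (simp add: N_uminus)

lemma N_minus_commute: "N (x - y) = N (y - x)"
  using N_uminus[of "x - y"] by simp

lemma N_diff: "N (x - y) \<le> N x + N y"
  using N_add[of x "- y"] by (simp add: N_uminus)

lemma N_eq_zeroI:
  assumes "\<And>n. N x \<le> f n" "f \<longlonglongrightarrow> 0"
  shows "x = 0"
proof (rule N_zero)
  have "N x \<le> 0" by (rule LIMSEQ_le_const[OF assms(2)]) (use assms(1) in blast)
  then show "N x = 0" using N_nonneg[of x] by simp
qed

text \<open>The iteration \<open>y \<mapsto> (z + y * y) / 2\<close> from \<open>0\<close> has the fixed points \<open>y\<close> with
  $(1-y)^2=1-z$. It is dominated by the scalar iteration for \<open>z = 1\<close>, which increases to \<open>1\<close>;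
  so it converges even when the norm of \<open>z\<close> is exactly \<open>1\<close>, and its limit commutes with whatever
  commutes with \<open>z\<close>.\<close>

lemma sqrt_one_minus:
  assumes z: "star z = z" "N z \<le> 1"
  obtains r where "star r = r" "r * r = 1 - z" "N (1 - r) \<le> 1"
    "\<forall>c. c * z = z * c \<longrightarrow> c * r = r * c"
proof -
  define y where "y = rec_nat (0::'b) (\<lambda>_ y. (1/2) *\<^sub>C (z + y * y))"
  have y0: "y 0 = 0" and ys: "y (Suc n) = (1/2) *\<^sub>C (z + y n * y n)" for n by (simp_all add: y_def)
  \<comment> \<open>the scalar iteration for \<open>z = 1\<close>, which dominates all increments\<close>
  define s where "s = rec_nat (0::real) (\<lambda>_ s. (1 + s * s) / 2)"
  have s0: "s 0 = 0" and ss: "s (Suc n) = (1 + s n * s n) / 2" for n by (simp_all add: s_def)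
  have s01: "0 \<le> s n \<and> s n \<le> 1" for n
  proof (induction n)
    case (Suc n)
    then have "s n * s n \<le> 1" by (simp add: mult_le_one)
    then show ?case by (simp add: ss)
  qed (simp add: s0)
  have "s n \<le> s (Suc n)" for n
  proof -
    have "0 \<le> (1 - s n) * (1 - s n)" by simp
    then show ?thesis by (simp add: ss algebra_simps)
  qed
  then have smono: "incseq s" by (rule incseq_SucI)
  have "convergent s"
    using s01 by (intro Bseq_mono_convergent BseqI'[of _ 1]) (use smono in \<open>auto simp: incseq_def\<close>)
  then have sC: "Cauchy s" by (rule convergent_Cauchy)
  have Ny: "N (y n) \<le> s n" for n
  proof (induction n)
    case (Suc n)
    have "N (y (Suc n)) = N (z + y n * y n) / 2" by (simp add: ys N_scaleC)
    also have "N (z + y n * y n) \<le> N z + N (y n) * N (y n)" by (meson N_add N_mult add_left_mono order_trans)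
    also have "\<dots> \<le> 1 + s n * s n" using z Suc by (intro add_mono mult_mono) (auto simp: N_nonneg s01)
    finally show ?case by (simp add: ss)
  qed (simp add: y0 s0)
  have comm: "c * y n = y n * c" if "c * z = z * c" for c n
  proof (induction n)
    case (Suc n)
    have "c * (y n * y n) = (y n * y n) * c" by (metis Suc mult.assoc)
    then show ?case by (simp add: ys mult_scaleC_left mult_scaleC_right distrib_left distrib_right that)
  qed (simp add: y0)
  have ycomm: "y k * y n = y n * y k" for k n by (intro comm) (simp add: comm[symmetric])
  have dy: "N (y (Suc n) - y n) \<le> s (Suc n) - s n" for n
  proof (induction n)
    case 0
    show ?case using z by (simp add: y0 s0 ys ss N_scaleC)
  next
    case (Suc n)
    have "y (Suc (Suc n)) - y (Suc n) = (1/2) *\<^sub>C (y (Suc n) * y (Suc n) - y n * y n)"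
      unfolding ys[of "Suc n"] ys[of n] by (simp flip: scaleC_diff_right)
    also have "y (Suc n) * y (Suc n) - y n * y n = (y (Suc n) - y n) * (y (Suc n) + y n)"
      using ycomm[of n "Suc n"] by (simp add: algebra_simps)
    finally have half: "N (y (Suc (Suc n)) - y (Suc n)) = N ((y (Suc n) - y n) * (y (Suc n) + y n)) / 2"
      by (simp add: N_scaleC)
    have "N ((y (Suc n) - y n) * (y (Suc n) + y n)) \<le> N (y (Suc n) - y n) * (N (y (Suc n)) + N (y n))"
      by (meson N_add N_mult N_nonneg mult_left_mono order_trans)
    also have "\<dots> \<le> (s (Suc n) - s n) * (s (Suc n) + s n)"
      using Suc Ny s01[of "Suc n"] s01[of n] N_nonneg incseq_SucD[OF smono, of n]
      by (intro mult_mono add_mono) auto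
    also have "\<dots> = s (Suc n) * s (Suc n) - s n * s n" by (simp add: algebra_simps)
    finally have "N (y (Suc (Suc n)) - y (Suc n)) \<le> (s (Suc n) * s (Suc n) - s n * s n) / 2"
      using half by simp
    also have "\<dots> = (1 + s (Suc n) * s (Suc n)) / 2 - (1 + s n * s n) / 2"
      by (simp add: diff_divide_distrib add_divide_distrib)
    finally show ?case by (simp only: ss)
  qed
  have dy2: "N (y (n + k) - y n) \<le> s (n + k) - s n" for n k
  proof (induction k)
    case (Suc k)
    have "N (y (n + Suc k) - y n) \<le> N (y (Suc (n + k)) - y (n + k)) + N (y (n + k) - y n)"
      using N_add[of "y (Suc (n + k)) - y (n + k)" "y (n + k) - y n"] by simp
    with Suc dy[of "n + k"] show ?case by simp
  qed simp
  have dy3: "N (y p - y q) \<le> dist (s p) (s q)" for p q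
    using dy2[of p "q - p"] dy2[of q "p - q"] N_minus_commute[of "y p" "y q"]
    by (cases "p \<le> q") (auto simp: dist_real_def)
  have "\<exists>L. (\<lambda>n. N (y n - L)) \<longlonglongrightarrow> 0"
  proof (rule N_complete)
    fix e :: real assume "e > 0"
    then obtain k where "\<forall>p\<ge>k. \<forall>q\<ge>k. dist (s p) (s q) < e" using metric_CauchyD[OF sC] by blast
    then show "\<exists>k. \<forall>p\<ge>k. \<forall>q\<ge>k. N (y p - y q) < e" by (meson dy3 le_less_trans)
  qed
  then obtain L where L: "(\<lambda>n. N (y n - L)) \<longlonglongrightarrow> 0" by blast
  have L': "(\<lambda>n. N (y (Suc n) - L)) \<longlonglongrightarrow> 0" using LIMSEQ_Suc[OF L] .
  have NL: "N L \<le> 1"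
  proof -
    have "N L \<le> N (y n - L) + 1" for n
      using N_diff[of "y n" "y n - L"] Ny[of n] s01[of n] by simp
    moreover have "(\<lambda>n. N (y n - L) + 1) \<longlonglongrightarrow> 0 + 1" by (intro tendsto_intros L)
    ultimately show ?thesis using LIMSEQ_le_const[of "\<lambda>n. N (y n - L) + 1" "0+1" "N L"] by simp
  qed
  have ystar: "star (y n) = y n" for n
    by (induction n) (simp_all add: y0 ys star_scaleC star_add star_mult z)
  have Lstar: "star L = L"
  proof -
    have "star L - L = 0"
    proof (rule N_eq_zeroI)
      fix n
      have "star L - L = (y n - L) - star (y n - L)" by (simp add: star_diff ystar)
      then show "N (star L - L) \<le> N (y n - L) + N (y n - L)" using N_diff N_star by metis
    qed (use tendsto_add[OF L L] in simp)
    then show ?thesis by simp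
  qed
  have Lcomm: "c * L = L * c" if c: "c * z = z * c" for c
  proof -
    have "c * L - L * c = 0"
    proof (rule N_eq_zeroI)
      fix n
      have "c * L - L * c = (y n - L) * c - c * (y n - L)" using comm[OF c, of n] by (simp add: algebra_simps)
      then have "N (c * L - L * c) \<le> N ((y n - L) * c) + N (c * (y n - L))" using N_diff by metis
      also have "\<dots> \<le> N (y n - L) * N c + N c * N (y n - L)" by (intro add_mono N_mult)
      finally show "N (c * L - L * c) \<le> 2 * N c * N (y n - L)" by simp
      show "(\<lambda>n. 2 * N c * N (y n - L)) \<longlonglongrightarrow> 0" using tendsto_mult_right_zero[OF L] by simp
    qed
    then show ?thesis by simp
  qed
  have fixpt: "(2 *\<^sub>C L - z) - L * L = 0"
  proof (rule N_eq_zeroI)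
    fix n
    have "2 *\<^sub>C y (Suc n) = z + y n * y n" by (simp add: ys)
    then have "(2 *\<^sub>C L - z) - L * L = (- 2) *\<^sub>C (y (Suc n) - L) + ((y n - L) * L + y n * (y n - L))"
      by (simp add: scaleC_diff_right complex_vector.scale_minus_left algebra_simps)
    also have "N \<dots> \<le> 2 * N (y (Suc n) - L) + N ((y n - L) * L + y n * (y n - L))"
      by (rule order_trans[OF N_add]) (simp add: N_scaleC N_uminus)
    also have "N ((y n - L) * L + y n * (y n - L)) \<le> N (y n - L) * N L + N (y n) * N (y n - L)"
      by (rule order_trans[OF N_add]) (intro add_mono N_mult)
    also have "\<dots> \<le> N (y n - L) * 1 + 1 * N (y n - L)"
      using NL Ny[of n] s01[of n] by (intro add_mono mult_mono) (auto simp: N_nonneg)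
    finally show "N ((2 *\<^sub>C L - z) - L * L) \<le> 2 * N (y (Suc n) - L) + 2 * N (y n - L)" by simp
    show "(\<lambda>n. 2 * N (y (Suc n) - L) + 2 * N (y n - L)) \<longlonglongrightarrow> 0"
      using tendsto_add[OF tendsto_mult_right_zero[OF L', of 2] tendsto_mult_right_zero[OF L, of 2]] by simp
  qed
  have two: "2 *\<^sub>C L = L + L" using scaleC_add_left[of 1 1 L] by simp
  show thesis
  proof (rule that[of "1 - L"])
    show "(1 - L) * (1 - L) = 1 - z" using fixpt by (simp add: two algebra_simps)
    show "star (1 - L) = 1 - L" by (simp add: star_diff Lstar)
    show "N (1 - (1 - L)) \<le> 1" using NL by simp
    show "\<forall>c. c * z = z * c \<longrightarrow> c * (1 - L) = (1 - L) * c"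
      using Lcomm by (simp add: algebra_simps)
  qed
qed

end

section \<open>Positive elements of a C*-algebra\<close>

lemma norm_star: "norm (star x) = norm (x::'a::unital_cstar_algebra)"
proof -
  have le: "norm x \<le> norm (star x)" for x :: 'a
  proof (cases "norm x = 0")
    case False
    have "norm x * norm x \<le> norm (star x) * norm x"
      using norm_mult_ineq[of "star x" x] by (simp add: norm_star_mult_self power2_eq_square)
    with False show ?thesis by simp
  qed simp
  show ?thesis using le[of x] le[of "star x"] by simp
qed

interpretation cstar: complete_star_norm "norm :: 'a::unital_cstar_algebra \<Rightarrow> real"
proof
  fix x y :: 'a and c
  show "norm (x + y) \<le> norm x + norm y" by (rule norm_triangle_ineq)
  show "norm (x * y) \<le> norm x * norm y" by (rule norm_mult_ineq)
  show "norm (c *\<^sub>C x) = cmod c * norm x" by (rule norm_scaleC)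
  show "norm (star x) = norm x" by (rule norm_star)
  show "x = 0" if "norm x = 0" using that by simp
next
  fix X :: "nat \<Rightarrow> 'a"
  assume "\<And>e. e > 0 \<Longrightarrow> \<exists>k. \<forall>p\<ge>k. \<forall>q\<ge>k. norm (X p - X q) < e"
  then have "Cauchy X" by (auto intro!: metric_CauchyI simp: dist_norm)
  then obtain L where "X \<longlonglongrightarrow> L" using Cauchy_convergent convergent_def by blast
  then show "\<exists>L. (\<lambda>n. norm (X n - L)) \<longlonglongrightarrow> 0"
    by (auto simp: tendsto_norm_zero_iff LIM_zero_iff)
qed

lemma star_scaleR: "star (r *\<^sub>R x) = r *\<^sub>R star (x::'a::unital_cstar_algebra)"
  by (simp add: scaleR_eq_scaleC star_scaleC)

lemma add_i_mult:
  fixes x y :: "'a::unital_star_algebra"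
  assumes "x * y = y * x"
  shows "(x - \<i> *\<^sub>C y) * (x + \<i> *\<^sub>C y) = x * x + y * y"
proof -
  have "\<i> *\<^sub>C \<i> *\<^sub>C (y * y) = - (y * y)" by (simp add: complex_vector.scale_minus_left)
  then show ?thesis using assms
    by (simp add: algebra_simps mult_scaleC_left mult_scaleC_right)
qed

text \<open>The element \<open>w = b + i e\<close> satisfies \<open>star w * w = k\<close>, so its norm is the square root of the
  modulus of \<open>k\<close>; and \<open>b\<close>, \<open>e\<close> are its real and imaginary parts.\<close>

lemma norm_commuting_sa:
  fixes b e :: "'a::unital_cstar_algebra"
  assumes "star b = b" "star e = e" "b * e = e * b" "b * b + e * e = k *\<^sub>R 1"
  shows "norm (b * b) \<le> \<bar>k\<bar>" "norm (e * e) \<le> \<bar>k\<bar>"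
proof -
  define w where "w = b + \<i> *\<^sub>C e"
  have sw: "star w = b - \<i> *\<^sub>C e" by (simp add: w_def star_add star_scaleC assms complex_vector.scale_minus_left)
  have "star w * w = k *\<^sub>R 1" unfolding sw unfolding w_def by (simp add: add_i_mult assms)
  then have nw: "(norm w)\<^sup>2 = \<bar>k\<bar>" by (metis mult.right_neutral norm_one norm_scaleR norm_star_mult_self)
  have "norm b \<le> norm w"
  proof -
    have "b + b = w + star w" by (subst sw) (simp add: w_def)
    then have "norm (b + b) \<le> norm w + norm w" by (metis norm_star norm_triangle_ineq)
    then show ?thesis by (simp flip: scaleR_2)
  qed
  moreover have "norm e \<le> norm w"
  proof -
    have "2 *\<^sub>R (\<i> *\<^sub>C e) = w - star w" by (subst sw) (simp add: w_def scaleR_2)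
    then have "norm (2 *\<^sub>R (\<i> *\<^sub>C e)) \<le> norm w + norm w" by (metis norm_star norm_triangle_ineq4)
    then show ?thesis by (simp add: norm_scaleC)
  qed
  moreover have "norm (b * b) = (norm b)\<^sup>2" "norm (e * e) = (norm e)\<^sup>2"
    using norm_star_mult_self[of b] norm_star_mult_self[of e] assms by simp_all
  ultimately show "norm (b * b) \<le> \<bar>k\<bar>" "norm (e * e) \<le> \<bar>k\<bar>"
    by (simp_all flip: nw add: power_mono)
qed

text \<open>For \<open>t = 1\<close>: with $e=\sqrt{1-b^2}$ the element \<open>b + i e\<close> is unitary, so $e^2=1-b^2$ has norm at most
  \<open>1\<close>. The inequality expresses that \<open>b * b\<close> has spectrum in \<open>{0..t}\<close>, without any
  spectral theory; by \<open>square_root_sa\<close> it characterizes the squares of self-adjoint elements.\<close>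

lemma norm_diff_square_sa:
  fixes b :: "'a::unital_cstar_algebra"
  assumes b: "star b = b" and t: "norm (b * b) \<le> t"
  shows "norm (t *\<^sub>R 1 - b * b) \<le> t"
proof (cases "t > 0")
  case False
  with t have "t = 0" using norm_ge_zero[of "b * b"] by linarith
  with t show ?thesis by simp
next
  case True
  define z where "z = (1/t) *\<^sub>R (b * b)"
  have "star z = z" "norm z \<le> 1" using t True by (simp_all add: z_def star_scaleR star_mult b field_simps)
  then obtain r where r: "star r = r" "r * r = 1 - z" "norm (1 - r) \<le> 1"
    "\<forall>c. c * z = z * c \<longrightarrow> c * r = r * c" by (rule cstar.sqrt_one_minus)
  define e where "e = sqrt t *\<^sub>R r"
  have "b * z = z * b" by (simp add: z_def mult.assoc)
  then have be: "b * e = e * b" using r(4) by (simp add: e_def)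
  have ee: "e * e = t *\<^sub>R 1 - b * b" using True by (simp add: e_def r(2) z_def scaleR_diff_right)
  have se: "star e = e" by (simp add: e_def star_scaleR r(1))
  have "norm (e * e) \<le> \<bar>t\<bar>"
    by (rule norm_commuting_sa(2)[OF b se be]) (simp add: ee)
  then show ?thesis using ee True by simp
qed

lemma root_sa:
  fixes y :: "'a::unital_cstar_algebra"
  assumes y: "star y = y" "norm (1 - y) \<le> 1"
  obtains r where "star r = r" "r * r = y" "norm (1 - r) \<le> 1"
    "\<forall>c. c * y = y * c \<longrightarrow> c * r = r * c"
proof -
  have "star (1 - y) = 1 - y" by (simp add: star_diff y)
  then obtain r where r: "star r = r" "r * r = 1 - (1 - y)"
    "norm (1 - r) \<le> 1" "\<forall>c. c * (1 - y) = (1 - y) * c \<longrightarrow> c * r = r * c"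
    using y(2) by (rule cstar.sqrt_one_minus)
  show thesis
  proof (rule that[OF r(1) _ r(3)])
    show "r * r = y" using r(2) by simp
    show "\<forall>c. c * y = y * c \<longrightarrow> c * r = r * c"
      using r(4) by (simp add: algebra_simps)
  qed
qed

text \<open>The fourth root serves to have a square root that is again a square, that is, a positive one.\<close>

lemma fourth_root:
  fixes x :: "'a::unital_cstar_algebra"
  assumes x: "star x = x" and t: "norm (t *\<^sub>R 1 - x) \<le> t"
  obtains d where "star d = d" "x = (d * d) * (d * d)"
    "\<forall>c. c * x = x * c \<longrightarrow> c * d = d * c"
proof (cases "t > 0")
  case False
  then have "t = 0" using t norm_ge_zero[of "t *\<^sub>R 1 - x"] by linarith
  with t have "x = 0" by simp
  show ?thesis by (rule that[of 0]) (simp_all add: \<open>x = 0\<close>)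
next
  case True
  define y where "y = (1/t) *\<^sub>R x"
  have "1 - y = (1/t) *\<^sub>R (t *\<^sub>R 1 - x)" using True by (simp add: y_def scaleR_diff_right)
  then have "norm (1 - y) = norm (t *\<^sub>R 1 - x) / t" using True unfolding norm_scaleR by simp
  then have n: "norm (1 - y) \<le> 1" using t True by simp
  have "star y = y" by (simp add: y_def star_scaleR x)
  then obtain r where r: "star r = r" "r * r = y" "norm (1 - r) \<le> 1"
    "\<forall>c. c * y = y * c \<longrightarrow> c * r = r * c" using n by (rule root_sa)
  obtain d where d: "star d = d" "d * d = r" "norm (1 - d) \<le> 1"
    "\<forall>c. c * r = r * c \<longrightarrow> c * d = d * c" by (rule root_sa[OF r(1,3)])
  define k where "k = sqrt (sqrt t)"
  have k: "k * k * (k * k) = t" using True by (simp add: k_def)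
  show thesis
  proof (rule that[of "k *\<^sub>R d"])
    have "(k *\<^sub>R d * k *\<^sub>R d) * (k *\<^sub>R d * k *\<^sub>R d) = (k * k * (k * k)) *\<^sub>R ((d * d) * (d * d))"
      by (simp add: mult.assoc)
    also have "\<dots> = x" using True by (simp only: k d(2) r(2)) (simp add: y_def)
    finally show "x = (k *\<^sub>R d * k *\<^sub>R d) * (k *\<^sub>R d * k *\<^sub>R d)" by simp
    show "\<forall>c. c * x = x * c \<longrightarrow> c * (k *\<^sub>R d) = (k *\<^sub>R d) * c"
      using d(4) r(4) by (simp add: y_def)
    show "star (k *\<^sub>R d) = k *\<^sub>R d" by (simp add: star_scaleR d(1))
  qed
qed

lemma square_root_sa:
  fixes x :: "'a::unital_cstar_algebra"
  assumes x: "star x = x" and t: "norm (t *\<^sub>R 1 - x) \<le> t"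
  obtains d where "star d = d" "x = d * d" "\<forall>c. c * x = x * c \<longrightarrow> c * d = d * c"
proof -
  obtain d where d: "star d = d" "x = (d * d) * (d * d)" "\<forall>c. c * x = x * c \<longrightarrow> c * d = d * c"
    by (rule fourth_root[OF assms])
  show thesis
  proof (rule that[of "d * d"])
    show "\<forall>c. c * x = x * c \<longrightarrow> c * (d * d) = (d * d) * c" using d(3) by (metis mult.assoc)
  qed (simp_all add: d(1,2) star_mult)
qed

text \<open>The norm condition of \<open>square_root_sa\<close> is stable under sums by the triangle inequality.\<close>

lemma sum_squares_sa:
  fixes b c :: "'a::unital_cstar_algebra"
  assumes "star b = b" "star c = c"
  shows "\<exists>d. star d = d \<and> b * b + c * c = d * d"
proof -
  let ?s = "norm (b * b)" and ?t = "norm (c * c)"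
  have "norm ((?s + ?t) *\<^sub>R 1 - (b * b + c * c)) = norm ((?s *\<^sub>R 1 - b * b) + (?t *\<^sub>R 1 - c * c))"
    by (simp add: scaleR_add_left algebra_simps)
  also have "\<dots> \<le> ?s + ?t"
    using norm_diff_square_sa[OF assms(1) order_refl] norm_diff_square_sa[OF assms(2) order_refl]
    by (meson add_mono norm_triangle_ineq order_trans)
  finally have n: "norm ((?s + ?t) *\<^sub>R 1 - (b * b + c * c)) \<le> ?s + ?t" .
  have "star (b * b + c * c) = b * b + c * c" by (simp add: star_add star_mult assms)
  then obtain d where "star d = d" "b * b + c * c = d * d" using n by (rule square_root_sa)
  then show ?thesis by blast
qed

lemma neumann_inverse:
  fixes z :: "'a::unital_cstar_algebra"
  assumes "norm z < 1"
  shows "\<exists>v. (1 - z) * v = 1 \<and> v * (1 - z) = 1"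
proof -
  have s: "summable (\<lambda>n. z ^ n)" using complete_algebra_summable_geometric[OF assms] .
  let ?v = "\<Sum>n. z ^ n"
  have 1: "?v = 1 + (\<Sum>n. z ^ Suc n)" using suminf_split_head[OF s] by simp
  have "(\<Sum>n. z ^ Suc n) = z * ?v" using suminf_mult[OF s, of z] by simp
  moreover have "(\<Sum>n. z ^ Suc n) = ?v * z"
    using suminf_mult2[OF s, of z] by (simp add: power_commutes)
  ultimately have "?v = 1 + z * ?v" "?v = 1 + ?v * z" using 1 by metis+
  then show ?thesis by (intro exI[of _ ?v]) (simp add: left_diff_distrib right_diff_distrib, metis add_diff_cancel_right')
qed

lemma square_plus_invertible:
  fixes b :: "'a::unital_cstar_algebra"
  assumes b: "star b = b" and e: "e > 0"
  shows "\<exists>w v. star w = w \<and> b * b + e *\<^sub>R 1 = w * w \<and> w * v = 1 \<and> v * w = 1"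
proof -
  define t where "t = norm (b * b)"
  have t0: "t \<ge> 0" by (simp add: t_def)
  define x where "x = b * b + e *\<^sub>R 1"
  have sx: "star x = x" by (simp add: x_def star_add star_mult star_scaleR b)
  have n: "norm ((t + e) *\<^sub>R 1 - x) \<le> t"
    using norm_diff_square_sa[OF b, of t] by (simp add: x_def t_def scaleR_add_left)
  then have "norm ((t + e) *\<^sub>R 1 - x) \<le> t + e" using e by simp
  then obtain w where w: "star w = w" "x = w * w" by (rule square_root_sa[OF sx])
  define z where "z = (1 / (t + e)) *\<^sub>R ((t + e) *\<^sub>R 1 - x)"
  have te: "t + e > 0" using t0 e by simp
  have "norm z = norm ((t + e) *\<^sub>R 1 - x) / (t + e)" using te unfolding z_def norm_scaleR by simp
  also have "\<dots> < 1" using n e te by simp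
  finally have "norm z < 1" .
  then obtain v where v: "(1 - z) * v = 1" "v * (1 - z) = 1" using neumann_inverse by blast
  have "1 - z = (1 / (t + e)) *\<^sub>R x" using te by (simp add: z_def scaleR_diff_right)
  then have xv: "x * ((1/(t+e)) *\<^sub>R v) = 1" "((1/(t+e)) *\<^sub>R v) * x = 1" using v by simp_all
  have "w * (w * ((1/(t+e)) *\<^sub>R v)) = 1" "((1/(t+e)) *\<^sub>R v * w) * w = 1"
    using xv w(2) by (simp_all add: mult.assoc)
  moreover from this have "w * ((1/(t+e)) *\<^sub>R v) = (1/(t+e)) *\<^sub>R v * w"
    by (metis mult.assoc mult.left_neutral mult.right_neutral)
  ultimately show ?thesis using w x_def by metis
qed

text \<open>The norm of a positive element belongs to its spectrum. Otherwise \<open>M - b * b\<close> is positive and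
  invertible, hence bounded below by some \<open>h > 0\<close>; then also \<open>M - h - b * b\<close> is a square commuting with \<open>b\<close>,
  and \<open>norm_commuting_sa\<close> bounds the norm of \<open>b * b\<close> by \<open>M - h\<close>.\<close>

lemma norm_square_not_resolvent:
  fixes b :: "'a::unital_cstar_algebra"
  assumes b: "star b = b" and M: "norm (b * b) = M" "M > 0"
    and v: "(M *\<^sub>R 1 - b * b) * v = 1" "v * (M *\<^sub>R 1 - b * b) = 1"
  shows False
proof -
  define x where "x = M *\<^sub>R 1 - b * b"
  note v = v[folded x_def]
  have sx: "star x = x" by (simp add: x_def star_diff star_mult star_scaleR b)
  have sv: "star v = v"
    using v sx by (metis mult.assoc mult.left_neutral mult.right_neutral star_mult star_one)
  have "norm (M *\<^sub>R 1 - x) \<le> M" by (simp add: x_def M)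
  then obtain g where g: "star g = g" "x = g * g"
    "\<forall>c. c * x = x * c \<longrightarrow> c * g = g * c" by (rule square_root_sa[OF sx])
  have inv_comm: "c * v = v * c" if "c * x = x * c" for c
    by (metis mult.assoc mult.left_neutral mult.right_neutral that v)
  have "v \<noteq> 0" using v(1) by auto
  \<comment> \<open>the second bound keeps \<open>M - h\<close> nonnegative\<close>
  define h where "h = min (1 / norm v) M"
  have h: "h > 0" "h \<le> M" "h * norm v \<le> 1"
    using \<open>v \<noteq> 0\<close> M by (auto simp: h_def min_def field_simps)
  have "star (h *\<^sub>R v) = h *\<^sub>R v" "norm (h *\<^sub>R v) \<le> 1" using h by (simp_all add: star_scaleR sv)
  then obtain f where f: "star f = f" "f * f = 1 - h *\<^sub>R v" "norm (1 - f) \<le> 1"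
    "\<forall>c. c * (h *\<^sub>R v) = (h *\<^sub>R v) * c \<longrightarrow> c * f = f * c" by (rule cstar.sqrt_one_minus)
  have fc: "c * f = f * c" if "c * x = x * c" for c using f(4)[rule_format, of c] inv_comm[OF that] by simp
  have gx: "g * x = x * g" by (simp add: g(2) mult.assoc)
  have bx: "b * x = x * b" by (simp add: x_def algebra_simps)
  define e where "e = g * f"
  have "star e = e" by (simp add: e_def star_mult f(1) g(1) fc[OF gx])
  moreover have "b * e = e * b" unfolding e_def by (metis bx fc g(3) mult.assoc)
  moreover have "b * b + e * e = (M - h) *\<^sub>R 1"
  proof -
    have "e * e = x * (f * f)" unfolding e_def g(2) by (metis fc[OF gx] mult.assoc)
    also have "\<dots> = x - h *\<^sub>R 1" by (simp add: f(2) right_diff_distrib v)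
    finally show ?thesis by (simp add: x_def scaleR_diff_left)
  qed
  ultimately have "norm (b * b) \<le> \<bar>M - h\<bar>" using norm_commuting_sa(1) b by blast
  with M h show False by simp
qed

text \<open>Since \<open>t * star t + star t * t\<close> is twice the sum of the squares of the real and imaginary parts
  of \<open>t\<close>, the element \<open>t * star t\<close> is that sum plus \<open>b * b\<close> and hence positive. So \<open>M + t * star t\<close> is invertible for all
  \<open>M > 0\<close>, and then so is \<open>M + star t * t = M - b * b\<close>, by the usual formula for the inverse.
  For \<open>M\<close> the norm of \<open>b * b\<close> this is impossible.\<close>

lemma star_mult_self_neg_square:
  fixes t b :: "'a::unital_cstar_algebra"
  assumes b: "star b = b" and tb: "star t * t = - (b * b)"
  shows "t = 0"
proof (rule ccontr)
  assume "t \<noteq> 0"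
  define M where "M = norm (b * b)"
  have M: "M > 0" using \<open>t \<noteq> 0\<close> norm_star_mult_self[of t] by (simp add: M_def tb)
  define h k where "h = (1/2) *\<^sub>C (t + star t)" and "k = (\<i>/2) *\<^sub>C (star t - t)"
  have hk: "star h = h" "star k = k"
    by (simp_all add: h_def k_def star_scaleC star_add star_diff add.commute complex_vector.scale_minus_left
        scaleC_diff_right)
  have hh: "4 *\<^sub>C (h * h) = t * t + t * star t + star t * t + star t * star t"
    by (simp add: h_def mult_scaleC_left mult_scaleC_right algebra_simps)
  have kk: "4 *\<^sub>C (k * k) = - (t * t - t * star t - star t * t + star t * star t)"
    by (simp add: k_def mult_scaleC_left mult_scaleC_right complex_vector.scale_minus_left algebra_simps)
  have "4 *\<^sub>C (h * h + k * k) = (1 + 1) *\<^sub>C (t * star t + star t * t)"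
    unfolding scaleC_add_right hh kk scaleC_add_left by (simp add: algebra_simps)
  then have "(1/2) *\<^sub>C (4 *\<^sub>C (h * h + k * k)) = t * star t + star t * t" by simp
  then have "(1 + 1) *\<^sub>C (h * h + k * k) = t * star t + star t * t" by simp
  then have tt: "t * star t = (h * h + k * k) + (h * h + k * k) + b * b"
    unfolding scaleC_add_left by (simp add: tb algebra_simps)
  obtain p where p: "star p = p" "h * h + k * k = p * p" using sum_squares_sa hk by blast
  obtain p' where p': "star p' = p'" "p * p + p * p = p' * p'" using sum_squares_sa p by blast
  obtain g where g: "star g = g" "t * star t = g * g" using sum_squares_sa[OF p'(1) b] tt p p' by auto
  obtain w v where wv: "g * g + M *\<^sub>R 1 = w * w" "w * v = 1" "v * w = 1"
    using square_plus_invertible[OF g(1) M] by blast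
  define J where "J = v * v"
  have J: "(M *\<^sub>R 1 + t * star t) * J = 1" "J * (M *\<^sub>R 1 + t * star t) = 1"
    using wv by (simp_all add: J_def g add.commute) (metis mult.assoc mult.left_neutral)+
  \<comment> \<open>the inverse of \<open>M + star t * t\<close>, by the usual formula\<close>
  define u where "u = (1/M) *\<^sub>R (1 - star t * J * t)"
  have J1: "t * star t * J = 1 - M *\<^sub>R J" and J2: "J * t * star t = 1 - M *\<^sub>R J"
    using J by (simp_all add: algebra_simps eq_diff_eq)
  have "(M *\<^sub>R 1 - b * b) = M *\<^sub>R 1 + star t * t" by (simp add: tb)
  moreover have "(M *\<^sub>R 1 + star t * t) * u = 1"
  proof -
    have "(star t * t) * (star t * J * t) = star t * (t * star t * J) * t" by (simp add: mult.assoc)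
    also have "\<dots> = star t * t - M *\<^sub>R (star t * J * t)"
      by (simp only: J1) (simp add: algebra_simps)
    finally show ?thesis using M by (simp add: u_def algebra_simps)
  qed
  moreover have "u * (M *\<^sub>R 1 + star t * t) = 1"
  proof -
    have "(star t * J * t) * (star t * t) = star t * (J * t * star t) * t" by (simp add: mult.assoc)
    also have "\<dots> = star t * t - M *\<^sub>R (star t * J * t)"
      by (simp only: J2) (simp add: algebra_simps)
    finally have e: "(star t * J * t) * (star t * t) = star t * t - M *\<^sub>R (star t * J * t)" .
    have "(1 - star t * J * t) * (M *\<^sub>R 1 + star t * t) = M *\<^sub>R 1"
      by (simp only: left_diff_distrib distrib_left mult_1_left e) (simp add: algebra_simps)
    then show ?thesis using M by (simp add: u_def)
  qed
  ultimately show False using norm_square_not_resolvent[OF b M_def[symmetric] M] by metis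
qed

text \<open>With \<open>q\<close> the positive square root of $x^2$, where \<open>x = star c * c\<close>, put \<open>n = q - x\<close>, twice the
  negative part of \<open>x\<close>. As $xn=-qn$, the element \<open>c * n\<close> satisfies the hypothesis of
  \<open>star_mult_self_neg_square\<close> and vanishes; this forces \<open>n = 0\<close> and \<open>x = q\<close>.\<close>

lemma star_mult_self_square:
  fixes c :: "'a::unital_cstar_algebra"
  shows "\<exists>d. star d = d \<and> star c * c = d * d"
proof -
  define x where "x = star c * c"
  have sx: "star x = x" by (simp add: x_def star_mult)
  have "star (x * x) = x * x" by (simp add: star_mult sx)
  then obtain d where d: "star d = d" "x * x = (d * d) * (d * d)"
    "\<forall>c. c * (x * x) = (x * x) * c \<longrightarrow> c * d = d * c"
    using norm_diff_square_sa[OF sx order_refl] by (rule fourth_root)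
  have xd: "x * d = d * x" using d(3) by (simp add: mult.assoc)
  define q where "q = d * d"
  define n where "n = q - x"
  have xq: "x * q = q * x" using xd unfolding q_def by (metis mult.assoc)
  have sn: "star n = n" by (simp add: n_def q_def star_diff star_mult d(1) sx)
  have "(x + q) * n = 0" using xq d(2) by (simp add: n_def algebra_simps flip: q_def)
  then have xn: "x * n = - (q * n)" by (simp add: distrib_right eq_neg_iff_add_eq_0)
  have dn: "d * n = n * d" using xd by (simp add: n_def q_def algebra_simps)
  have "star (c * n) * (c * n) = n * (x * n)" by (simp add: star_mult sn x_def mult.assoc)
  also have "\<dots> = - ((d * n) * (d * n))" unfolding xn q_def by (metis dn mult.assoc mult_minus_right)
  finally have "c * n = 0"
    by (rule star_mult_self_neg_square[rotated]) (simp add: star_mult sn d(1) dn)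
  then have "x * n = 0" by (simp add: x_def mult.assoc)
  with xn have "q * n = 0" by simp
  with \<open>x * n = 0\<close> have "n * n = 0" by (subst n_def) (simp add: left_diff_distrib)
  then have "n = 0" using norm_star_mult_self[of n] sn by simp
  then have "x = d * d" by (simp add: n_def q_def)
  then show ?thesis using d(1) unfolding x_def by (intro exI[of _ d] conjI)
qed

lemma sum_star_mult_self_square:
  fixes c :: "'i \<Rightarrow> 'a::unital_cstar_algebra"
  shows "\<exists>d. star d = d \<and> (\<Sum>r\<in>R. star (c r) * c r) = d * d"
proof (induction R rule: infinite_finite_induct)
  case (insert r R)
  then obtain d e where "star d = d" "(\<Sum>r\<in>R. star (c r) * c r) = d * d"
    "star e = e" "star (c r) * c r = e * e" using star_mult_self_square by metis
  then show ?case using sum_squares_sa[of e d] insert by simp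
qed (auto intro!: exI[of _ 0])

lemma sum_star_mult_self_plus:
  fixes c :: "'i \<Rightarrow> 'a::unital_cstar_algebra"
  assumes "e > 0"
  shows "\<exists>w v. star w = w \<and> star v = v \<and> (\<Sum>r\<in>R. star (c r) * c r) + e *\<^sub>R 1 = w * w \<and> w * v = 1 \<and> v * w = 1"
proof -
  obtain d where "star d = d" "(\<Sum>r\<in>R. star (c r) * c r) = d * d"
    using sum_star_mult_self_square by metis
  with square_plus_invertible[OF _ assms] obtain w v where
    w: "star w = w" "(\<Sum>r\<in>R. star (c r) * c r) + e *\<^sub>R 1 = w * w" "w * v = 1" "v * w = 1" by metis
  have "star v * w = 1" using w(1,3) star_mult[of w v] by simp
  then have "star v = v" using w(3) by (metis mult.assoc mult.left_neutral mult.right_neutral)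
  with w show ?thesis by blast
qed

text \<open>This is the order form of the norm, \<open>star a * a \<le> t\<close>, with the difference written as a square so
  that it is preserved by *-homomorphisms and by passing to matrices.\<close>

lemma norm_sq_minus_square:
  fixes a :: "'a::unital_cstar_algebra"
  assumes "(norm a)\<^sup>2 \<le> t"
  shows "\<exists>d. t *\<^sub>R 1 - star a * a = star d * d"
proof -
  obtain b where b: "star b = b" "star a * a = b * b" using star_mult_self_square by metis
  have n: "norm (b * b) \<le> t" using norm_star_mult_self[of a] assms by (simp add: b(2))
  define x where "x = t *\<^sub>R 1 - b * b"
  have "star x = x" by (simp add: x_def star_diff star_mult star_scaleR b)
  moreover have "norm (t *\<^sub>R 1 - x) \<le> t" using n by (simp add: x_def)
  ultimately obtain d where "star d = d" "x = d * d" by (rule square_root_sa)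
  then show ?thesis using b x_def by (metis)
qed

section \<open>Cholesky factorization of Gram matrices\<close>

text \<open>Block Cholesky factorization by induction on the index set: the pivot, a sum of squares in \<open>A\<close>
  plus \<open>e\<close>, has an invertible square root \<open>w\<close>. The Schur complement of a Gram matrix plus \<open>e\<close> is
  again of this form, for the vectors \<open>Y'\<close> with one additional row. In this way only square roots in \<open>A\<close>
  itself are used and no norm on the matrix algebra.\<close>

lemma gram_plus_scalar_factor_nat:
  fixes Y :: "nat \<Rightarrow> 'i \<Rightarrow> 'a::unital_cstar_algebra"
  assumes "finite I" and e: "e > 0"
  shows "\<exists>W. \<forall>i\<in>I. \<forall>j\<in>I. (\<Sum>r<n. star (Y r i) * Y r j) + (if i = j then e *\<^sub>R 1 else 0)
    = (\<Sum>l\<in>I. star (W l i) * W l j)"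
  using assms(1)
proof (induction I arbitrary: n Y)
  case (insert k I)
  obtain w v where w: "star w = w" "star v = v"
    "(\<Sum>r<n. star (Y r k) * Y r k) + e *\<^sub>R 1 = w * w" "w * v = 1" "v * w = 1"
    using sum_star_mult_self_plus[OF e, where c="\<lambda>r. Y r k" and R="{..<n}"] by metis
  define b where "b j = (\<Sum>r<n. star (Y r k) * Y r j)" for j
  have sb: "star (b j) = (\<Sum>r<n. star (Y r j) * Y r k)" for j
    by (simp add: b_def star_sum star_mult)
  define t where "t j = v * (v * b j)" for j
  have wt: "w * (w * t j) = b j" for j
    by (simp add: t_def w flip: mult.assoc)
  have st: "star (t j) = star (b j) * v * v" for j by (simp add: t_def star_mult w)
  \<comment> \<open>the rows of the Schur complement; row \<open>n\<close> accounts for \<open>e * star (t i) * t j\<close>\<close>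
  define Y' where "Y' r j = (if r < n then Y r j - Y r k * t j else sqrt e *\<^sub>R t j)" for r j
  obtain W' where W': "\<And>i j. i \<in> I \<Longrightarrow> j \<in> I \<Longrightarrow>
      (\<Sum>r<Suc n. star (Y' r i) * Y' r j) + (if i = j then e *\<^sub>R 1 else 0) = (\<Sum>l\<in>I. star (W' l i) * W' l j)"
    using insert.IH[where n="Suc n" and Y=Y'] by blast
  define W where "W l j = (if l = k then (if j = k then w else v * b j)
      else (if j = k then 0 else W' l j))" for l j
  have ne: "l \<noteq> k" if "l \<in> I" for l using that insert.hyps by blast
  have schur: "(\<Sum>r<Suc n. star (Y' r i) * Y' r j) + star (b i) * t j = (\<Sum>r<n. star (Y r i) * Y r j)"
    (is "?lhs = ?d") for i j
  proof -
    have a: "(\<Sum>r<n. star (Y r k) * Y r k) = w * w - e *\<^sub>R 1" using w(3) by (simp add: eq_diff_eq)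
    have "(\<Sum>r<n. star (Y' r i) * Y' r j)
        = (\<Sum>r<n. star (Y r i) * Y r j - star (Y r i) * Y r k * t j - star (t i) * (star (Y r k) * Y r j)
            + star (t i) * (star (Y r k) * Y r k) * t j)"
      by (rule sum.cong) (simp_all add: Y'_def star_diff star_mult algebra_simps)
    also have "\<dots> = ?d - star (b i) * t j - star (t i) * b j + star (t i) * (w * w - e *\<^sub>R 1) * t j"
      unfolding sb a[symmetric] unfolding b_def
      by (simp add: sum.distrib sum_subtractf sum_distrib_left sum_distrib_right)
    also have "star (t i) * (w * w - e *\<^sub>R 1) * t j = star (t i) * b j - e *\<^sub>R (star (t i) * t j)"
      by (simp add: left_diff_distrib right_diff_distrib mult.assoc wt)
    finally have "(\<Sum>r<n. star (Y' r i) * Y' r j) = ?d - star (b i) * t j - e *\<^sub>R (star (t i) * t j)"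
      by simp
    moreover have "star (Y' n i) * Y' n j = e *\<^sub>R (star (t i) * t j)"
      using e by (simp add: Y'_def star_scaleR)
    ultimately show ?thesis by simp
  qed
  have "(\<Sum>r<n. star (Y r i) * Y r j) + (if i = j then e *\<^sub>R 1 else 0)
      = (\<Sum>l\<in>insert k I. star (W l i) * W l j)" (is "?L = ?R")
    if ij: "i \<in> insert k I" "j \<in> insert k I" for i j
  proof -
    have R: "?R = star (W k i) * W k j + (\<Sum>l\<in>I. star (W l i) * W l j)" using insert.hyps by simp
    consider "i = k" "j = k" | "i = k" "j \<in> I" | "i \<in> I" "j = k" | "i \<in> I" "j \<in> I" using ij by blast
    then show ?thesis
    proof cases
      case 1
      have "(\<Sum>l\<in>I. star (W l i) * W l j) = 0" by (rule sum.neutral) (use 1 ne in \<open>simp add: W_def\<close>)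
      then show ?thesis unfolding R using 1 by (simp add: W_def w)
    next
      case 2
      have "(\<Sum>l\<in>I. star (W l i) * W l j) = 0" by (rule sum.neutral) (use 2 ne in \<open>simp add: W_def\<close>)
      moreover have "w * (v * b j) = b j" by (simp add: w flip: mult.assoc)
      ultimately show ?thesis unfolding R using 2 ne by (auto simp add: W_def w b_def)
    next
      case 3
      have "(\<Sum>l\<in>I. star (W l i) * W l j) = 0" by (rule sum.neutral) (use 3 ne in \<open>simp add: W_def\<close>)
      then show ?thesis unfolding R using 3 ne by (auto simp add: W_def w star_mult sb mult.assoc)
    next
      case 4
      have "(\<Sum>l\<in>I. star (W l i) * W l j) = (\<Sum>l\<in>I. star (W' l i) * W' l j)"
        by (rule sum.cong) (use 4 ne in \<open>auto simp add: W_def\<close>)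
      moreover have "star (W k i) * W k j = star (b i) * t j"
        using 4 ne by (auto simp: W_def star_mult w t_def mult.assoc)
      ultimately have "?R = star (b i) * t j
          + ((\<Sum>r<Suc n. star (Y' r i) * Y' r j) + (if i = j then e *\<^sub>R 1 else 0))"
        unfolding R W'[OF 4] by (simp only:)
      also have "\<dots> = ?L" unfolding schur[of i j, symmetric] by (simp only: ac_simps)
      finally show ?thesis by (rule sym)
    qed
  qed
  then show ?case by blast
qed simp

lemma gram_plus_scalar_factor:
  fixes Y :: "'r \<Rightarrow> 'i \<Rightarrow> 'a::unital_cstar_algebra"
  assumes I: "finite I" and R: "finite R" and e: "e > 0"
  obtains W where "\<And>i j. i \<in> I \<Longrightarrow> j \<in> I \<Longrightarrow>
    (\<Sum>r\<in>R. star (Y r i) * Y r j) + (if i = j then e *\<^sub>R 1 else 0) = (\<Sum>l\<in>I. star (W l i) * W l j)"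
proof -
  obtain f where f: "bij_betw f {..<card R} R" using R ex_bij_betw_nat_finite[of R] by (auto simp: atLeast0LessThan)
  have "(\<Sum>r<card R. star (Y (f r) i) * Y (f r) j) = (\<Sum>r\<in>R. star (Y r i) * Y r j)" for i j
    by (rule sum.reindex_bij_betw[OF f])
  then show thesis
    using gram_plus_scalar_factor_nat[OF I e, where n="card R" and Y="\<lambda>r. Y (f r)"] that by auto
qed

section \<open>Extension of positive functionals\<close>

text \<open>The argument of the Hahn-Banach theorem. Partial extensions are represented by
  their graphs, real subspaces of pairs on which the second component is nonnegative over \<open>C\<close>; this
  alone makes them single-valued, because \<open>0 \<in> C\<close>. A maximal one exists by Zorn's lemma. If it missed
  a vector \<open>w\<close>, a value for \<open>w\<close> could be chosen between the values at the vectors below and above \<open>w\<close>, which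
  exist by the domination hypothesis.\<close>

lemma riesz_extension:
  fixes W W0 C :: "'v::complex_vector set" and f :: "'v \<Rightarrow> real"
  assumes W: "csubspace W" and W0: "csubspace W0" "W0 \<subseteq> W"
    and C0: "0 \<in> C"
    and C_add: "\<And>x y. x \<in> C \<Longrightarrow> y \<in> C \<Longrightarrow> x + y \<in> C"
    and C_scale: "\<And>x r. x \<in> C \<Longrightarrow> r > 0 \<Longrightarrow> complex_of_real r *\<^sub>C x \<in> C"
    and dom: "\<And>w. w \<in> W \<Longrightarrow> \<exists>v\<in>W0. v - w \<in> C"
    and f_add: "\<And>x y. x \<in> W0 \<Longrightarrow> y \<in> W0 \<Longrightarrow> f (x + y) = f x + f y"
    and f_scale: "\<And>x r. x \<in> W0 \<Longrightarrow> f (complex_of_real r *\<^sub>C x) = r * f x"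
    and f_pos: "\<And>x. x \<in> W0 \<Longrightarrow> x \<in> C \<Longrightarrow> 0 \<le> f x"
  obtains F :: "'v \<Rightarrow> real" where
    "\<And>x y. x \<in> W \<Longrightarrow> y \<in> W \<Longrightarrow> F (x + y) = F x + F y"
    "\<And>x r. x \<in> W \<Longrightarrow> F (complex_of_real r *\<^sub>C x) = r * F x"
    "\<And>x. x \<in> W0 \<Longrightarrow> F x = f x"
    "\<And>x. x \<in> W \<Longrightarrow> x \<in> C \<Longrightarrow> 0 \<le> F x"
proof -
  let ?s = "\<lambda>r x. complex_of_real r *\<^sub>C (x::'v)"
  have W_add: "x + y \<in> W" if "x \<in> W" "y \<in> W" for x y using W that by (rule complex_vector.subspace_add)
  have W_scale: "c *\<^sub>C x \<in> W" if "x \<in> W" for c x using W that by (rule complex_vector.subspace_scale)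
  have W0_add: "x + y \<in> W0" if "x \<in> W0" "y \<in> W0" for x y using W0(1) that by (rule complex_vector.subspace_add)
  have W0_scale: "c *\<^sub>C x \<in> W0" if "x \<in> W0" for c x using W0(1) that by (rule complex_vector.subspace_scale)
  have W0_0: "0 \<in> W0" using W0(1) by (rule complex_vector.subspace_0)
  define g where "g = (\<lambda>x. (x, f x)) ` W0"
  define A where "A = {G. g \<subseteq> G \<and> fst ` G \<subseteq> W \<and>
     (\<forall>x r y s. (x, r) \<in> G \<longrightarrow> (y, s) \<in> G \<longrightarrow> (x + y, r + s) \<in> G) \<and>
     (\<forall>x r k. (x, r) \<in> G \<longrightarrow> (?s k x, k * r) \<in> G) \<and>
     (\<forall>x r. (x, r) \<in> G \<longrightarrow> x \<in> C \<longrightarrow> 0 \<le> r)}"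
  have gA: "g \<in> A"
    unfolding A_def g_def using W0 by (auto simp: image_iff f_add f_scale f_pos W0_add W0_scale)
  have "\<exists>M\<in>A. \<forall>X\<in>A. M \<subseteq> X \<longrightarrow> X = M"
  proof (rule subset_Zorn_nonempty)
    show "A \<noteq> {}" using gA by blast
    fix K assume K: "K \<noteq> {}" "subset.chain A K"
    then have KA: "\<And>G. G \<in> K \<Longrightarrow> G \<in> A" by (auto simp: subset.chain_def)
    have two: "\<exists>G\<in>K. p \<in> G \<and> q \<in> G" if pq: "p \<in> \<Union>K" "q \<in> \<Union>K" for p q
    proof -
      obtain G H where GH: "G \<in> K" "H \<in> K" "p \<in> G" "q \<in> H" using pq by blast
      then have "G \<subseteq> H \<or> H \<subseteq> G" using K(2) unfolding subset.chain_def by blast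
      with GH show ?thesis by blast
    qed
    show "\<Union>K \<in> A" unfolding A_def mem_Collect_eq
    proof (intro conjI allI impI)
      show "g \<subseteq> \<Union>K" using K(1) KA unfolding A_def by blast
      show "fst ` \<Union>K \<subseteq> W" using KA unfolding A_def by blast
      show "(x + y, r + s) \<in> \<Union>K" if xy: "(x, r) \<in> \<Union>K" "(y, s) \<in> \<Union>K" for x r y s
      proof -
        obtain G where "G \<in> K" "(x, r) \<in> G" "(y, s) \<in> G" using two[OF xy] by blast
        with KA[of G] show ?thesis unfolding A_def by blast
      qed
      show "(?s k x, k * r) \<in> \<Union>K" if "(x, r) \<in> \<Union>K" for x r k
        using that KA unfolding A_def by blast
      show "0 \<le> r" if "(x, r) \<in> \<Union>K" "x \<in> C" for x r using that KA unfolding A_def by blast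
    qed
  qed
  then obtain M where M: "M \<in> A" and max: "\<And>X. X \<in> A \<Longrightarrow> M \<subseteq> X \<Longrightarrow> X = M" by blast
  have gM: "g \<subseteq> M" and MW: "\<And>x r. (x, r) \<in> M \<Longrightarrow> x \<in> W"
    and M_add: "\<And>x r y s. (x, r) \<in> M \<Longrightarrow> (y, s) \<in> M \<Longrightarrow> (x + y, r + s) \<in> M"
    and M_scale: "\<And>x r k. (x, r) \<in> M \<Longrightarrow> (?s k x, k * r) \<in> M"
    and M_pos: "\<And>x r. (x, r) \<in> M \<Longrightarrow> x \<in> C \<Longrightarrow> 0 \<le> r"
    using M unfolding A_def by auto
  have M_f: "(x, f x) \<in> M" if "x \<in> W0" for x using gM that by (auto simp: g_def)
  have f0: "f 0 = 0" using f_scale[OF W0_0, of 0] by simp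
  have M0: "(0, 0) \<in> M" using M_f[OF W0_0] f0 by simp
  have M_diff: "(x - y, r - s) \<in> M" if "(x, r) \<in> M" "(y, s) \<in> M" for x r y s
    using M_add[OF that(1) M_scale[OF that(2), of "-1"]] by (simp add: complex_vector.scale_minus_left)
  have uniq: "r = s" if "(x, r) \<in> M" "(x, s) \<in> M" for x r s
    using M_pos[OF _ C0, of "r - s"] M_pos[OF _ C0, of "s - r"] M_diff[OF that] M_diff[OF that(2,1)] by simp
  have total: "\<exists>r. (w, r) \<in> M" if w: "w \<in> W" for w
  proof -
    define L where "L = {r. \<exists>x. (x, r) \<in> M \<and> w - x \<in> C}"
    define U where "U = {r. \<exists>x. (x, r) \<in> M \<and> x - w \<in> C}"
    have LU: "l \<le> u" if lu: "l \<in> L" "u \<in> U" for l u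
    proof -
      obtain x y where xy: "(x, l) \<in> M" "w - x \<in> C" "(y, u) \<in> M" "y - w \<in> C"
        using lu by (auto simp: L_def U_def)
      have "y - x = (y - w) + (w - x)" by simp
      then have "y - x \<in> C" using C_add xy by metis
      then show ?thesis using M_pos[OF M_diff[OF xy(3,1)]] by simp
    qed
    have "U \<noteq> {}" using dom[OF w] M_f by (auto simp: U_def)
    have "L \<noteq> {}"
    proof -
      obtain v where v: "v \<in> W0" "v - (- w) \<in> C"
        using dom[of "- w"] w W complex_vector.subspace_neg by blast
      have "- v \<in> W0" using v(1) W0(1) by (rule complex_vector.subspace_neg[rotated])
      moreover have "w - (- v) \<in> C" using v(2) by (simp add: add.commute)
      ultimately have "f (- v) \<in> L" unfolding L_def using M_f by blast
      then show ?thesis by blast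
    qed
    define a where "a = Sup L"
    have La: "l \<le> a" if "l \<in> L" for l
    proof -
      obtain u where "u \<in> U" using \<open>U \<noteq> {}\<close> by blast
      then have "bdd_above L" by (intro bdd_aboveI[of L u] LU)
      with that show ?thesis unfolding a_def by (rule cSup_upper)
    qed
    have aU: "a \<le> u" if "u \<in> U" for u
      unfolding a_def by (rule cSup_least[OF \<open>L \<noteq> {}\<close>]) (rule LU[OF _ that])
    define M' where "M' = {(x + ?s t w, r + t * a) | x r t. (x, r) \<in> M}"
    have MM': "M \<subseteq> M'"
    proof
      fix p assume p: "p \<in> M"
      obtain x r where xr: "p = (x, r)" by (cases p)
      have "(x + ?s 0 w, r + 0 * a) \<in> M'" using p unfolding M'_def xr by blast
      then show "p \<in> M'" by (simp add: xr)
    qed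
    have "M' \<in> A" unfolding A_def mem_Collect_eq
    proof (intro conjI allI impI)
      show "g \<subseteq> M'" using gM MM' by blast
      show "fst ` M' \<subseteq> W" unfolding M'_def using W_add W_scale w MW by auto
      show "(x + y, r + s) \<in> M'" if "(x, r) \<in> M'" "(y, s) \<in> M'" for x r y s
      proof -
        obtain x1 r1 t1 x2 r2 t2 where *: "x = x1 + ?s t1 w" "r = r1 + t1 * a" "(x1, r1) \<in> M"
          "y = x2 + ?s t2 w" "s = r2 + t2 * a" "(x2, r2) \<in> M" using \<open>(x, r) \<in> M'\<close> \<open>(y, s) \<in> M'\<close> unfolding M'_def by auto
        have "x + y = (x1 + x2) + ?s (t1 + t2) w" "r + s = (r1 + r2) + (t1 + t2) * a"
          unfolding * by (simp_all add: scaleC_add_left algebra_simps)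
        then show ?thesis unfolding M'_def using M_add[OF *(3,6)] by blast
      qed
      show "(?s k x, k * r) \<in> M'" if xr: "(x, r) \<in> M'" for x r k
      proof -
        obtain x1 r1 t1 where *: "x = x1 + ?s t1 w" "r = r1 + t1 * a" "(x1, r1) \<in> M"
          using xr unfolding M'_def by auto
        have "?s k x = ?s k x1 + ?s (k * t1) w" "k * r = k * r1 + (k * t1) * a"
          unfolding * by (simp_all add: scaleC_add_right algebra_simps)
        then show ?thesis unfolding M'_def using M_scale[OF *(3)] by blast
      qed
      show "0 \<le> r" if xr: "(x, r) \<in> M'" and xC: "x \<in> C" for x r
      proof -
        obtain y s t where *: "x = y + ?s t w" "r = s + t * a" "(y, s) \<in> M"
          using xr unfolding M'_def by auto
        consider "t = 0" | "t > 0" | "t < 0" by linarith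
        then show ?thesis
        proof cases
          case 1
          then have "x = y" "r = s" by (simp_all add: *)
          then show ?thesis using M_pos[OF *(3)] xC by simp
        next
          case 2
          have "?s (1/t) x \<in> C" using C_scale[OF xC, of "1/t"] 2 by simp
          also have "?s (1/t) x = w - ?s (-1/t) y"
            using 2 by (simp add: * scaleC_add_right complex_vector.scale_minus_left)
          finally have "(-1/t) * s \<in> L" unfolding L_def using M_scale[OF *(3), of "-1/t"] by blast
          from La[OF this] 2 show ?thesis by (simp add: * field_simps)
        next
          case 3
          have "?s (-1/t) x \<in> C" using C_scale[OF xC, of "-1/t"] 3 by simp
          also have "?s (-1/t) x = ?s (-1/t) y - w"
            using 3 by (simp add: * scaleC_diff_right scaleC_add_right complex_vector.scale_minus_left)
          finally have "(-1/t) * s \<in> U" unfolding U_def using M_scale[OF *(3), of "-1/t"] by blast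
          from aU[OF this] 3 show ?thesis by (simp add: * field_simps)
        qed
      qed
    qed
    from max[OF this MM'] have "M' = M" .
    have "(0 + ?s 1 w, 0 + 1 * a) \<in> M'" using M0 unfolding M'_def by blast
    then have "(w, a) \<in> M'" by simp
    with \<open>M' = M\<close> show ?thesis by blast
  qed
  define F where "F x = (THE r. (x, r) \<in> M)" for x
  have F: "F x = r" if "(x, r) \<in> M" for x r unfolding F_def using that uniq by blast
  have FM: "(x, F x) \<in> M" if "x \<in> W" for x using total[OF that] F by metis
  show thesis
  proof (rule that[of F])
    show "F (x + y) = F x + F y" if "x \<in> W" "y \<in> W" for x y
      by (rule F[OF M_add[OF FM FM]]) (fact that)+
    show "F (?s r x) = r * F x" if "x \<in> W" for x r by (rule F[OF M_scale[OF FM[OF that]]])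
    show "F x = f x" if "x \<in> W0" for x by (rule F[OF M_f[OF that]])
    show "0 \<le> F x" if "x \<in> W" "x \<in> C" for x by (rule M_pos[OF FM[OF that(1)] that(2)])
  qed
qed

section \<open>Matrix units\<close>

text \<open>The matrix unit $E_{ij}$ with coefficient \<open>a\<close>.\<close>

definition sing :: "nat \<Rightarrow> nat \<Rightarrow> 'a::star_algebra \<Rightarrow> 'a fmat" where
  "sing i j a = mk_fmat (Suc (max i j)) (\<lambda>p q. if p = i \<and> q = j then a else 0)"

lemma entry_sing: "entry (sing i j a) p q = (if p = i \<and> q = j then a else 0)"
  by (auto simp: sing_def mk_fmat.rep_eq)

lemmas entry_simps = plus_fmat.rep_eq zero_fmat.rep_eq scaleC_fmat.rep_eq star_fmat.rep_eq

lemma entry_uminus: "entry (- x) i j = - entry (x::'a::star_algebra fmat) i j"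
  by (simp add: uminus_fmat.rep_eq)

lemma entry_minus: "entry (x - y) i j = entry x i j - entry (y::'a::star_algebra fmat) i j"
  unfolding minus_fmat_def plus_fmat.rep_eq entry_uminus by simp

lemma entry_sum: "entry (\<Sum>i\<in>I. f i) p q = (\<Sum>i\<in>I. entry (f i :: 'a::star_algebra fmat) p q)"
  by (induction I rule: infinite_finite_induct) (simp_all add: entry_simps)

lemma sing_mult: "sing i j a * sing k l b = (if j = k then sing i l (a * b) else 0)"
proof (rule fmat_eqI)
  fix p q
  have "entry (sing i j a * sing k l b) p q = (\<Sum>r<Suc j. entry (sing i j a) p r * entry (sing k l b) r q)"
    by (rule entry_times) (auto simp: entry_sing)
  also have "\<dots> = (\<Sum>r<Suc j. if r = j then (if p = i \<and> j = k \<and> q = l then a * b else 0) else 0)"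
    by (rule sum.cong) (auto simp: entry_sing)
  finally show "entry (sing i j a * sing k l b) p q = entry (if j = k then sing i l (a * b) else 0) p q"
    by (simp add: entry_sing entry_simps)
qed

lemma star_sing: "star (sing i j a) = sing j i (star a)"
  by (rule fmat_eqI) (auto simp: entry_simps entry_sing)

lemma sing_add: "sing i j (a + b) = sing i j a + sing i j b"
  by (rule fmat_eqI) (simp add: plus_fmat.rep_eq entry_sing)

lemma sing_scaleC: "sing i j (c *\<^sub>C a) = c *\<^sub>C sing i j a"
  by (rule fmat_eqI) (simp add: scaleC_fmat.rep_eq entry_sing)

lemma sing_zero [simp]: "sing i j 0 = 0"
  by (rule fmat_eqI) (simp add: zero_fmat.rep_eq entry_sing)

lemma sing_sum: "sing i j (\<Sum>k\<in>K. f k) = (\<Sum>k\<in>K. sing i j (f k))"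
  by (induction K rule: infinite_finite_induct) (simp_all add: sing_add)

lemma fmat_eq_sum_sing:
  assumes "\<And>i j. k \<le> i \<or> k \<le> j \<Longrightarrow> entry x i j = 0"
  shows "x = (\<Sum>i<k. \<Sum>j<k. sing i j (entry x i j))"
proof (rule fmat_eqI)
  fix p q
  have "entry (\<Sum>i<k. \<Sum>j<k. sing i j (entry x i j)) p q
      = (\<Sum>i<k. \<Sum>j<k. if j = q then if i = p then entry x p q else 0 else 0)"
    unfolding entry_sum entry_sing by (intro sum.cong) auto
  also have "\<dots> = entry x p q" by (cases "p < k"; cases "q < k") (simp_all add: assms not_less)
  finally show "entry x p q = entry (\<Sum>i<k. \<Sum>j<k. sing i j (entry x i j)) p q" by simp
qed

definition diag_mat :: "nat \<Rightarrow> (nat \<Rightarrow> 'a) \<Rightarrow> 'a::star_algebra fmat" where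
  "diag_mat m f = (\<Sum>j<m. sing j j (f j))"

lemma entry_diag_mat: "entry (diag_mat m f) i j = (if i = j \<and> i < m then f i else 0)"
proof -
  have "entry (diag_mat m f) i j = (\<Sum>p<m. if p = i then if i = j then f i else 0 else 0 :: 'a)"
    unfolding diag_mat_def entry_sum entry_sing by (rule sum.cong) auto
  then show ?thesis by simp
qed

lemma entry_diag_mat_times:
  assumes "\<And>i j. m \<le> i \<or> m \<le> j \<Longrightarrow> entry x i j = 0"
  shows "entry (diag_mat m f * x) i j = f i * entry x i j" "entry (x * diag_mat m f) i j = entry x i j * f j"
proof -
  have "entry (diag_mat m f * x) i j = (\<Sum>l<m. entry (diag_mat m f) i l * entry x l j)"
    by (rule entry_times) (simp add: assms)
  also have "\<dots> = (\<Sum>l<m. if l = i then f i * entry x i j else 0)"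
    by (rule sum.cong) (auto simp: entry_diag_mat)
  finally show "entry (diag_mat m f * x) i j = f i * entry x i j" by (auto simp: assms not_less)
  have "entry (x * diag_mat m f) i j = (\<Sum>l<m. entry x i l * entry (diag_mat m f) l j)"
    by (rule entry_times) (simp add: assms)
  also have "\<dots> = (\<Sum>l<m. if l = j then entry x i j * f j else 0)"
    by (rule sum.cong) (auto simp: entry_diag_mat)
  finally show "entry (x * diag_mat m f) i j = entry x i j * f j" by (auto simp: assms not_less)
qed

lemma diag_mat_mult: "diag_mat m f * diag_mat m g = diag_mat m (\<lambda>j. f j * g j)"
  by (rule fmat_eqI, subst entry_diag_mat_times(1)) (auto simp: entry_diag_mat)

lemma star_diag_mat: "star (diag_mat m f) = diag_mat m (\<lambda>j. star (f j))"
  by (simp add: diag_mat_def star_sum star_sing)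

lemma diag_mat_add: "diag_mat m (\<lambda>j. f j + g j) = diag_mat m f + diag_mat m g"
  by (simp add: diag_mat_def sing_add sum.distrib)

lemma diag_mat_scaleC: "diag_mat m (\<lambda>j. c *\<^sub>C f j) = c *\<^sub>C diag_mat m f"
  by (simp add: diag_mat_def sing_scaleC scaleC_sum_right)

section \<open>Orthonormal bases and isometries\<close>

lemma tendsto_ap: "f \<longlonglongrightarrow> l \<Longrightarrow> (\<lambda>n. ap T (f n)) \<longlonglongrightarrow> ap T l"
  by (rule bounded_linear.tendsto[OF ap_bounded_linear])

lemma cinner_star_right: "cinner x (ap (star T) y) = cinner (ap T x) y"
  using star_bop_cinner[of "star T" x y] by simp

lemma cinner_sum_left:
  "cinner (\<Sum>i\<in>I. f i) (x::'h::chilbert_space) = (\<Sum>i\<in>I. cinner (f i) x)"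
  by (induction I rule: infinite_finite_induct) (simp_all add: cinner_add_left)

lemma norm_sum_orthonormal:
  fixes e :: "'i \<Rightarrow> 'h::chilbert_space"
  assumes "finite I" and on: "\<And>i j. i \<in> I \<Longrightarrow> j \<in> I \<Longrightarrow> cinner (e i) (e j) = (if i = j then 1 else 0)"
  shows "(norm (\<Sum>i\<in>I. c i *\<^sub>C e i))\<^sup>2 = (\<Sum>i\<in>I. (cmod (c i))\<^sup>2)"
proof -
  have "complex_of_real ((norm (\<Sum>i\<in>I. c i *\<^sub>C e i))\<^sup>2) = (\<Sum>i\<in>I. \<Sum>j\<in>I. cnj (c i) * (c j * cinner (e i) (e j)))"
    by (simp only: cinner_self[symmetric] cinner_sum_left cinner_sum_right cinner_scaleC_left
        cinner_scaleC_right sum_distrib_left) (subst sum.swap, simp add: mult_ac)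
  also have "\<dots> = (\<Sum>i\<in>I. \<Sum>j\<in>I. if j = i then complex_of_real ((cmod (c i))\<^sup>2) else 0)"
    by (intro sum.cong refl) (simp add: on complex_norm_square mult.commute flip: of_real_power)
  also have "\<dots> = complex_of_real (\<Sum>i\<in>I. (cmod (c i))\<^sup>2)" using assms(1) by simp
  finally show ?thesis using of_real_eq_iff by blast
qed

lemma norm_projection_le:
  fixes e :: "'i \<Rightarrow> 'h::chilbert_space"
  assumes "finite I" and on: "\<And>i j. i \<in> I \<Longrightarrow> j \<in> I \<Longrightarrow> cinner (e i) (e j) = (if i = j then 1 else 0)"
  shows "norm (\<Sum>i\<in>I. cinner (e i) h *\<^sub>C e i) \<le> norm h"
proof -
  let ?P = "\<Sum>i\<in>I. cinner (e i) h *\<^sub>C e i"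
  have "cinner ?P h = complex_of_real (\<Sum>i\<in>I. (cmod (cinner (e i) h))\<^sup>2)"
    by (simp add: cinner_sum_left cinner_scaleC_left complex_norm_square mult.commute flip: of_real_power)
  also have "\<dots> = complex_of_real ((norm ?P)\<^sup>2)"
    by (simp only: norm_sum_orthonormal[OF assms])
  finally have "(norm ?P)\<^sup>2 = cmod (cinner ?P h)" by (simp add: norm_power)
  also have "\<dots> \<le> norm ?P * norm h" by (rule cauchy_schwarz)
  finally show ?thesis by (cases "norm ?P = 0") (simp_all add: power2_eq_square)
qed

definition hilbert_basis :: "(nat \<Rightarrow> 'h::chilbert_space) \<Rightarrow> bool" where
  "hilbert_basis e \<longleftrightarrow> (\<forall>i j. cinner (e i) (e j) = (if i = j then 1 else 0)) \<and>
     (\<forall>h. (\<lambda>N. \<Sum>i<N. cinner (e i) h *\<^sub>C e i) \<longlonglongrightarrow> h)"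

text \<open>Gram-Schmidt orthogonalization along a dense sequence \<open>d\<close>, skipping the vectors that are already in the
  span. Each step finds a further vector because a finite orthonormal set \<open>B\<close> with \<open>P B (d k) = d k\<close>
  for all \<open>k\<close> would span the space, \<open>P B\<close> being continuous.\<close>

lemma hilbert_basis_exists:
  assumes sep: "separable_space (euclidean :: 'h::chilbert_space topology)"
    and inf: "\<not> (\<exists>B::'h::chilbert_space set. finite B \<and> cspan B = UNIV)"
  obtains e :: "nat \<Rightarrow> 'h::chilbert_space" where "hilbert_basis e"
proof -
  obtain D :: "'h set" where D: "countable D" "closure D = UNIV"
    using sep by (auto simp: separable_space_def)
  then have "D \<noteq> {}" by auto
  define d where "d = from_nat_into D"
  have rd: "range d = D" unfolding d_def using \<open>D \<noteq> {}\<close> D(1) by (rule range_from_nat_into)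
  have dense: "\<exists>k. norm (h - d k) < t" if "t > 0" for h t
  proof -
    have "h \<in> closure D" using D(2) by simp
    then obtain y where y: "y \<in> D" "dist y h < t" using \<open>t > 0\<close> unfolding closure_approachable by blast
    then obtain k where "y = d k" using rd by blast
    with y(2) have "norm (h - d k) < t" by (simp add: dist_norm norm_minus_commute)
    then show ?thesis by blast
  qed
  define P where "P B h = (\<Sum>y\<in>B. cinner y h *\<^sub>C y)" for B and h :: 'h
  define onS where "onS B \<longleftrightarrow> finite B \<and> (\<forall>x\<in>B. \<forall>y\<in>B. cinner x y = (if x = y then 1 else 0))" for B :: "'h set"
  have Pdiff: "P B (x - y) = P B x - P B y" for B x y
    by (simp add: P_def cinner_diff_right complex_vector.scale_left_diff_distrib sum_subtractf)
  have Pn: "norm (P B h) \<le> norm h" if "onS B" for B h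
    unfolding P_def using that by (intro norm_projection_le) (auto simp: onS_def)
  have approx: "norm (P B h - h) \<le> 2 * norm (h - x)" if "onS B" "P B x = x" for B h x
  proof -
    have eq: "P B h - h = P B (h - x) - (h - x)" by (simp add: Pdiff that)
    show ?thesis unfolding eq
      using norm_triangle_ineq4[of "P B (h - x)" "h - x"] Pn[OF that(1), of "h - x"] by linarith
  qed
  have ex: "\<exists>k. P B (d k) \<noteq> d k" if B: "onS B" for B
  proof (rule ccontr)
    assume "\<nexists>k. P B (d k) \<noteq> d k"
    then have all: "\<And>k. P B (d k) = d k" by blast
    have "h \<in> cspan B" for h
    proof -
      have "norm (P B h - h) \<le> 0"
      proof (rule field_le_epsilon)
        fix t :: real assume "t > 0"
        then obtain k where "norm (h - d k) < t / 2" using dense[of "t/2" h] by auto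
        with approx[OF B all, of h k] show "norm (P B h - h) \<le> 0 + t" by simp
      qed
      then have "h = P B h" by simp
      moreover have "P B h \<in> cspan B" unfolding P_def
        by (intro complex_vector.span_sum complex_vector.span_scale complex_vector.span_base)
      ultimately show ?thesis by simp
    qed
    then show False using inf B by (auto simp: onS_def)
  qed
  define idx where "idx B = (LEAST k. P B (d k) \<noteq> d k)" for B
  define res where "res B = d (idx B) - P B (d (idx B))" for B
  define new where "new B = (1 / complex_of_real (norm (res B))) *\<^sub>C res B" for B
  have idx: "P B (d (idx B)) \<noteq> d (idx B)" if "onS B" for B
    unfolding idx_def using ex[OF that] by (rule LeastI_ex)
  have orth: "cinner y (h - P B h) = 0" if "onS B" "y \<in> B" for B y h
  proof -
    have "cinner y (P B h) = (\<Sum>x\<in>B. if x = y then cinner y h else 0)"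
      unfolding P_def cinner_sum_right cinner_scaleC_right
      by (rule sum.cong) (use that in \<open>auto simp: onS_def\<close>)
    then show ?thesis using that by (simp add: onS_def cinner_diff_right)
  qed
  have new: "cinner (new B) (new B) = 1" "\<And>y. y \<in> B \<Longrightarrow> cinner y (new B) = 0" "new B \<notin> B"
      "res B = complex_of_real (norm (res B)) *\<^sub>C new B" if B: "onS B" for B
  proof -
    have "res B \<noteq> 0" using idx[OF B] by (simp add: res_def)
    then show n: "cinner (new B) (new B) = 1"
      by (simp add: new_def cinner_scaleC_left cinner_scaleC_right cinner_self power2_eq_square norm_scaleC_hilbert norm_divide)
    show o: "cinner y (new B) = 0" if "y \<in> B" for y
      using orth[OF B that] by (simp add: new_def res_def cinner_scaleC_right)
    show "new B \<notin> B" using n o by force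
    show "res B = complex_of_real (norm (res B)) *\<^sub>C new B" using \<open>res B \<noteq> 0\<close> by (simp add: new_def)
  qed
  have on_ins: "onS (insert (new B) B)" if B: "onS B" for B
  proof -
    have "cinner (new B) y = 0" if "y \<in> B" for y
      using new(2)[OF B that] cinner_commute[of "new B" y] by simp
    with new(1-3)[OF B] B show ?thesis unfolding onS_def by auto
  qed
  have P_ins: "P (insert (new B) B) h = cinner (new B) h *\<^sub>C new B + P B h" if B: "onS B" for B h
    using new(3)[OF B] B by (simp add: P_def onS_def)
  have new_P: "cinner (new B) (P B h) = 0" if B: "onS B" for B h
    unfolding P_def cinner_sum_right cinner_scaleC_right
    by (rule sum.neutral) (use new(2)[OF B] cinner_commute[of "new B"] in auto)
  have keep: "P (insert (new B) B) x = x" if B: "onS B" and x: "P B x = x" for B x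
    using P_ins[OF B, of x] new_P[OF B, of x] x by simp
  have hit: "P (insert (new B) B) (d (idx B)) = d (idx B)" if B: "onS B" for B
  proof -
    have "cinner (new B) (d (idx B)) = cinner (new B) (res B)"
      by (simp add: res_def cinner_diff_right new_P[OF B])
    also have "\<dots> = complex_of_real (norm (res B))"
      by (subst new(4)[OF B]) (simp add: cinner_scaleC_right new(1)[OF B])
    finally show ?thesis using P_ins[OF B, of "d (idx B)"] new(4)[OF B] by (simp add: res_def)
  qed
  define Bs where "Bs = rec_nat {} (\<lambda>_ B. insert (new B) B)"
  have Bs: "Bs 0 = {}" "Bs (Suc n) = insert (new (Bs n)) (Bs n)" for n by (simp_all add: Bs_def)
  have onB: "onS (Bs n)" for n by (induction n) (simp_all add: Bs on_ins, simp add: onS_def)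
  have cover: "\<forall>k<n. P (Bs n) (d k) = d k" for n
  proof (induction n)
    case (Suc n)
    show ?case
    proof (intro allI impI)
      fix k assume k: "k < Suc n"
      show "P (Bs (Suc n)) (d k) = d k"
      proof (cases "P (Bs n) (d k) = d k")
        case True
        then show ?thesis by (simp add: Bs keep[OF onB])
      next
        case False
        with Suc k have "k = n" by (metis less_SucE)
        have "idx (Bs n) = k" unfolding idx_def
          by (rule Least_equality) (use False Suc \<open>k = n\<close> not_le in auto)
        then show ?thesis using hit[OF onB, of n] by (simp add: Bs)
      qed
    qed
  qed simp
  define e where "e n = new (Bs n)" for n
  have Be: "Bs n = e ` {..<n}" for n
    by (induction n) (simp_all add: Bs e_def lessThan_Suc)
  have e_in: "e i \<in> Bs n" if "i < n" for i n using that Be by auto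
  have e_new: "cinner (e i) (e n) = 0" if "i < n" for i n
    using new(2)[OF onB e_in[OF that]] by (simp add: e_def)
  have e_on: "cinner (e i) (e j) = (if i = j then 1 else 0)" for i j
  proof -
    consider "i = j" | "i < j" | "j < i" by linarith
    then show ?thesis
      by cases (use new(1)[OF onB] e_new cinner_commute[of "e i" "e j"] in \<open>auto simp: e_def\<close>)
  qed
  have "inj e"
    by (rule injI) (metis e_on zero_neq_one)
  then have PB: "P (Bs n) h = (\<Sum>i<n. cinner (e i) h *\<^sub>C e i)" for n h
    unfolding P_def Be by (subst sum.reindex) (auto intro: inj_on_subset)
  have "(\<lambda>N. \<Sum>i<N. cinner (e i) h *\<^sub>C e i) \<longlonglongrightarrow> h" for h
  proof (rule metric_LIMSEQ_I)
    fix t :: real assume "t > 0"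
    then obtain k where k: "norm (h - d k) < t / 2" using dense[of "t/2" h] by auto
    have "dist (\<Sum>i<n. cinner (e i) h *\<^sub>C e i) h < t" if "n \<ge> Suc k" for n
      using approx[OF onB, of n "d k" h] cover that k by (simp add: PB dist_norm Suc_le_eq)
    then show "\<exists>no. \<forall>n\<ge>no. dist (\<Sum>i<n. cinner (e i) h *\<^sub>C e i) h < t" by blast
  qed
  with e_on show thesis by (intro that[of e]) (simp add: hilbert_basis_def)
qed

context
  fixes e :: "nat \<Rightarrow> 'h::chilbert_space"
  assumes e: "hilbert_basis e"
begin

lemma basis_orthonormal: "cinner (e i) (e j) = (if i = j then 1 else 0)"
  using e by (simp add: hilbert_basis_def)

lemma basis_expansion: "(\<lambda>N. \<Sum>i<N. cinner (e i) h *\<^sub>C e i) \<longlonglongrightarrow> h"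
  using e by (simp add: hilbert_basis_def)

lemma norm_truncation_le: "norm (\<Sum>i<N. cinner (e i) h *\<^sub>C e i) \<le> norm h"
  by (rule norm_projection_le) (simp_all add: basis_orthonormal)

lemma basis_ext: "(\<And>i. cinner (e i) x = cinner (e i) y) \<Longrightarrow> x = y"
  using basis_expansion[of x] basis_expansion[of y] LIMSEQ_unique by simp

lemma bop_basis_eqI:
  assumes "\<And>j. ap S (e j) = ap T (e j)"
  shows "S = T"
proof (rule bop_eqI)
  fix h
  have eq: "ap S (\<Sum>i<N. cinner (e i) h *\<^sub>C e i) = ap T (\<Sum>i<N. cinner (e i) h *\<^sub>C e i)" for N
    by (simp add: ap_sum_right ap_scaleC assms)
  show "ap S h = ap T h"
    using tendsto_ap[OF basis_expansion, of S h] tendsto_ap[OF basis_expansion, of T h] LIMSEQ_unique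
    unfolding eq by blast
qed

text \<open>The truncated forms \<open>B N\<close> are uniformly bounded, and \<open>B N g h\<close> is constant from \<open>N = n\<close> on if
  \<open>g\<close> and \<open>h\<close> are replaced by their truncations. So they converge to a bounded sesquilinear form,
  which the theorem of Riesz turns into an operator.\<close>

lemma operator_of_bounded_form:
  assumes K: "K \<ge> 0"
    and bd: "\<And>N g h. cmod (\<Sum>i<N. \<Sum>j<N. cinner g (e i) * cinner (e j) h * b i j) \<le> K * norm g * norm h"
  obtains T where "\<And>i j. cinner (e i) (ap T (e j)) = b i j"
proof -
  define B where "B N g h = (\<Sum>i<N. \<Sum>j<N. cinner g (e i) * cinner (e j) h * b i j)" for N :: nat and g h :: 'h
  define P where "P N h = (\<Sum>i<N. cinner (e i) h *\<^sub>C e i)" for N :: nat and h :: 'h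
  have Bbd: "cmod (B N g h) \<le> K * norm g * norm h" for N g h using bd by (simp add: B_def)
  have B_add: "B N g (h + k) = B N g h + B N g k" "B N (g + g') h = B N g h + B N g' h" for N g g' h k
    by (simp_all add: B_def cinner_add_right cinner_add_left algebra_simps sum.distrib)
  have B_diff: "B N g (h - k) = B N g h - B N g k" "B N (g - g') h = B N g h - B N g' h" for N g g' h k
    by (simp_all add: B_def cinner_diff_right cinner_diff_left algebra_simps sum_subtractf)
  have B_scale: "B N g (c *\<^sub>C h) = c * B N g h" "B N (c *\<^sub>C g) h = cnj c * B N g h" for N g h c
    by (simp_all add: B_def cinner_scaleC_right cinner_scaleC_left sum_distrib_left mult_ac)
  have eP: "cinner (e i) (P n h) = (if i < n then cinner (e i) h else 0)" for i n h
  proof -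
    have "cinner (e i) (P n h) = (\<Sum>j<n. if j = i then cinner (e i) h else 0)"
      unfolding P_def cinner_sum_right cinner_scaleC_right basis_orthonormal by (rule sum.cong) auto
    then show ?thesis by simp
  qed
  have Pe: "cinner (P n h) (e i) = (if i < n then cinner h (e i) else 0)" for i n h
    using eP[of i n h] cinner_commute[of "P n h" "e i"] cinner_commute[of h "e i"] by simp
  have BP: "B N (P n g) (P n h) = B n g h" if "n \<le> N" for N n g h
  proof -
    have "B N (P n g) (P n h) = (\<Sum>i<N. if i < n then (\<Sum>j<N. if j < n then cinner g (e i) * cinner (e j) h * b i j else 0) else 0)"
      unfolding B_def by (intro sum.cong refl) (auto simp: eP Pe intro!: sum.cong)
    also have "\<dots> = (\<Sum>i<n. \<Sum>j<N. if j < n then cinner g (e i) * cinner (e j) h * b i j else 0)"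
      by (rule sum.mono_neutral_cong_right) (use that in auto)
    also have "\<dots> = (\<Sum>i<n. \<Sum>j<n. cinner g (e i) * cinner (e j) h * b i j)"
      by (intro sum.cong refl sum.mono_neutral_cong_right) (use that in auto)
    finally show ?thesis by (simp add: B_def)
  qed
  define del where "del g h n = K * norm (g - P n g) * norm h + K * norm g * norm (h - P n h)" for g h n
  have close: "cmod (B N g h - B n g h) \<le> del g h n" if "n \<le> N" for N n g h
  proof -
    have "B N g h - B n g h = B N (g - P n g) h + B N (P n g) (h - P n h)"
      by (simp add: B_diff BP[OF that])
    also have "cmod \<dots> \<le> K * norm (g - P n g) * norm h + K * norm (P n g) * norm (h - P n h)"
      by (rule order_trans[OF norm_triangle_ineq]) (intro add_mono Bbd)
    also have "\<dots> \<le> del g h n" unfolding del_def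
      using norm_truncation_le[where N=n and h=g] K by (simp add: P_def mult_left_mono mult_right_mono)
    finally show ?thesis .
  qed
  have P_lim: "(\<lambda>n. P n h) \<longlonglongrightarrow> h" for h unfolding P_def by (rule basis_expansion)
  have del_lim: "(\<lambda>n. del g h n) \<longlonglongrightarrow> 0" for g h
  proof -
    have "(\<lambda>n. del g h n) \<longlonglongrightarrow> K * norm (g - g) * norm h + K * norm g * norm (h - h)"
      unfolding del_def by (intro tendsto_intros P_lim)
    then show ?thesis by simp
  qed
  have "convergent (\<lambda>N. B N g h)" for g h
  proof (rule Cauchy_convergent, rule metric_CauchyI)
    fix t :: real assume "t > 0"
    then obtain n where n: "\<And>k. k \<ge> n \<Longrightarrow> norm (del g h k - 0) < t / 2"
      using LIMSEQ_D[OF del_lim[of g h], of "t/2"] by auto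
    have "dist (B p g h) (B q g h) < t" if "p \<ge> n" "q \<ge> n" for p q
    proof -
      have "dist (B p g h) (B q g h) \<le> cmod (B p g h - B n g h) + cmod (B q g h - B n g h)"
        by (metis dist_norm dist_triangle2)
      also have "\<dots> \<le> del g h n + del g h n" using close that by (intro add_mono)
      also have "\<dots> < t" using n[of n] by auto
      finally show ?thesis .
    qed
    then show "\<exists>M. \<forall>p\<ge>M. \<forall>q\<ge>M. dist (B p g h) (B q g h) < t" by blast
  qed
  then obtain L where L: "(\<lambda>N. B N g h) \<longlonglongrightarrow> L g h" for g h unfolding convergent_def by metis
  have L_add: "L g (h + k) = L g h + L g k" "L (g + g') h = L g h + L g' h" for g g' h k
    using L[of g "h + k"] tendsto_add[OF L[of g h] L[of g k]]
      L[of "g + g'" h] tendsto_add[OF L[of g h] L[of g' h]]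
    unfolding B_add by (blast intro: LIMSEQ_unique)+
  have L_scale: "L g (c *\<^sub>C h) = c * L g h" "L (c *\<^sub>C g) h = cnj c * L g h" for g h c
    using L[of g "c *\<^sub>C h"] tendsto_mult_left[OF L[of g h], of c]
      L[of "c *\<^sub>C g" h] tendsto_mult_left[OF L[of g h], of "cnj c"]
    unfolding B_scale by (blast intro: LIMSEQ_unique)+
  have L_bd: "cmod (L g h) \<le> K * norm g * norm h" for g h
    by (rule LIMSEQ_le_const2[OF tendsto_norm[OF L]]) (use Bbd in blast)
  have "\<exists>y. \<forall>h. L g h = cinner y h" for g
    by (rule riesz[where K="K * norm g"]) (simp_all add: L_add L_scale L_bd)
  then obtain t where t: "\<And>g h. L g h = cinner (t g) h" by metis
  have "bounded_clinear t" unfolding bounded_clinear_def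
  proof (intro conjI allI exI)
    show "t (x + y) = t x + t y" for x y
      by (rule cinner_ext_left) (simp add: t[symmetric] L_add cinner_add_left)
    show "t (c *\<^sub>C x) = c *\<^sub>C t x" for c x
      by (rule cinner_ext_left) (simp add: t[symmetric] L_scale cinner_scaleC_left)
    show "norm (t g) \<le> K * norm g" for g
    proof (cases "norm (t g) = 0")
      case False
      have "norm (t g) * norm (t g) = cmod (cinner (t g) (t g))"
        by (simp add: cinner_self power2_eq_square norm_mult)
      also have "\<dots> \<le> (K * norm g) * norm (t g)" using L_bd[of g "t g"] by (simp add: t)
      finally show ?thesis using False by simp
    qed (use K in simp)
  qed
  then have ap_t: "ap (Abs_bop t) = t" by (simp add: Abs_bop_inverse)
  show thesis
  proof (rule that[of "star (Abs_bop t)"])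
    fix i j
    have "B N (e i) (e j) = b i j" if "N \<ge> Suc (max i j)" for N
    proof -
      have "B N (e i) (e j) = (\<Sum>p<N. \<Sum>q<N. if q = j then if p = i then b i j else 0 else 0)"
        unfolding B_def basis_orthonormal by (intro sum.cong refl) auto
      also have "\<dots> = b i j"
      proof -
        have "i < N" "j < N" using that by auto
        then show ?thesis by simp
      qed
      finally show ?thesis .
    qed
    then have "(\<lambda>N. B N (e i) (e j)) \<longlonglongrightarrow> b i j"
      by (intro tendsto_eventually eventually_sequentiallyI[of "Suc (max i j)"])
    then have "L (e i) (e j) = b i j" using L LIMSEQ_unique by blast
    then show "cinner (e i) (ap (star (Abs_bop t)) (e j)) = b i j"
      by (simp add: cinner_star_right ap_t t)
  qed
qed

lemma basis_isometry:
  assumes s: "inj s"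
  obtains W where "\<And>j. ap W (e j) = e (s j)"
proof -
  have "cmod (\<Sum>i<N. \<Sum>j<N. cinner g (e i) * cinner (e j) h * (if i = s j then 1 else 0)) \<le> 1 * norm g * norm h"
    (is "cmod ?S \<le> _") for N g h
  proof -
    define J where "J = {j\<in>{..<N}. s j < N}"
    define x where "x = (\<Sum>j\<in>J. cinner (e (s j)) g *\<^sub>C e j)"
    have fin: "finite J" by (simp add: J_def)
    have "?S = (\<Sum>j<N. \<Sum>i<N. if i = s j then cinner g (e (s j)) * cinner (e j) h else 0)"
      by (subst sum.swap) (intro sum.cong refl, auto)
    also have "\<dots> = (\<Sum>j<N. if s j < N then cinner g (e (s j)) * cinner (e j) h else 0)" by simp
    also have "\<dots> = (\<Sum>j\<in>J. cinner g (e (s j)) * cinner (e j) h)"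
      unfolding J_def by (rule sum.mono_neutral_cong_right) auto
    also have "\<dots> = cinner x h"
      unfolding x_def cinner_sum_left cinner_scaleC_left by (metis cinner_commute)
    finally have S: "?S = cinner x h" .
    have "(norm x)\<^sup>2 = (norm (\<Sum>j\<in>J. cinner (e (s j)) g *\<^sub>C e (s j)))\<^sup>2"
      unfolding x_def using s
      by (subst norm_sum_orthonormal[OF fin], simp add: basis_orthonormal)
         (subst norm_sum_orthonormal[OF fin], auto simp: basis_orthonormal inj_eq)
    then have "norm x = norm (\<Sum>j\<in>J. cinner (e (s j)) g *\<^sub>C e (s j))" by simp
    also have "\<dots> \<le> norm g"
      using s by (intro norm_projection_le[OF fin, of "\<lambda>j. e (s j)"]) (simp add: basis_orthonormal inj_eq)
    finally have "norm x * norm h \<le> norm g * norm h" by (simp add: mult_right_mono)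
    with cauchy_schwarz[of x h] show ?thesis unfolding S by simp
  qed
  from operator_of_bounded_form[OF zero_le_one this]
  obtain W where W: "\<And>i j. cinner (e i) (ap W (e j)) = (if i = s j then 1 else 0)" by blast
  have "ap W (e j) = e (s j)" for j by (rule basis_ext) (simp add: W basis_orthonormal)
  then show thesis by (rule that)
qed

text \<open>The isometry \<open>W i\<close> maps the basis onto its members with index congruent to \<open>i\<close> modulo \<open>m\<close>.
  Such isometries identify the \<open>m\<close>-fold sum of the space with the space itself.\<close>

lemma cuntz_isometries:
  assumes m: "m > 0"
  obtains W :: "nat \<Rightarrow> 'h bop" where
    "\<And>i j. i < m \<Longrightarrow> j < m \<Longrightarrow> star (W i) * W j = (if i = j then 1 else 0)"
    "(\<Sum>i<m. W i * star (W i)) = 1"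
proof -
  have "\<exists>W. \<forall>j. ap W (e j) = e (m * j + i)" for i
  proof -
    have "inj (\<lambda>j. m * j + i)" using m by (auto intro!: injI)
    then obtain W where "\<And>j. ap W (e j) = e (m * j + i)" by (rule basis_isometry) blast
    then show ?thesis by blast
  qed
  then obtain W where W: "\<And>i j. ap (W i) (e j) = e (m * j + i)" by metis
  have mod: "(m * a + i = m * b + j) = (a = b \<and> i = j)" if "i < m" "j < m" for a b i j
  proof
    assume "m * a + i = m * b + j"
    then have "(m * a + i) div m = (m * b + j) div m" "(m * a + i) mod m = (m * b + j) mod m" by simp_all
    with that show "a = b \<and> i = j" by simp
  qed simp
  have starW: "ap (star (W i)) (e b) = (if b mod m = i then e (b div m) else 0)" if "i < m" for i b
  proof (rule basis_ext)
    fix a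
    have "(m * a + i = b) = (a = b div m \<and> i = b mod m)"
      using mod[OF that mod_less_divisor[OF m], of a "b div m" b] by simp
    then show "cinner (e a) (ap (star (W i)) (e b)) = cinner (e a) (if b mod m = i then e (b div m) else 0)"
      by (auto simp: cinner_star_right W basis_orthonormal)
  qed
  show thesis
  proof (rule that[of W])
    show "star (W i) * W j = (if i = j then 1 else 0)" if "i < m" "j < m" for i j
      by (rule bop_basis_eqI) (use that in \<open>auto simp: times_bop.rep_eq W starW one_bop.rep_eq zero_bop.rep_eq\<close>)
    show "(\<Sum>i<m. W i * star (W i)) = 1"
    proof (rule bop_basis_eqI)
      fix j
      have "ap (\<Sum>i<m. W i * star (W i)) (e j) = (\<Sum>i<m. if i = j mod m then e j else 0)"
        unfolding ap_sum_left by (rule sum.cong) (auto simp: times_bop.rep_eq W starW)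
      then show "ap (\<Sum>i<m. W i * star (W i)) (e j) = ap 1 (e j)"
        using m by (simp add: one_bop.rep_eq)
    qed
  qed
qed

end

lemma hsum_unitary_of_isometries:
  fixes W :: "nat \<Rightarrow> 'h::chilbert_space bop"
  assumes iso: "\<And>i j. i < m \<Longrightarrow> j < m \<Longrightarrow> star (W i) * W j = (if i = j then 1 else 0)"
    and sum: "(\<Sum>i<m. W i * star (W i)) = 1"
  shows "hsum_unitary m (\<lambda>f. \<Sum>i<m. ap (W i) (f i))"
  unfolding hsum_unitary_def
proof (intro conjI ballI allI)
  let ?V = "\<lambda>f. \<Sum>i<m. ap (W i) (f i)"
  fix f g :: "nat \<Rightarrow> 'h" and c assume "f \<in> hsum m" "g \<in> hsum m"
  show "?V (\<lambda>i. f i + g i) = ?V f + ?V g" by (simp add: ap_add sum.distrib)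
  have "cinner (ap (W i) x) (ap (W j) y) = (if i = j then cinner x y else 0)" if "i < m" "j < m" for i j x y
  proof -
    have "cinner (ap (W i) x) (ap (W j) y) = cinner x (ap (star (W i) * W j) y)"
      by (simp add: cinner_star_right times_bop.rep_eq)
    then show ?thesis using iso[OF that] by (simp add: one_bop.rep_eq zero_bop.rep_eq)
  qed
  then have "cinner (?V f) (?V g) = (\<Sum>i<m. \<Sum>j<m. if i = j then cinner (f i) (g j) else 0)"
    unfolding cinner_sum_left cinner_sum_right by (intro sum.cong refl) auto
  then show "cinner (?V f) (?V g) = hsum_inner m f g" by (simp add: hsum_inner_def)
next
  fix f :: "nat \<Rightarrow> 'h" and c
  show "(\<Sum>i<m. ap (W i) (c *\<^sub>C f i)) = c *\<^sub>C (\<Sum>i<m. ap (W i) (f i))"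
    by (simp add: ap_scaleC scaleC_sum_right)
next
  have "h \<in> (\<lambda>f. \<Sum>i<m. ap (W i) (f i)) ` hsum m" for h
  proof (rule image_eqI)
    have "h = ap (\<Sum>i<m. W i * star (W i)) h" by (simp add: sum one_bop.rep_eq)
    then show "h = (\<Sum>i<m. ap (W i) (if i < m then ap (star (W i)) h else 0))"
      by (simp add: ap_sum_left times_bop.rep_eq)
  qed (auto simp: hsum_def)
  then show "(\<lambda>f. \<Sum>i<m. ap (W i) (f i)) ` hsum m = UNIV" by blast
qed

section \<open>Sums of squares in matrix algebras\<close>

definition star_subalg :: "'b::star_algebra set \<Rightarrow> bool" where
  "star_subalg A \<longleftrightarrow> csubspace A \<and> (\<forall>x\<in>A. \<forall>y\<in>A. x * y \<in> A) \<and> (\<forall>x\<in>A. star x \<in> A)"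

lemma star_subalgD:
  assumes "star_subalg A"
  shows "0 \<in> A" "\<And>x y. x \<in> A \<Longrightarrow> y \<in> A \<Longrightarrow> x + y \<in> A" "\<And>x y. x \<in> A \<Longrightarrow> y \<in> A \<Longrightarrow> x - y \<in> A"
    "\<And>c x. x \<in> A \<Longrightarrow> c *\<^sub>C x \<in> A" "\<And>x y. x \<in> A \<Longrightarrow> y \<in> A \<Longrightarrow> x * y \<in> A" "\<And>x. x \<in> A \<Longrightarrow> star x \<in> A"
    "\<And>I f. (\<And>i. i \<in> I \<Longrightarrow> f i \<in> A) \<Longrightarrow> (\<Sum>i\<in>I. f i) \<in> A"
proof -
  have s: "csubspace A" using assms by (simp add: star_subalg_def)
  show "0 \<in> A" using s by (rule complex_vector.subspace_0)
  show "x + y \<in> A" if "x \<in> A" "y \<in> A" for x y using s that by (rule complex_vector.subspace_add)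
  show "x - y \<in> A" if "x \<in> A" "y \<in> A" for x y using s that by (rule complex_vector.subspace_diff)
  show "c *\<^sub>C x \<in> A" if "x \<in> A" for c x using s that by (rule complex_vector.subspace_scale)
  show "x * y \<in> A" if "x \<in> A" "y \<in> A" for x y using assms that by (simp add: star_subalg_def)
  show "star x \<in> A" if "x \<in> A" for x using assms that by (simp add: star_subalg_def)
  show "(\<Sum>i\<in>I. f i) \<in> A" if "\<And>i. i \<in> I \<Longrightarrow> f i \<in> A" for I :: "'c set" and f
    using s that by (rule complex_vector.subspace_sum)
qed

text \<open>Matrices of all finite sizes at once.\<close>

definition entries_in :: "'b::star_algebra set \<Rightarrow> 'b fmat set" where
  "entries_in A = {X. \<forall>i j. entry X i j \<in> A}"

lemma csubspace_entries_in:
  assumes "csubspace A" shows "csubspace (entries_in A)"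
proof (rule complex_vector.subspaceI)
  show "0 \<in> entries_in A"
    using complex_vector.subspace_0[OF assms] by (simp add: entries_in_def zero_fmat.rep_eq)
  show "X + Y \<in> entries_in A" if "X \<in> entries_in A" "Y \<in> entries_in A" for X Y
    using complex_vector.subspace_add[OF assms] that by (simp add: entries_in_def plus_fmat.rep_eq)
  show "c *\<^sub>C X \<in> entries_in A" if "X \<in> entries_in A" for c X
    using complex_vector.subspace_scale[OF assms] that by (simp add: entries_in_def scaleC_fmat.rep_eq)
qed

lemma star_subalg_entries_in:
  assumes "star_subalg A" shows "star_subalg (entries_in A)"
  unfolding star_subalg_def
proof (intro conjI ballI)
  show "csubspace (entries_in A)" using assms by (intro csubspace_entries_in) (simp add: star_subalg_def)
  fix X Y assume XY: "X \<in> entries_in A" "Y \<in> entries_in A"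
  have "(\<Sum>l | entry X i l \<noteq> 0. entry X i l * entry Y l j) \<in> A" for i j
    using XY by (intro star_subalgD(5,7)[OF assms]) (simp_all add: entries_in_def)
  then show "X * Y \<in> entries_in A" by (simp add: entries_in_def times_fmat.rep_eq)
next
  fix X assume "X \<in> entries_in A"
  then show "star X \<in> entries_in A"
    using star_subalgD(6)[OF assms] by (simp add: entries_in_def star_fmat.rep_eq)
qed

lemma Mat_UNIV: "Mat m UNIV = {x. \<forall>i j. \<not> (i < m \<and> j < m) \<longrightarrow> entry x i j = 0}"
  by (auto simp: mem_Mat_iff)

lemma star_subalg_Mat: "star_subalg (Mat m (UNIV :: 'a::star_algebra set))"
  unfolding star_subalg_def
proof (intro conjI ballI)
  show "csubspace (Mat m (UNIV :: 'a set))"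
    by (rule complex_vector.subspaceI)
      (simp_all add: Mat_UNIV zero_fmat.rep_eq plus_fmat.rep_eq scaleC_fmat.rep_eq)
  fix x y :: "'a fmat" assume xy: "x \<in> Mat m UNIV" "y \<in> Mat m UNIV"
  have "entry (x * y) i j = (\<Sum>l<m. entry x i l * entry y l j)" for i j
    by (rule entry_times) (use xy in \<open>auto simp: Mat_UNIV\<close>)
  then show "x * y \<in> Mat m UNIV" using xy by (auto simp: Mat_UNIV)
next
  fix x :: "'a fmat" assume "x \<in> Mat m UNIV"
  then show "star x \<in> Mat m UNIV" by (auto simp: Mat_UNIV star_fmat.rep_eq)
qed

lemma sing_in_Mat: "i < m \<Longrightarrow> j < m \<Longrightarrow> sing i j a \<in> Mat m UNIV"
  by (auto simp: Mat_UNIV entry_sing)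

lemma sing_in_entries_in: "0 \<in> A \<Longrightarrow> a \<in> A \<Longrightarrow> sing i j a \<in> entries_in A"
  by (auto simp: entries_in_def entry_sing)

inductive_set sos :: "'b::star_algebra set \<Rightarrow> 'b set" for A where
  sos_zero: "0 \<in> sos A"
| sos_step: "y \<in> A \<Longrightarrow> x \<in> sos A \<Longrightarrow> star y * y + x \<in> sos A"

lemma sos_add: "x \<in> sos A \<Longrightarrow> z \<in> sos A \<Longrightarrow> x + z \<in> sos A"
  by (induction x rule: sos.induct) (auto simp: add.assoc intro: sos_step)

lemma sos_square: "y \<in> A \<Longrightarrow> star y * y \<in> sos A"
  using sos_step[OF _ sos_zero] by simp

lemma sos_sum: "(\<And>i. i \<in> I \<Longrightarrow> f i \<in> sos A) \<Longrightarrow> (\<Sum>i\<in>I. f i) \<in> sos A"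
  by (induction I rule: infinite_finite_induct) (auto intro: sos_zero sos_add)

lemma sos_subset: "star_subalg A \<Longrightarrow> x \<in> sos A \<Longrightarrow> x \<in> A"
proof -
  assume A: "star_subalg A" and "x \<in> sos A"
  from this(2) show "x \<in> A"
    by (induction x rule: sos.induct) (simp_all add: star_subalgD[OF A])
qed

lemma sos_scale:
  assumes A: "star_subalg A" and x: "x \<in> sos A" and r: "0 \<le> r"
  shows "complex_of_real r *\<^sub>C x \<in> sos A"
  using x
proof (induction x rule: sos.induct)
  case (sos_step y x)
  let ?y = "complex_of_real (sqrt r) *\<^sub>C y"
  have "complex_of_real r *\<^sub>C (star y * y) = star ?y * ?y"
    using r by (simp add: star_scaleC mult_scaleC_left mult_scaleC_right flip: of_real_mult)
  moreover have "?y \<in> A" using sos_step.hyps A by (simp add: star_subalgD)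
  ultimately show ?case using sos.sos_step sos_step.IH by (simp add: scaleC_add_right)
qed (simp add: sos_zero)

lemma sos_conjugate:
  assumes A: "star_subalg A" and a: "a \<in> A" and x: "x \<in> sos A"
  shows "star a * x * a \<in> sos A"
  using x
proof (induction x rule: sos.induct)
  case (sos_step y x)
  have "star a * (star y * y + x) * a = star (y * a) * (y * a) + star a * x * a"
    by (simp add: star_mult distrib_left distrib_right mult.assoc)
  moreover have "y * a \<in> A" using A sos_step.hyps(1) a by (rule star_subalgD)
  ultimately show ?case using sos.sos_step[OF _ sos_step.IH] by metis
qed (simp add: sos_zero)

lemma star_sos: "x \<in> sos A \<Longrightarrow> star x = x"
  by (induction x rule: sos.induct) (simp_all add: star_add star_mult)

lemma sos_as_sum: "x \<in> sos A \<Longrightarrow> \<exists>n Y. (\<forall>r. Y r \<in> A \<or> Y r = 0) \<and> x = (\<Sum>r<(n::nat). star (Y r) * Y r)"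
proof (induction x rule: sos.induct)
  case sos_zero
  then show ?case by (intro exI[of _ 0] exI[of _ "\<lambda>_. 0"]) simp
next
  case (sos_step y x)
  then obtain n Y where Y: "\<forall>r. Y r \<in> A \<or> Y r = 0" "x = (\<Sum>r<(n::nat). star (Y r) * Y r)" by blast
  have "(\<Sum>r<n. star ((Y(n := y)) r) * (Y(n := y)) r) = x"
    unfolding Y(2) by (rule sum.cong) auto
  then have "star y * y + x = (\<Sum>r<Suc n. star ((Y(n := y)) r) * (Y(n := y)) r)"
    by (simp add: add.commute)
  moreover have "\<forall>r. (Y(n := y)) r \<in> A \<or> (Y(n := y)) r = 0" using Y sos_step.hyps by simp
  ultimately show ?case by (intro exI[of _ "Suc n"] exI[of _ "Y(n := y)"] conjI)
qed

abbreviation block_mats :: "nat \<Rightarrow> 'a::star_algebra fmat fmat set" where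
  "block_mats m \<equiv> entries_in (Mat m UNIV)"

lemma star_subalg_block_mats: "star_subalg (block_mats m)"
  by (intro star_subalg_entries_in star_subalg_Mat)

definition mat_one :: "nat \<Rightarrow> 'a::unital_star_algebra fmat" where
  "mat_one m = diag_mat m (\<lambda>_. 1)"

definition block_one :: "nat \<Rightarrow> nat \<Rightarrow> 'a::unital_star_algebra fmat fmat" where
  "block_one m k = diag_mat k (\<lambda>_. mat_one m)"

lemma entry_mat_one: "entry (mat_one m) i j = (if i = j \<and> i < m then 1 else 0)"
  by (simp add: mat_one_def entry_diag_mat)

lemma unit_of_Mat_eq: "unit_of (Mat m (UNIV :: 'a::unital_star_algebra set)) = mat_one m"
  unfolding unit_of_Mat by (rule fmat_eqI) (auto simp: entry_mat_one mk_fmat.rep_eq)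

lemma mat_one_in_Mat: "mat_one m \<in> Mat m UNIV"
  by (auto simp: Mat_UNIV entry_mat_one)

lemma entry_block_one: "entry (block_one m k) i j = (if i = j \<and> i < k then mat_one m else 0)"
  by (simp add: block_one_def entry_diag_mat)

lemma block_one_in: "block_one m k \<in> block_mats m"
  by (auto simp: entries_in_def entry_block_one mat_one_in_Mat star_subalgD[OF star_subalg_Mat])

lemma mat_one_mult:
  assumes "x \<in> Mat m UNIV"
  shows "mat_one m * x = x" "x * mat_one m = x"
  unfolding mat_one_def
  by (rule fmat_eqI, subst entry_diag_mat_times, use assms in \<open>auto simp: Mat_UNIV\<close>)+

lemma star_mat_one: "star (mat_one m) = mat_one m"
  by (simp add: mat_one_def star_diag_mat)

lemma block_one_mult:
  assumes X: "X \<in> block_mats m" and z: "\<And>i j. k \<le> i \<or> k \<le> j \<Longrightarrow> entry X i j = 0"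
  shows "block_one m k * X = X" "X * block_one m k = X"
  unfolding block_one_def
  by (rule fmat_eqI, subst entry_diag_mat_times[OF z], use X in \<open>simp_all add: entries_in_def mat_one_mult\<close>)+

lemma star_block_one: "star (block_one m k) = block_one m k"
  by (simp add: block_one_def star_diag_mat star_mat_one)

lemma block_one_idem: "block_one m k * block_one m k = block_one m k"
  by (rule block_one_mult(1)[OF block_one_in]) (auto simp: entry_block_one)

lemma block_one_mono:
  assumes "k \<le> k'"
  shows "block_one m k' - (block_one m k :: 'a::unital_star_algebra fmat fmat) \<in> sos (block_mats m)"
proof -
  have split: "{..<k'} = {..<k} \<union> {k..<k'}" using assms by auto
  have "block_one m k' = (block_one m k :: 'a fmat fmat) + (\<Sum>i\<in>{k..<k'}. sing i i (mat_one m))"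
    unfolding block_one_def diag_mat_def split by (rule sum.union_disjoint) auto
  then have "block_one m k' - (block_one m k :: 'a fmat fmat) = (\<Sum>i\<in>{k..<k'}. sing i i (mat_one m))" by simp
  also have "\<dots> = (\<Sum>i\<in>{k..<k'}. star (sing i i (mat_one m)) * sing i i (mat_one m))"
    by (rule sum.cong) (simp_all add: star_sing sing_mult star_mat_one mat_one_mult mat_one_in_Mat)
  also have "\<dots> \<in> sos (block_mats m)"
    by (intro sos_sum sos_square sing_in_entries_in) (simp_all add: mat_one_in_Mat star_subalgD[OF star_subalg_Mat])
  finally show ?thesis .
qed

text \<open>Boundedness of \<open>X\<close> in terms of the order on the matrices: $X^*X$ lies below a multiple of the unit of some size.\<close>

definition dominated :: "nat \<Rightarrow> 'a::unital_star_algebra fmat fmat \<Rightarrow> bool" where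
  "dominated m X \<longleftrightarrow> (\<exists>k c. 0 \<le> c \<and> complex_of_real c *\<^sub>C block_one m k - star X * X \<in> sos (block_mats m))"

lemma dominated_mono:
  fixes X :: "'a::unital_star_algebra fmat fmat"
  assumes "complex_of_real c *\<^sub>C block_one m k - X \<in> sos (block_mats m)" "0 \<le> c" "k \<le> k'"
  shows "complex_of_real c *\<^sub>C block_one m k' - X \<in> sos (block_mats m)"
proof -
  have "complex_of_real c *\<^sub>C block_one m k' - X
      = complex_of_real c *\<^sub>C (block_one m k' - block_one m k) + (complex_of_real c *\<^sub>C block_one m k - X)"
    by (simp add: scaleC_diff_right)
  also have "\<dots> \<in> sos (block_mats m)"
    by (intro sos_add sos_scale star_subalg_block_mats block_one_mono assms)
  finally show ?thesis .
qed

text \<open>$(X+Y)^*(X+Y)=2X^*X+2Y^*Y-(X-Y)^*(X-Y)$.\<close>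

lemma dominated_add:
  assumes X: "X \<in> block_mats m" "dominated m X" and Y: "Y \<in> block_mats m" "dominated m Y"
  shows "dominated m (X + Y)"
proof -
  obtain k c k' c' where *: "0 \<le> c" "complex_of_real c *\<^sub>C block_one m k - star X * X \<in> sos (block_mats m)"
    "0 \<le> c'" "complex_of_real c' *\<^sub>C block_one m k' - star Y * Y \<in> sos (block_mats m)"
    using X Y by (auto simp: dominated_def)
  define n where "n = max k k'"
  have 1: "complex_of_real c *\<^sub>C block_one m n - star X * X \<in> sos (block_mats m)"
    by (rule dominated_mono[OF *(2,1)]) (simp add: n_def)
  have 2: "complex_of_real c' *\<^sub>C block_one m n - star Y * Y \<in> sos (block_mats m)"
    by (rule dominated_mono[OF *(4,3)]) (simp add: n_def)
  have 3: "star (X - Y) * (X - Y) \<in> sos (block_mats m)"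
    using X Y by (intro sos_square star_subalgD[OF star_subalg_block_mats])
  have U: "complex_of_real (2 * (c + c')) *\<^sub>C U = (complex_of_real c *\<^sub>C U + complex_of_real c *\<^sub>C U)
      + (complex_of_real c' *\<^sub>C U + complex_of_real c' *\<^sub>C U)" for U :: "'a fmat fmat"
    by (simp flip: scaleC_add_left)
  have "complex_of_real (2 * (c + c')) *\<^sub>C block_one m n - star (X + Y) * (X + Y)
      = (complex_of_real c *\<^sub>C block_one m n - star X * X) + (complex_of_real c *\<^sub>C block_one m n - star X * X)
      + ((complex_of_real c' *\<^sub>C block_one m n - star Y * Y) + (complex_of_real c' *\<^sub>C block_one m n - star Y * Y))
      + star (X - Y) * (X - Y)"
    unfolding U by (simp only: star_add star_diff algebra_simps)
  also have "\<dots> \<in> sos (block_mats m)" by (intro sos_add 1 2 3)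
  finally show ?thesis using * unfolding dominated_def by (intro exI[of _ n] exI[of _ "2 * (c + c')"]) simp
qed

text \<open>The element $c-a^*a$ is a square in the algebra of entries, so the difference is a
  sum of squares of diagonal matrices with a single nonzero entry.\<close>

lemma dominated_sing:
  fixes a :: "'a::unital_cstar_algebra"
  assumes q: "q < m"
  shows "dominated m (sing i j (sing p q a))"
proof -
  define c where "c = (norm a)\<^sup>2"
  obtain d where d: "c *\<^sub>R 1 - star a * a = star d * d" using norm_sq_minus_square[of a c] c_def by auto
  define Z where "Z l r = sing l l (sing r r (if l = j \<and> r = q then d else sqrt c *\<^sub>R 1))" for l r
  have Z: "star (Z l r) * Z l r = complex_of_real c *\<^sub>C sing l l (sing r r 1)
      - (if r = q then if l = j then sing j j (sing q q (star a * a)) else 0 else 0)" for l r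
  proof -
    have "star (Z l r) * Z l r = sing l l (sing r r (if l = j \<and> r = q then star d * d else c *\<^sub>R 1))"
      by (simp add: Z_def star_sing sing_mult star_scaleR c_def power2_eq_square)
    also have "\<dots> = sing l l (sing r r (complex_of_real c *\<^sub>C 1 - (if l = j \<and> r = q then star a * a else 0)))"
      by (simp add: d[symmetric] scaleR_eq_scaleC)
    also have "\<dots> = complex_of_real c *\<^sub>C sing l l (sing r r 1)
      - sing l l (sing r r (if l = j \<and> r = q then star a * a else 0))"
    proof -
      have sd: "sing l l (sing r r (x - y)) = sing l l (sing r r x) - sing l l (sing r r y)" for x y :: 'a
        using sing_add[of r r "x - y" y] sing_add[of l l "sing r r (x - y)" "sing r r y"] by (simp add: eq_diff_eq)
      show ?thesis by (simp add: sd sing_scaleC)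
    qed
    finally show ?thesis by auto
  qed
  have "star (sing i j (sing p q a)) * sing i j (sing p q a) = sing j j (sing q q (star a * a))"
    by (simp add: star_sing sing_mult)
  also have "\<dots> = (\<Sum>l<Suc j. \<Sum>r<m. if r = q then if l = j then sing j j (sing q q (star a * a)) else 0 else 0)"
    using q by simp
  finally have "complex_of_real c *\<^sub>C block_one m (Suc j) - star (sing i j (sing p q a)) * sing i j (sing p q a)
      = (\<Sum>l<Suc j. \<Sum>r<m. star (Z l r) * Z l r)"
    unfolding Z block_one_def mat_one_def diag_mat_def
    by (simp only: sing_sum scaleC_sum_right sum_subtractf)
  also have "\<dots> \<in> sos (block_mats m)"
    by (intro sos_sum sos_square)
      (auto simp: Z_def intro!: sing_in_entries_in sing_in_Mat star_subalgD[OF star_subalg_Mat])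
  finally show ?thesis unfolding dominated_def
    by (intro exI[of _ "Suc j"] exI[of _ c]) (simp add: c_def)
qed

lemma dominated_sum:
  "(\<And>i. i \<in> I \<Longrightarrow> f i \<in> block_mats m \<and> dominated m (f i)) \<Longrightarrow>
    (\<Sum>i\<in>I. f i) \<in> block_mats m \<and> dominated m (\<Sum>i\<in>I. f i)"
proof (induction I rule: infinite_finite_induct)
  case (insert i I)
  then show ?case by (auto intro!: dominated_add star_subalgD[OF star_subalg_block_mats])
qed (auto simp: dominated_def star_subalgD[OF star_subalg_block_mats] intro!: exI[of _ 0] sos_zero)

lemma dominated_block_mats:
  fixes X :: "'a::unital_cstar_algebra fmat fmat"
  assumes X: "X \<in> block_mats m"
  shows "dominated m X"
proof -
  obtain k where k: "\<And>i j. k \<le> i \<or> k \<le> j \<Longrightarrow> entry X i j = 0" using entry_bound by metis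
  have E: "entry X i j = (\<Sum>p<m. \<Sum>q<m. sing p q (entry (entry X i j) p q))" for i j
    by (rule fmat_eq_sum_sing) (use X in \<open>auto simp: entries_in_def Mat_UNIV\<close>)
  have "X = (\<Sum>i<k. \<Sum>j<k. sing i j (\<Sum>p<m. \<Sum>q<m. sing p q (entry (entry X i j) p q)))"
    unfolding E[symmetric] by (rule fmat_eq_sum_sing[OF k])
  also have "\<dots> = (\<Sum>i<k. \<Sum>j<k. \<Sum>p<m. \<Sum>q<m. sing i j (sing p q (entry (entry X i j) p q)))"
    by (simp only: sing_sum)
  finally have eq: "X = \<dots>" .
  have "\<dots> \<in> block_mats m \<and> dominated m \<dots>"
    by (intro dominated_sum conjI dominated_sing sing_in_entries_in sing_in_Mat star_subalgD[OF star_subalg_Mat]) auto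
  then show ?thesis using eq by metis
qed

text \<open>From $X^*X\le c$ and $(1-X)^*(1-X)\ge 0$ one obtains $X+X^*\le 1+c$.\<close>

lemma block_order_unit:
  fixes X :: "'a::unital_cstar_algebra fmat fmat"
  assumes X: "X \<in> block_mats m"
  obtains k c where "(complex_of_real c *\<^sub>C block_one m k - X) + star (complex_of_real c *\<^sub>C block_one m k - X)
    \<in> sos (block_mats m)"
proof -
  obtain l c where c: "0 \<le> c" "complex_of_real c *\<^sub>C block_one m l - star X * X \<in> sos (block_mats m)"
    using dominated_block_mats[OF X] by (auto simp: dominated_def)
  obtain l' where l': "\<And>i j. l' \<le> i \<or> l' \<le> j \<Longrightarrow> entry X i j = 0" using entry_bound by metis
  define k where "k = max l l'"
  define U :: "'a fmat fmat" where "U = block_one m k"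
  have U: "U * X = X" "X * U = X" "star U = U" "U * U = U" "U \<in> block_mats m"
    unfolding U_def by (intro block_one_mult[OF X] l' star_block_one block_one_idem block_one_in; auto simp: k_def)+
  have sU: "star X * U = star X" "U * star X = star X" using U(1-3) by (metis star_mult)+
  have 1: "complex_of_real c *\<^sub>C U - star X * X \<in> sos (block_mats m)" unfolding U_def
    by (rule dominated_mono[OF c(2,1)]) (simp add: k_def)
  have 2: "star (U - X) * (U - X) \<in> sos (block_mats m)"
    using X U by (intro sos_square star_subalgD[OF star_subalg_block_mats])
  have h: "complex_of_real ((c + 1) / 2) *\<^sub>C U + complex_of_real ((c + 1) / 2) *\<^sub>C U = complex_of_real c *\<^sub>C U + U"
  proof -
    have "complex_of_real ((c + 1) / 2) *\<^sub>C U + complex_of_real ((c + 1) / 2) *\<^sub>C U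
        = complex_of_real ((c + 1) / 2 + (c + 1) / 2) *\<^sub>C U" by (simp only: scaleC_add_left of_real_add)
    also have "(c + 1) / 2 + (c + 1) / 2 = c + 1" by simp
    finally show ?thesis by (simp add: scaleC_add_left)
  qed
  have "star (U - X) * (U - X) = U - X - star X + star X * X"
    by (simp add: star_diff algebra_simps U sU)
  then have "(complex_of_real ((c + 1) / 2) *\<^sub>C U - X) + star (complex_of_real ((c + 1) / 2) *\<^sub>C U - X)
      = (complex_of_real c *\<^sub>C U - star X * X) + star (U - X) * (U - X)"
    using h by (simp add: star_diff star_scaleC U algebra_simps)
  also have "\<dots> \<in> sos (block_mats m)" by (intro sos_add 1 2)
  finally show thesis unfolding U_def by (rule that)
qed

text \<open>Flattening matrices of matrices to matrices indexed by pairs turns a sum of squares into the Gram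
  matrix of the rows of all the \<open>Y r\<close>.\<close>

lemma sos_plus_unit_square:
  fixes X :: "'a::unital_cstar_algebra fmat fmat"
  assumes X: "X \<in> sos (block_mats m)" and z: "\<And>i j. k \<le> i \<or> k \<le> j \<Longrightarrow> entry X i j = 0" and e: "e > 0"
  obtains w where "w \<in> Mat k (Mat m UNIV)" "X + complex_of_real e *\<^sub>C block_one m k = star w * w"
proof -
  obtain n Y where "\<forall>r. Y r \<in> block_mats m \<or> Y r = 0" and XY: "X = (\<Sum>r<(n::nat). star (Y r) * Y r)"
    using sos_as_sum[OF X] by blast
  then have Y: "Y r \<in> block_mats m" for r using star_subalgD(1)[OF star_subalg_block_mats] by metis
  have "\<forall>r. \<exists>N. \<forall>i j. N \<le> i \<or> N \<le> j \<longrightarrow> entry (Y r) i j = 0" by (intro allI entry_bound)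
  from choice[OF this] have "\<exists>K. \<forall>r. \<forall>i j. K r \<le> i \<or> K r \<le> j \<longrightarrow> entry (Y r) i j = 0" .
  then obtain K where K: "\<And>r i j. K r \<le> i \<or> K r \<le> j \<Longrightarrow> entry (Y r) i j = 0" by blast
  have Yz: "entry (entry (Y r) i j) p q = 0" if "m \<le> p \<or> m \<le> q" for r i j p q
    using Y[of r] that by (auto simp: entries_in_def Mat_UNIV)
  define R where "R = Sigma {..<n} (\<lambda>r. {..<K r} \<times> {..<m})"
  define I where "I = {..<k} \<times> {..<m}"
  define Q where "Q = (\<lambda>(r, s, t) (i, p). entry (entry (Y r) s i) t p)"
  have fin: "finite I" "finite R" by (simp_all add: I_def R_def)
  obtain W where W: "\<And>i j. i \<in> I \<Longrightarrow> j \<in> I \<Longrightarrow>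
      (\<Sum>r\<in>R. star (Q r i) * Q r j) + (if i = j then e *\<^sub>R 1 else 0) = (\<Sum>l\<in>I. star (W l i) * W l j)"
    using gram_plus_scalar_factor[OF fin e] by blast
  define w where "w = mk_fmat k (\<lambda>i j. mk_fmat m (\<lambda>p q. W (i, p) (j, q)))"
  have w: "entry w i j = (if i < k \<and> j < k then mk_fmat m (\<lambda>p q. W (i, p) (j, q)) else 0)" for i j
    by (simp add: w_def mk_fmat.rep_eq)
  have w2: "entry (entry w i j) p q = (if i < k \<and> j < k \<and> p < m \<and> q < m then W (i, p) (j, q) else 0)" for i j p q
    by (simp add: w mk_fmat.rep_eq entry_simps)
  have "w \<in> Mat k (Mat m UNIV)" by (simp add: mem_Mat_iff w mk_fmat.rep_eq)
  moreover have "X + complex_of_real e *\<^sub>C block_one m k = star w * w"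
  proof (rule fmat_eqI, rule fmat_eqI)
    fix i j p q
    have XE: "entry (entry X i j) p q = (\<Sum>r\<in>R. star (Q r (i, p)) * Q r (j, q))"
    proof -
      have 1: "entry (star (Y r) * Y r) i j = (\<Sum>s<K r. star (entry (Y r) s i) * entry (Y r) s j)" for r
        unfolding entry_simps(4)[symmetric]
        by (subst entry_times[where N="K r"]) (auto simp: K entry_simps)
      have 2: "entry (star (entry (Y r) s i) * entry (Y r) s j) p q
          = (\<Sum>t<m. star (entry (entry (Y r) s i) t p) * entry (entry (Y r) s j) t q)" for r s
        by (subst entry_times[where N=m]) (auto simp: Yz entry_simps)
      have "entry (entry X i j) p q = (\<Sum>r<n. \<Sum>s<K r. \<Sum>t<m. star (Q (r, s, t) (i, p)) * Q (r, s, t) (j, q))"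
        unfolding XY entry_sum 1 2 Q_def by simp
      also have "\<dots> = (\<Sum>r<n. \<Sum>st\<in>{..<K r} \<times> {..<m}. star (Q (r, st) (i, p)) * Q (r, st) (j, q))"
        by (simp add: sum.cartesian_product case_prod_unfold)
      also have "\<dots> = (\<Sum>r\<in>R. star (Q r (i, p)) * Q r (j, q))"
        unfolding R_def by (subst sum.Sigma) (auto simp: case_prod_unfold)
      finally show ?thesis .
    qed
    have "entry (entry (star w * w) i j) p q = (\<Sum>s<k. \<Sum>t<m. star (entry (entry w s i) t p) * entry (entry w s j) t q)"
    proof -
      have 1: "entry (star w * w) i j = (\<Sum>s<k. star (entry w s i) * entry w s j)"
        by (subst entry_times[where N=k]) (auto simp: w entry_simps)
      have 2: "entry (star (entry w s i) * entry w s j) p q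
          = (\<Sum>t<m. star (entry (entry w s i) t p) * entry (entry w s j) t q)" for s
        by (subst entry_times[where N=m]) (auto simp: w2 entry_simps)
      show ?thesis unfolding 1 entry_sum 2 ..
    qed
    also have "\<dots> = (\<Sum>(s, t)\<in>I. star (entry (entry w s i) t p) * entry (entry w s j) t q)"
      unfolding I_def by (simp add: sum.cartesian_product)
    finally have ww: "entry (entry (star w * w) i j) p q = \<dots>" .
    show "entry (entry (X + complex_of_real e *\<^sub>C block_one m k) i j) p q = entry (entry (star w * w) i j) p q"
    proof (cases "i < k \<and> j < k \<and> p < m \<and> q < m")
      case True
      then have "(i, p) \<in> I" "(j, q) \<in> I" by (auto simp: I_def)
      note W' = W[OF this]
      have "(\<Sum>(s, t)\<in>I. star (entry (entry w s i) t p) * entry (entry w s j) t q)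
          = (\<Sum>l\<in>I. star (W l (i, p)) * W l (j, q))"
        by (rule sum.cong) (use True in \<open>auto simp: I_def w2\<close>)
      then show ?thesis unfolding ww using W' True
        by (auto simp: entry_simps XE[symmetric] entry_block_one entry_mat_one scaleR_eq_scaleC)
    next
      case False
      then have "(\<Sum>(s, t)\<in>I. star (entry (entry w s i) t p) * entry (entry w s j) t q) = 0"
        by (intro sum.neutral) (auto simp: w2)
      moreover have "entry (entry X i j) p q = 0"
      proof (cases "i < k \<and> j < k")
        case True
        with False have "m \<le> p \<or> m \<le> q" by auto
        moreover have "X \<in> block_mats m" using X by (rule sos_subset[OF star_subalg_block_mats])
        ultimately show ?thesis by (auto simp: entries_in_def Mat_UNIV)
      next
        case False
        then show ?thesis by (auto simp: z entry_simps not_less)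
      qed
      moreover have "entry (entry (block_one m k :: 'a fmat fmat) i j) p q = 0"
        using False by (auto simp: entry_block_one entry_mat_one entry_simps)
      ultimately show ?thesis unfolding ww by (simp add: entry_simps)
    qed
  qed
  ultimately show thesis by (rule that)
qed

section \<open>Extension of ucp maps into the bounded operators\<close>

lemma bounded_bilinear_cinner: "bounded_bilinear (cinner :: 'h::chilbert_space \<Rightarrow> 'h \<Rightarrow> complex)"
proof
  fix a a' b b' :: 'h and r :: real
  show "cinner (a + a') b = cinner a b + cinner a' b" by (rule cinner_add_left)
  show "cinner a (b + b') = cinner a b + cinner a b'" by (rule cinner_add_right)
  show "cinner (r *\<^sub>R a) b = r *\<^sub>R cinner a b"
    by (simp add: scaleR_eq_scaleC' cinner_scaleC_left scaleR_conv_of_real)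
  show "cinner a (r *\<^sub>R b) = r *\<^sub>R cinner a b"
    by (simp add: scaleR_eq_scaleC' cinner_scaleC_right scaleR_conv_of_real)
  show "\<exists>K. \<forall>a b::'h. norm (cinner a b) \<le> norm a * norm b * K"
    by (rule exI[of _ 1]) (simp add: cauchy_schwarz)
qed

lemmas tendsto_cinner = bounded_bilinear.tendsto[OF bounded_bilinear_cinner]

lemma nonneg_Reals_iff: "z \<in> \<real>\<^sub>\<ge>\<^sub>0 \<longleftrightarrow> 0 \<le> Re z \<and> Im z = 0" for z :: complex
  by (rule complex_nonneg_Reals_iff)

text \<open>A form on pairs of scalars that is nonnegative has a positive semidefinite
  coefficient matrix; the second inequality is the nonnegativity of its determinant.\<close>

lemma psd_form_2:
  fixes a b c d :: complex
  assumes psd: "\<And>s t. cnj s * s * a + cnj s * t * b + cnj t * s * c + cnj t * t * d \<in> \<real>\<^sub>\<ge>\<^sub>0"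
  shows "c = cnj b" "(cmod b)\<^sup>2 \<le> Re a * Re d"
proof -
  have a: "0 \<le> Re a" "Im a = 0" using psd[of 1 0] by (simp_all add: nonneg_Reals_iff)
  have d: "0 \<le> Re d" "Im d = 0" using psd[of 0 1] by (simp_all add: nonneg_Reals_iff)
  have 1: "Im b + Im c = 0" using psd[of 1 1] a d by (simp add: nonneg_Reals_iff)
  have 2: "Re b - Re c = 0" using psd[of 1 \<i>] a d by (simp add: nonneg_Reals_iff)
  show c: "c = cnj b" using 1 2 by (simp add: complex_eq_iff)
  define B where "B = (cmod b)\<^sup>2"
  have q: "0 \<le> x\<^sup>2 * Re a + 2 * (x * y * B) + y\<^sup>2 * B * Re d" for x y :: real
  proof -
    let ?s = "complex_of_real x" and ?t = "cnj b * complex_of_real y"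
    have bb: "b * cnj b = complex_of_real B" "cnj b * b = complex_of_real B"
      unfolding B_def by (simp_all only: complex_norm_square mult.commute)
    have "cnj ?s * ?s * a + cnj ?s * ?t * b + cnj ?t * ?s * c + cnj ?t * ?t * d
      = complex_of_real (x\<^sup>2) * a + complex_of_real (x * y) * (cnj b * b) + complex_of_real (x * y) * (b * cnj b)
        + complex_of_real (y\<^sup>2) * (b * cnj b) * d"
      by (simp add: c power2_eq_square mult_ac)
    also have "\<dots> = complex_of_real (x\<^sup>2) * a + complex_of_real (2 * (x * y * B)) + complex_of_real (y\<^sup>2 * B) * d"
      unfolding bb by simp
    finally have "complex_of_real (x\<^sup>2) * a + complex_of_real (2 * (x * y * B)) + complex_of_real (y\<^sup>2 * B) * d \<in> \<real>\<^sub>\<ge>\<^sub>0"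
      using psd[of ?s ?t] by simp
    then have "0 \<le> Re (complex_of_real (x\<^sup>2) * a + complex_of_real (2 * (x * y * B)) + complex_of_real (y\<^sup>2 * B) * d)"
      unfolding nonneg_Reals_iff by blast
    then show ?thesis
      by (simp only: plus_complex.sel Re_complex_of_real times_complex.sel Im_complex_of_real)
  qed
  have B0: "0 \<le> B" by (simp add: B_def)
  have "B \<le> Re a * Re d"
  proof (cases "Re d > 0")
    case True
    have "0 \<le> Re d * (Re a * Re d - B)" using q[of "Re d" "-1"] by (simp add: power2_eq_square algebra_simps)
    with True show ?thesis by (simp add: zero_le_mult_iff)
  next
    case False
    with d have d0: "Re d = 0" by simp
    have "B \<le> 0"
    proof (rule ccontr)
      assume "\<not> B \<le> 0"
      then have B: "B > 0" by simp
      define x where "x = B / (Re a + 1)"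
      have x: "x > 0" using B a by (simp add: x_def)
      have "0 \<le> x * (x * Re a - 2 * B)" using q[of x "-1"] d0 by (simp add: power2_eq_square algebra_simps)
      with x have "2 * B \<le> x * Re a" by (simp add: zero_le_mult_iff)
      moreover have "x * Re a \<le> x * (Re a + 1)" using x by (simp add: algebra_simps)
      moreover have "x * (Re a + 1) = B" using a by (simp add: x_def)
      ultimately show False using B by simp
    qed
    then show ?thesis by (simp add: d0)
  qed
  then show "(cmod b)\<^sup>2 \<le> Re a * Re d" by (simp add: B_def)
qed

text \<open>For \<open>k = T h\<close> the Cauchy-Schwarz inequality of a positive form, with its first factor bounded by
  \<open>a\<close> times the square of the norm, takes the shape of the hypothesis.\<close>

lemma norm_square_le_of_form:
  fixes k :: "'h::chilbert_space"
  assumes "(cmod (cinner k k))\<^sup>2 \<le> (a * (norm k)\<^sup>2) * b" "0 \<le> a * b"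
  shows "(norm k)\<^sup>2 \<le> a * b"
proof (cases "k = 0")
  case False
  have "cmod (cinner k k) = (norm k)\<^sup>2" by (simp add: cinner_self norm_power)
  then have "(norm k)\<^sup>2 * (norm k)\<^sup>2 \<le> (norm k)\<^sup>2 * (a * b)"
    using assms(1) by (simp add: power2_eq_square mult_ac)
  then show ?thesis by (rule mult_left_le_imp_le) (use False in simp)
qed (use assms in simp)

lemma sum_nonneg_Reals:
  fixes f :: "'i \<Rightarrow> complex"
  assumes "\<And>i. i \<in> I \<Longrightarrow> f i \<in> \<real>\<^sub>\<ge>\<^sub>0"
  shows "(\<Sum>i\<in>I. f i) \<in> \<real>\<^sub>\<ge>\<^sub>0"
  using assms by (simp add: nonneg_Reals_iff sum_nonneg)

text \<open>The sum runs over the nonzero entries, so that it is finite without reference to a size.\<close>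

definition mat_form :: "(nat \<Rightarrow> nat \<Rightarrow> 'b::zero \<Rightarrow> complex) \<Rightarrow> 'b fmat \<Rightarrow> complex" where
  "mat_form \<phi> X = (\<Sum>p | entry X (fst p) (snd p) \<noteq> 0. \<phi> (fst p) (snd p) (entry X (fst p) (snd p)))"

lemma mat_form_eq:
  assumes "\<And>i j. \<phi> i j 0 = 0" and z: "\<And>i j. N \<le> i \<or> N \<le> j \<Longrightarrow> entry X i j = 0"
  shows "mat_form \<phi> X = (\<Sum>i<N. \<Sum>j<N. \<phi> i j (entry X i j))"
proof -
  have "mat_form \<phi> X = (\<Sum>p\<in>{..<N} \<times> {..<N}. \<phi> (fst p) (snd p) (entry X (fst p) (snd p)))"
    unfolding mat_form_def
  proof (rule sum.mono_neutral_left)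
    show "{p. entry X (fst p) (snd p) \<noteq> 0} \<subseteq> {..<N} \<times> {..<N}"
      using z by (auto simp flip: not_le)
  qed (auto simp: assms(1))
  then show ?thesis by (simp add: sum.cartesian_product case_prod_unfold)
qed

lemma mat_form_add:
  fixes X Y :: "'b::star_algebra fmat"
  assumes add: "\<And>i j x y. x \<in> A \<Longrightarrow> y \<in> A \<Longrightarrow> \<phi> i j (x + y) = \<phi> i j x + \<phi> i j y"
    and 0: "\<And>i j. \<phi> i j 0 = 0" and X: "X \<in> entries_in A" and Y: "Y \<in> entries_in A"
  shows "mat_form \<phi> (X + Y) = mat_form \<phi> X + mat_form \<phi> Y"
proof -
  obtain M N where M: "\<And>i j. M \<le> i \<or> M \<le> j \<Longrightarrow> entry X i j = 0" and N: "\<And>i j. N \<le> i \<or> N \<le> j \<Longrightarrow> entry Y i j = 0"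
    using entry_bound[of X] entry_bound[of Y] by blast
  define K where "K = max M N"
  have "mat_form \<phi> X = (\<Sum>i<K. \<Sum>j<K. \<phi> i j (entry X i j))"
    by (rule mat_form_eq[where \<phi>=\<phi>, OF 0]) (rule M, auto simp: K_def)
  moreover have "mat_form \<phi> Y = (\<Sum>i<K. \<Sum>j<K. \<phi> i j (entry Y i j))"
    by (rule mat_form_eq[where \<phi>=\<phi>, OF 0]) (rule N, auto simp: K_def)
  moreover have "mat_form \<phi> (X + Y) = (\<Sum>i<K. \<Sum>j<K. \<phi> i j (entry (X + Y) i j))"
    by (rule mat_form_eq[where \<phi>=\<phi>, OF 0]) (auto simp: plus_fmat.rep_eq M N K_def)
  moreover have "\<phi> i j (entry (X + Y) i j) = \<phi> i j (entry X i j) + \<phi> i j (entry Y i j)" for i j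
    using X Y by (simp add: plus_fmat.rep_eq entries_in_def add)
  ultimately show ?thesis by (simp add: sum.distrib)
qed

lemma mat_form_scaleC:
  fixes X :: "'b::star_algebra fmat"
  assumes scale: "\<And>i j c x. x \<in> A \<Longrightarrow> \<phi> i j (c *\<^sub>C x) = c * \<phi> i j x"
    and 0: "\<And>i j. \<phi> i j 0 = 0" and X: "X \<in> entries_in A"
  shows "mat_form \<phi> (c *\<^sub>C X) = c * mat_form \<phi> X"
proof -
  obtain N where N: "\<And>i j. N \<le> i \<or> N \<le> j \<Longrightarrow> entry X i j = 0" using entry_bound[of X] by blast
  have "mat_form \<phi> X = (\<Sum>i<N. \<Sum>j<N. \<phi> i j (entry X i j))" by (rule mat_form_eq[where \<phi>=\<phi>, OF 0 N])
  moreover have "mat_form \<phi> (c *\<^sub>C X) = (\<Sum>i<N. \<Sum>j<N. \<phi> i j (entry (c *\<^sub>C X) i j))"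
    by (rule mat_form_eq[where \<phi>=\<phi>, OF 0]) (simp add: scaleC_fmat.rep_eq N)
  moreover have "\<phi> i j (entry (c *\<^sub>C X) i j) = c * \<phi> i j (entry X i j)" for i j
    using X by (simp add: scaleC_fmat.rep_eq entries_in_def scale)
  ultimately show ?thesis by (simp add: sum_distrib_left)
qed

lemma mat_form_sing:
  assumes 0: "\<And>i j. \<phi> i j 0 = 0"
  shows "mat_form \<phi> (sing i j x) = \<phi> i j x"
proof -
  define N where "N = Suc (max i j)"
  have ij: "i < N" "j < N" by (auto simp: N_def)
  have "mat_form \<phi> (sing i j x) = (\<Sum>p<N. \<Sum>q<N. \<phi> p q (entry (sing i j x) p q))"
    by (rule mat_form_eq[where \<phi>=\<phi>, OF 0]) (auto simp: entry_sing N_def)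
  also have "\<dots> = (\<Sum>p<N. \<Sum>q<N. if q = j then if p = i then \<phi> i j x else 0 else 0)"
    by (intro sum.cong refl) (auto simp: entry_sing 0)
  also have "\<dots> = \<phi> i j x" using ij by simp
  finally show ?thesis .
qed

lemma sum_cinner_square_nonneg:
  fixes Y :: "'h::chilbert_space bop fmat"
  assumes Y: "\<And>i j. k \<le> i \<or> k \<le> j \<Longrightarrow> entry Y i j = 0"
  shows "(\<Sum>i<k. \<Sum>j<k. cinner (h i) (ap (entry (star Y * Y) i j) (h j))) \<in> \<real>\<^sub>\<ge>\<^sub>0"
proof -
  define v where "v l = (\<Sum>j<k. ap (entry Y l j) (h j))" for l
  have "entry (star Y * Y) i j = (\<Sum>l<k. star (entry Y l i) * entry Y l j)" for i j
    by (subst entry_times[where N=k]) (auto simp: star_fmat.rep_eq Y)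
  then have "cinner (h i) (ap (entry (star Y * Y) i j) (h j)) = (\<Sum>l<k. cinner (ap (entry Y l i) (h i)) (ap (entry Y l j) (h j)))" for i j
    by (simp add: ap_sum_left cinner_sum_right times_bop.rep_eq cinner_star_right)
  then have "(\<Sum>i<k. \<Sum>j<k. cinner (h i) (ap (entry (star Y * Y) i j) (h j)))
      = (\<Sum>i<k. \<Sum>j<k. \<Sum>l<k. cinner (ap (entry Y l i) (h i)) (ap (entry Y l j) (h j)))" by simp
  also have "\<dots> = (\<Sum>l<k. \<Sum>i<k. \<Sum>j<k. cinner (ap (entry Y l i) (h i)) (ap (entry Y l j) (h j)))"
    by (subst sum.swap[of _ "{..<k}" "{..<k}"], subst (2) sum.swap) (rule refl)
  also have "\<dots> = (\<Sum>l<k. cinner (v l) (v l))"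
    unfolding v_def cinner_sum_left cinner_sum_right by (rule sum.cong[OF refl], rule sum.swap)
  also have "\<dots> = complex_of_real (\<Sum>l<k. (norm (v l))\<^sup>2)" by (simp add: cinner_self)
  finally show ?thesis by (simp add: nonneg_Reals_iff sum_nonneg)
qed

text \<open>The functional \<open>s\<close> of \<open>\<psi>\<close> is nonnegative on sums of squares: adding a small
  multiple of the unit turns the sum into a single square, to which complete positivity of \<open>\<psi>\<close>
  applies. To extend complex functionals by \<open>riesz_extension\<close>, real parts are extended with respect to the
  cone of all \<open>X\<close> with \<open>X + star X\<close> a sum of squares; it contains the skew-adjoint elements, so
  the extension vanishes there and its complexification is real on self-adjoint elements.\<close>

lemma positive_functional_extension:
  fixes S :: "'a::unital_cstar_algebra fmat set" and \<psi> :: "'a fmat \<Rightarrow> 'h::chilbert_space bop"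
  assumes S: "operator_subsystem (Mat m UNIV) S" and \<psi>: "ucp (Mat m UNIV) S \<psi>"
    and e: "hilbert_basis e"
  obtains \<Phi> :: "'a fmat fmat \<Rightarrow> complex" where
    "\<And>X Y. X \<in> block_mats m \<Longrightarrow> Y \<in> block_mats m \<Longrightarrow> \<Phi> (X + Y) = \<Phi> X + \<Phi> Y"
    "\<And>c X. X \<in> block_mats m \<Longrightarrow> \<Phi> (c *\<^sub>C X) = c * \<Phi> X"
    "\<And>X. X \<in> sos (block_mats m) \<Longrightarrow> \<Phi> X \<in> \<real>\<^sub>\<ge>\<^sub>0"
    "\<And>i j x. x \<in> S \<Longrightarrow> \<Phi> (sing i j x) = cinner (e i) (ap (\<psi> x) (e j))"
proof -
  have SM: "S \<subseteq> Mat m UNIV" and Ssub: "csubspace S" and Sstar: "\<And>x. x \<in> S \<Longrightarrow> star x \<in> S"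
    and SE: "mat_one m \<in> S"
    using S by (auto simp: operator_subsystem_def unit_of_Mat_eq)
  have S0: "0 \<in> S" using Ssub by (rule complex_vector.subspace_0)
  have \<psi>_add: "\<And>x y. x \<in> S \<Longrightarrow> y \<in> S \<Longrightarrow> \<psi> (x + y) = \<psi> x + \<psi> y"
    and \<psi>_scale: "\<And>c x. x \<in> S \<Longrightarrow> \<psi> (c *\<^sub>C x) = c *\<^sub>C \<psi> x" and \<psi>_unit: "\<psi> (mat_one m) = 1"
    and cp: "\<And>k x. x \<in> Mat k S \<Longrightarrow> positive_in (Mat k (Mat m UNIV)) x \<Longrightarrow> positive_in (Mat k UNIV) (amplify k \<psi> x)"
    using \<psi> by (auto simp: ucp_def completely_positive_def unit_of_Mat_eq)
  have \<psi>0: "\<psi> 0 = 0" using \<psi>_scale[OF S0, of 0] by simp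
  define \<phi> where "\<phi> i j x = cinner (e i) (ap (\<psi> x) (e j))" for i j x
  have \<phi>0: "\<phi> i j 0 = 0" for i j by (simp add: \<phi>_def \<psi>0 zero_bop.rep_eq)
  let ?A = "block_mats m :: 'a fmat fmat set" and ?B = "entries_in S"
  define s where "s = mat_form \<phi>"
  note W_alg = star_subalgD[OF star_subalg_block_mats]
  have W: "csubspace ?A" by (rule star_subalg_block_mats[unfolded star_subalg_def, THEN conjunct1])
  have W0: "csubspace ?B" by (rule csubspace_entries_in[OF Ssub])
  have W0W: "?B \<subseteq> ?A" using SM by (auto simp: entries_in_def)
  have W0_add: "X + Y \<in> ?B" if "X \<in> ?B" "Y \<in> ?B" for X Y using W0 that by (rule complex_vector.subspace_add)
  have W0_diff: "X - Y \<in> ?B" if "X \<in> ?B" "Y \<in> ?B" for X Y using W0 that by (rule complex_vector.subspace_diff)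
  have W0_scale: "c *\<^sub>C X \<in> ?B" if "X \<in> ?B" for c X using W0 that by (rule complex_vector.subspace_scale)
  have W0_star: "star X \<in> ?B" if "X \<in> ?B" for X using that Sstar by (simp add: entries_in_def star_fmat.rep_eq)
  have W0_unit: "block_one m k \<in> ?B" for k using SE S0 by (simp add: entries_in_def entry_block_one)
  have s_add: "s (X + Y) = s X + s Y" if "X \<in> ?B" "Y \<in> ?B" for X Y
    unfolding s_def by (rule mat_form_add[where \<phi>=\<phi> and A=S, OF _ \<phi>0 that])
      (simp add: \<phi>_def \<psi>_add plus_bop.rep_eq cinner_add_right)
  have s_scale: "s (c *\<^sub>C X) = c * s X" if "X \<in> ?B" for c X
    unfolding s_def by (rule mat_form_scaleC[where \<phi>=\<phi> and A=S, OF _ \<phi>0 that])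
      (simp add: \<phi>_def \<psi>_scale scaleC_bop.rep_eq cinner_scaleC_right)
  have s_sing: "s (sing i j x) = \<phi> i j x" for i j x unfolding s_def by (rule mat_form_sing[where \<phi>=\<phi>, OF \<phi>0])
  have s_diff: "s (X - Y) = s X - s Y" if "X \<in> ?B" "Y \<in> ?B" for X Y
    using s_add[OF W0_diff[OF that] that(2)] by simp
  have s_unit: "s (block_one m k) = of_nat k" for k
  proof -
    have "s (block_one m k) = (\<Sum>i<k. \<Sum>j<k. \<phi> i j (entry (block_one m k) i j))"
      unfolding s_def by (rule mat_form_eq[where \<phi>=\<phi>, OF \<phi>0]) (auto simp: entry_block_one)
    also have "\<dots> = (\<Sum>i<k. \<Sum>j<k. if i = j then 1 else 0)"
      by (intro sum.cong refl)
        (auto simp: entry_block_one \<phi>0, simp add: \<phi>_def \<psi>_unit one_bop.rep_eq basis_orthonormal[OF e])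
    finally show ?thesis by simp
  qed
  have s_pos: "s X \<in> \<real>\<^sub>\<ge>\<^sub>0" if X: "X \<in> ?B" "X \<in> sos ?A" for X
  proof -
    obtain k where k: "\<And>i j. k \<le> i \<or> k \<le> j \<Longrightarrow> entry X i j = 0" using entry_bound[of X] by blast
    have sq: "s X + complex_of_real t * of_nat k \<in> \<real>\<^sub>\<ge>\<^sub>0" if t: "t > 0" for t
    proof -
      let ?Z = "X + complex_of_real t *\<^sub>C block_one m k"
      obtain w where w: "w \<in> Mat k (Mat m UNIV)" "?Z = star w * w"
        using sos_plus_unit_square[OF X(2) k t] by blast
      have Z0: "?Z \<in> ?B" by (intro W0_add W0_scale W0_unit X)
      have Zk: "entry ?Z i j = 0" if "k \<le> i \<or> k \<le> j" for i j
        using that by (auto simp: plus_fmat.rep_eq scaleC_fmat.rep_eq k entry_block_one)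
      have "?Z \<in> Mat k S" using Z0 Zk by (auto simp: mem_Mat_iff entries_in_def not_less)
      moreover have "positive_in (Mat k (Mat m UNIV)) ?Z" using w by (auto simp: positive_in_def)
      ultimately obtain Y where Y: "Y \<in> Mat k UNIV" "amplify k \<psi> ?Z = star Y * Y"
        using cp unfolding positive_in_def by blast
      have Yk: "entry Y i j = 0" if "k \<le> i \<or> k \<le> j" for i j
        using Y(1) that by (auto simp: Mat_UNIV)
      have "s ?Z = (\<Sum>i<k. \<Sum>j<k. \<phi> i j (entry ?Z i j))"
        unfolding s_def by (rule mat_form_eq[where \<phi>=\<phi>, OF \<phi>0 Zk])
      also have "\<dots> = (\<Sum>i<k. \<Sum>j<k. cinner (e i) (ap (entry (amplify k \<psi> ?Z) i j) (e j)))"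
        by (intro sum.cong refl) (simp add: amplify_def mk_fmat.rep_eq \<phi>_def)
      also have "\<dots> \<in> \<real>\<^sub>\<ge>\<^sub>0" unfolding Y(2) by (rule sum_cinner_square_nonneg[OF Yk])
      also have "s ?Z = s X + complex_of_real t * of_nat k"
        using s_add[OF X(1) W0_scale[OF W0_unit, of "complex_of_real t" k]] by (simp add: s_scale W0_unit s_unit)
      finally show ?thesis .
    qed
    have "(\<lambda>n. s X + complex_of_real (inverse (real (Suc n))) * of_nat k) \<longlonglongrightarrow> s X + complex_of_real 0 * of_nat k"
      by (intro tendsto_intros tendsto_of_real LIMSEQ_inverse_real_of_nat)
    then have "s X + complex_of_real 0 * of_nat k \<in> \<real>\<^sub>\<ge>\<^sub>0"
      by (rule closed_sequentially[OF closed_nonneg_Reals_complex, rotated]) (intro allI sq, simp)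
    then show ?thesis by simp
  qed
  have herm_real: "Im (s Z) = 0" if Z: "Z \<in> ?B" "star Z = Z" for Z
  proof -
    obtain k c where kc: "(complex_of_real c *\<^sub>C block_one m k - Z) + star (complex_of_real c *\<^sub>C block_one m k - Z) \<in> sos ?A"
      using block_order_unit[of Z m] Z W0W by blast
    let ?D = "complex_of_real c *\<^sub>C block_one m k - Z"
    have D: "?D \<in> ?B" by (intro W0_diff W0_scale W0_unit Z)
    have "star ?D = ?D" by (simp add: star_diff star_scaleC star_block_one Z)
    then have "s (?D + ?D) \<in> \<real>\<^sub>\<ge>\<^sub>0" using kc D by (intro s_pos W0_add) simp_all
    then have "Im (s ?D) = 0" using s_add[OF D D] by (simp add: nonneg_Reals_iff)
    moreover have "s ?D = complex_of_real c * of_nat k - s Z"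
      using s_diff[OF W0_scale[OF W0_unit] Z(1)] by (simp add: s_scale W0_unit s_unit)
    ultimately show ?thesis by simp
  qed
  \<comment> \<open>the cone of accretive elements\<close>
  define C where "C = {X \<in> ?A. X + star X \<in> sos ?A}"
  have C0: "0 \<in> C" by (simp add: C_def sos_zero W_alg)
  have C_add: "X + Y \<in> C" if "X \<in> C" "Y \<in> C" for X Y
  proof -
    have eq: "(X + Y) + star (X + Y) = (X + star X) + (Y + star Y)" by (simp add: star_add algebra_simps)
    show ?thesis unfolding C_def mem_Collect_eq eq
      using that sos_add[of "X + star X" _ "Y + star Y"] by (simp add: C_def W_alg(2))
  qed
  have C_scale: "complex_of_real r *\<^sub>C X \<in> C" if "X \<in> C" "r > 0" for X r
  proof -
    have "complex_of_real r *\<^sub>C X + star (complex_of_real r *\<^sub>C X) = complex_of_real r *\<^sub>C (X + star X)"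
      by (simp add: star_scaleC scaleC_add_right)
    moreover have "complex_of_real r *\<^sub>C (X + star X) \<in> sos ?A"
      using that by (intro sos_scale star_subalg_block_mats) (simp_all add: C_def)
    ultimately show ?thesis using that by (simp add: C_def W_alg)
  qed
  have dom: "\<exists>V\<in>?B. V - X \<in> C" if X: "X \<in> ?A" for X
  proof -
    obtain k c where kc: "(complex_of_real c *\<^sub>C block_one m k - X) + star (complex_of_real c *\<^sub>C block_one m k - X) \<in> sos ?A"
      using block_order_unit[OF X] by blast
    moreover have "complex_of_real c *\<^sub>C block_one m k - X \<in> ?A" using X by (intro W_alg block_one_in)
    ultimately show ?thesis using W0_scale[OF W0_unit] unfolding C_def by blast
  qed
  have f_pos: "0 \<le> Re (s X)" if X: "X \<in> ?B" "X \<in> C" for X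
  proof -
    have "s (X + star X) \<in> \<real>\<^sub>\<ge>\<^sub>0" using X by (intro s_pos W0_add W0_star) (simp_all add: C_def)
    then have 1: "0 \<le> Re (s X) + Re (s (star X))"
      using s_add[OF X(1) W0_star[OF X(1)]] by (simp add: nonneg_Reals_iff)
    \<comment> \<open>self-adjoint, so \<open>s\<close> is real there, which compares \<open>s X\<close> with \<open>s (star X)\<close>\<close>
    let ?Z = "\<i> *\<^sub>C (X - star X)"
    have Z: "?Z \<in> ?B" by (intro W0_scale W0_diff W0_star X)
    have "star ?Z = ?Z" by (simp add: star_scaleC star_diff scaleC_diff_right complex_vector.scale_minus_left)
    from herm_real[OF Z this] have "Re (s X) = Re (s (star X))"
      by (simp add: s_scale W0_diff W0_star X s_diff)
    with 1 show ?thesis by simp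
  qed
  show thesis
  proof (rule riesz_extension[where W="?A" and ?W0.0="?B" and C=C and f="\<lambda>X. Re (s X)",
        OF W W0 W0W C0 C_add C_scale dom])
    show "Re (s (X + Y)) = Re (s X) + Re (s Y)" if "X \<in> ?B" "Y \<in> ?B" for X Y
      using s_add[OF that] by simp
    show "Re (s (complex_of_real r *\<^sub>C X)) = r * Re (s X)" if "X \<in> ?B" for X r
      using s_scale[OF that] by simp
    show "0 \<le> Re (s X)" if "X \<in> ?B" "X \<in> C" for X using that by (rule f_pos)
  next
  fix F :: "'a fmat fmat \<Rightarrow> real"
  assume F_add: "\<And>x y. x \<in> ?A \<Longrightarrow> y \<in> ?A \<Longrightarrow> F (x + y) = F x + F y"
    and F_scale: "\<And>x r. x \<in> ?A \<Longrightarrow> F (complex_of_real r *\<^sub>C x) = r * F x"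
    and F_ext: "\<And>x. x \<in> ?B \<Longrightarrow> F x = Re (s x)"
    and F_pos: "\<And>x. x \<in> ?A \<Longrightarrow> x \<in> C \<Longrightarrow> 0 \<le> F x"
  \<comment> \<open>the complex-linear functional with real part \<open>F\<close>\<close>
  define \<Phi> where "\<Phi> X = Complex (F X) (- F (\<i> *\<^sub>C X))" for X
  have F_minus: "F (- X) = - F X" if "X \<in> ?A" for X
    using F_scale[OF that, of "-1"] by (simp add: complex_vector.scale_minus_left)
  show thesis
  proof (rule that[of \<Phi>])
    show \<Phi>_add: "\<Phi> (X + Y) = \<Phi> X + \<Phi> Y" if "X \<in> ?A" "Y \<in> ?A" for X Y
      using that by (simp add: \<Phi>_def complex_eq_iff scaleC_add_right F_add W_alg)
    show "\<Phi> (c *\<^sub>C X) = c * \<Phi> X" if X: "X \<in> ?A" for c X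
    proof -
      have re: "F (complex_of_real r *\<^sub>C X') = r * F X'" if "X' \<in> ?A" for r X' using F_scale[OF that] .
      have iX: "\<i> *\<^sub>C X \<in> ?A" using X by (rule W_alg)
      have c: "c *\<^sub>C X = complex_of_real (Re c) *\<^sub>C X + complex_of_real (Im c) *\<^sub>C (\<i> *\<^sub>C X)"
        by (subst complex_eq[of c]) (simp add: scaleC_add_left mult.commute)
      have ic: "\<i> *\<^sub>C (c *\<^sub>C X) = complex_of_real (Re c) *\<^sub>C (\<i> *\<^sub>C X) + complex_of_real (- Im c) *\<^sub>C X"
      proof -
        have "\<i> * c = complex_of_real (Re c) * \<i> + complex_of_real (- Im c)" by (simp add: complex_eq_iff)
        then show ?thesis by (simp only: scaleC_scaleC scaleC_add_left[symmetric])
      qed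
      have 1: "F (c *\<^sub>C X) = Re c * F X + Im c * F (\<i> *\<^sub>C X)"
        unfolding c by (subst F_add) (use X iX in \<open>simp_all only: W_alg re\<close>)
      have 2: "F (\<i> *\<^sub>C (c *\<^sub>C X)) = Re c * F (\<i> *\<^sub>C X) + (- Im c) * F X"
        unfolding ic by (subst F_add) (use X iX in \<open>simp_all only: W_alg re\<close>)
      show ?thesis unfolding \<Phi>_def 1 2 by (simp add: complex_eq_iff)
    qed
    show "\<Phi> X \<in> \<real>\<^sub>\<ge>\<^sub>0" if X: "X \<in> sos ?A" for X
    proof -
      have XW: "X \<in> ?A" using X by (rule sos_subset[OF star_subalg_block_mats])
      have "X \<in> C" using X XW by (simp add: C_def star_sos[OF X] sos_add)
      then have "0 \<le> F X" using F_pos XW by blast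
      moreover have "F (\<i> *\<^sub>C X) = 0"
      proof -
        have iX: "\<i> *\<^sub>C X \<in> ?A" using XW by (rule W_alg)
        have "\<i> *\<^sub>C X + star (\<i> *\<^sub>C X) = 0" by (simp add: star_scaleC star_sos[OF X] complex_vector.scale_minus_left)
        then have "\<i> *\<^sub>C X \<in> C" using iX by (simp add: C_def sos_zero)
        moreover have "- (\<i> *\<^sub>C X) \<in> C" unfolding C_def
        proof (intro CollectI conjI)
          show "- (\<i> *\<^sub>C X) \<in> ?A" using iX W complex_vector.subspace_neg by blast
          have "- (\<i> *\<^sub>C X) + star (- (\<i> *\<^sub>C X)) = 0"
            by (simp add: star_minus star_scaleC star_sos[OF X] complex_vector.scale_minus_left)
          then show "- (\<i> *\<^sub>C X) + star (- (\<i> *\<^sub>C X)) \<in> sos ?A" by (simp add: sos_zero)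
        qed
        ultimately show ?thesis using F_pos[of "\<i> *\<^sub>C X"] F_pos[of "- (\<i> *\<^sub>C X)"] F_minus[OF iX] iX
          by (simp add: C_def)
      qed
      ultimately show ?thesis by (simp add: \<Phi>_def nonneg_Reals_iff)
    qed
    show "\<Phi> (sing i j x) = cinner (e i) (ap (\<psi> x) (e j))" if x: "x \<in> S" for i j x
    proof -
      have sW: "sing i j x \<in> ?B" using x S0 by (rule sing_in_entries_in[rotated])
      have "\<Phi> (sing i j x) = s (sing i j x)"
        unfolding \<Phi>_def F_ext[OF sW] F_ext[OF W0_scale[OF sW]] by (simp add: complex_eq_iff s_scale sW)
      then show ?thesis by (simp add: s_sing \<phi>_def)
    qed
  qed
  qed
qed

lemma bop_form_eqI:
  assumes e: "hilbert_basis e" and "\<And>i j. cinner (e i) (ap S (e j)) = cinner (e i) (ap T (e j))"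
  shows "S = T"
  by (rule bop_basis_eqI[OF e], rule basis_ext[OF e], rule assms(2))

text \<open>The coefficients \<open>\<Phi> (sing i j x)\<close> of the extended functional define a bounded operator:
  with the rows \<open>row N h x\<close>, which have the entries $\langle e_j,h\rangle x$ for \<open>j < N\<close>, the
  truncated form is \<open>\<Phi> (star (row N g E) * row N h x)\<close> with \<open>E\<close> the unit, and the Cauchy-Schwarz inequality for \<open>\<Phi>\<close>
  bounds it by means of $x^*x\le c$. Complete positivity is stated in Stinespring form, as positivity of
  the kernel \<open>\<Psi> (star (x r) * x q)\<close>: for truncated vectors the sum is \<open>\<Phi>\<close> at the square
  of a sum of rows.\<close>

lemma arveson_extension:
  fixes S :: "'a::unital_cstar_algebra fmat set" and \<psi> :: "'a fmat \<Rightarrow> 'h::chilbert_space bop"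
    and e :: "nat \<Rightarrow> 'h"
  assumes S: "operator_subsystem (Mat m UNIV) S" and \<psi>: "ucp (Mat m UNIV) S \<psi>"
    and e: "hilbert_basis e"
  obtains \<Psi> :: "'a fmat \<Rightarrow> 'h bop" where
    "\<And>x y. x \<in> Mat m UNIV \<Longrightarrow> y \<in> Mat m UNIV \<Longrightarrow> \<Psi> (x + y) = \<Psi> x + \<Psi> y"
    "\<And>c x. x \<in> Mat m UNIV \<Longrightarrow> \<Psi> (c *\<^sub>C x) = c *\<^sub>C \<Psi> x"
    "\<And>x. x \<in> S \<Longrightarrow> \<Psi> x = \<psi> x"
    "\<And>n x h. (\<And>r. r < n \<Longrightarrow> x r \<in> Mat m UNIV) \<Longrightarrow>
      (\<Sum>r<n::nat. \<Sum>q<n. cinner (h r) (ap (\<Psi> (star (x r) * x q)) (h q))) \<in> \<real>\<^sub>\<ge>\<^sub>0"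
proof (rule positive_functional_extension[OF S \<psi> e])
  fix \<Phi> :: "'a fmat fmat \<Rightarrow> complex"
  let ?A = "block_mats m :: 'a fmat fmat set" and ?M = "Mat m UNIV :: 'a fmat set"
  assume \<Phi>_add: "\<And>X Y. X \<in> ?A \<Longrightarrow> Y \<in> ?A \<Longrightarrow> \<Phi> (X + Y) = \<Phi> X + \<Phi> Y"
    and \<Phi>_scale: "\<And>c X. X \<in> ?A \<Longrightarrow> \<Phi> (c *\<^sub>C X) = c * \<Phi> X"
    and \<Phi>_pos: "\<And>X. X \<in> sos ?A \<Longrightarrow> \<Phi> X \<in> \<real>\<^sub>\<ge>\<^sub>0"
    and \<Phi>_ext: "\<And>i j x. x \<in> S \<Longrightarrow> \<Phi> (sing i j x) = cinner (e i) (ap (\<psi> x) (e j))"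
  note A_alg = star_subalgD[OF star_subalg_block_mats[where ?'a='a and m=m]]
  note M_alg = star_subalgD[OF star_subalg_Mat[where ?'a='a and m=m]]
  define E where "E = (mat_one m :: 'a fmat)"
  have E: "E \<in> ?M" "E \<in> S" "\<psi> E = 1" "star E = E" "E * E = E"
    using S \<psi> by (auto simp: E_def mat_one_in_Mat operator_subsystem_def ucp_def unit_of_Mat_eq
        star_mat_one mat_one_mult)
  have \<Phi>0: "\<Phi> 0 = 0" using \<Phi>_scale[OF A_alg(1), of 0] by simp
  have \<Phi>_sum: "\<Phi> (\<Sum>i\<in>I. f i) = (\<Sum>i\<in>I. \<Phi> (f i))" if "\<And>i. i \<in> I \<Longrightarrow> f i \<in> ?A" for I :: "nat set" and f
    using that
  proof (induction I rule: infinite_finite_induct)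
    case (insert i I)
    then show ?case by (simp add: \<Phi>_add A_alg)
  qed (simp_all add: \<Phi>0)
  define row where "row N h x = (\<Sum>j<N. cinner (e j) h *\<^sub>C sing 0 j x)" for N :: nat and h and x :: "'a fmat"
  have sing_A: "sing i j x \<in> ?A" if "x \<in> ?M" for i j x
    using that by (intro sing_in_entries_in M_alg)
  have row_A: "row N h x \<in> ?A" if "x \<in> ?M" for N h x
    unfolding row_def using that by (intro A_alg sing_A)
  have row_prod: "star (row N g x) * row N h y
      = (\<Sum>i<N. \<Sum>j<N. (cinner g (e i) * cinner (e j) h) *\<^sub>C sing i j (star x * y))" for N g h x y
  proof -
    have "star (row N g x) = (\<Sum>i<N. cinner g (e i) *\<^sub>C sing i 0 (star x))"
      unfolding row_def star_sum star_scaleC star_sing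
      by (rule sum.cong) (simp_all add: cinner_commute[of g])
    then show ?thesis
      by (simp add: row_def sum_product mult_scaleC_left mult_scaleC_right sing_mult mult.commute[of "cinner g _"])
  qed
  define B where "B x N g h = (\<Sum>i<N. \<Sum>j<N. cinner g (e i) * cinner (e j) h * \<Phi> (sing i j x))" for x and N :: nat and g h
  have \<Phi>_row: "\<Phi> (star (row N g x) * row N h y) = B (star x * y) N g h" if "x \<in> ?M" "y \<in> ?M" for N g h x y
  proof -
    have s: "sing i j (star x * y) \<in> ?A" for i j using that by (intro sing_A M_alg)
    show ?thesis unfolding row_prod B_def
      by (subst \<Phi>_sum, intro A_alg s, rule sum.cong[OF refl], subst \<Phi>_sum, intro A_alg s)
        (simp add: \<Phi>_scale s)
  qed
  have unit_row: "Re (\<Phi> (star (row N h E) * row N h E)) \<le> (norm h)\<^sup>2" for N h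
  proof -
    have "\<Phi> (star (row N h E) * row N h E) = B E N h h" using \<Phi>_row[OF E(1) E(1)] E by simp
    also have "\<dots> = (\<Sum>i<N. \<Sum>j<N. if i = j then cinner h (e i) * cinner (e i) h else 0)"
      unfolding B_def \<Phi>_ext[OF E(2)] E(3)
      by (intro sum.cong refl) (auto simp: one_bop.rep_eq basis_orthonormal[OF e])
    also have "\<dots> = (\<Sum>i<N. complex_of_real ((cmod (cinner (e i) h))\<^sup>2))"
      by (simp only: complex_norm_square) (simp add: cinner_commute[of h] mult.commute)
    also have "\<dots> = complex_of_real ((norm (\<Sum>i<N. cinner (e i) h *\<^sub>C e i))\<^sup>2)"
      by (subst norm_sum_orthonormal) (simp_all add: basis_orthonormal[OF e])
    finally show ?thesis
      using norm_truncation_le[OF e, where N=N and h=h] by (simp add: power_mono flip: of_real_power)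
  qed
  have bound: "\<exists>K\<ge>0. \<forall>N g h. cmod (B x N g h) \<le> K * norm g * norm h" if x: "x \<in> ?M" for x
  proof -
    obtain k c where c: "0 \<le> c"
      "complex_of_real c *\<^sub>C block_one m k - star (sing 0 0 x) * sing 0 0 x \<in> sos ?A"
      using dominated_block_mats[OF sing_A[OF x, of 0 0]] by (auto simp: dominated_def)
    have "cmod (B x N g h) \<le> sqrt c * norm g * norm h" for N g h
    proof -
      let ?y = "row N g E" and ?z = "row N h x" and ?r = "row N h E"
      have yA: "?y \<in> ?A" and zA: "?z \<in> ?A" and rA: "?r \<in> ?A" using x E by (auto intro: row_A)
      have "cnj s * s * \<Phi> (star ?y * ?y) + cnj s * t * \<Phi> (star ?y * ?z) + cnj t * s * \<Phi> (star ?z * ?y)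
          + cnj t * t * \<Phi> (star ?z * ?z) \<in> \<real>\<^sub>\<ge>\<^sub>0" for s t
      proof -
        have "star (s *\<^sub>C ?y + t *\<^sub>C ?z) * (s *\<^sub>C ?y + t *\<^sub>C ?z)
          = (cnj s * s) *\<^sub>C (star ?y * ?y) + (cnj s * t) *\<^sub>C (star ?y * ?z)
            + (cnj t * s) *\<^sub>C (star ?z * ?y) + (cnj t * t) *\<^sub>C (star ?z * ?z)"
          by (simp add: star_add star_scaleC mult_scaleC_left mult_scaleC_right algebra_simps)
        moreover have "star (s *\<^sub>C ?y + t *\<^sub>C ?z) * (s *\<^sub>C ?y + t *\<^sub>C ?z) \<in> sos ?A"
          by (intro sos_square A_alg yA zA)
        ultimately have "\<Phi> ((cnj s * s) *\<^sub>C (star ?y * ?y) + (cnj s * t) *\<^sub>C (star ?y * ?z)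
            + (cnj t * s) *\<^sub>C (star ?z * ?y) + (cnj t * t) *\<^sub>C (star ?z * ?z)) \<in> \<real>\<^sub>\<ge>\<^sub>0"
          using \<Phi>_pos by simp
        then show ?thesis using yA zA by (simp add: \<Phi>_add \<Phi>_scale A_alg)
      qed
      from psd_form_2(2)[OF this]
      have 1: "(cmod (\<Phi> (star ?y * ?z)))\<^sup>2 \<le> Re (\<Phi> (star ?y * ?y)) * Re (\<Phi> (star ?z * ?z))" .
      have yz: "\<Phi> (star ?y * ?z) = B x N g h"
        using \<Phi>_row[OF E(1) x] E x by (simp add: E_def mat_one_mult star_mat_one)
      have "sing 0 0 x * ?r = ?z"
        using x by (simp add: row_def sum_distrib_left mult_scaleC_right sing_mult E_def mat_one_mult)
      then have zz: "star ?r * (star (sing 0 0 x) * sing 0 0 x) * ?r = star ?z * ?z"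
        by (metis mult.assoc star_mult)
      define k' where "k' = max k (Suc N)"
      have "block_one m k' * ?r = ?r"
      proof (rule block_one_mult(1)[OF rA])
        fix i j assume "k' \<le> i \<or> k' \<le> j"
        then show "entry ?r i j = 0"
          unfolding row_def entry_sum
          by (intro sum.neutral) (auto simp: scaleC_fmat.rep_eq entry_sing k'_def)
      qed
      then have rr: "star ?r * (complex_of_real c *\<^sub>C block_one m k') * ?r = complex_of_real c *\<^sub>C (star ?r * ?r)"
        by (simp add: mult_scaleC_left mult_scaleC_right mult.assoc)
      have "complex_of_real c *\<^sub>C block_one m k' - star (sing 0 0 x) * sing 0 0 x \<in> sos ?A"
        by (rule dominated_mono[OF c(2,1)]) (simp add: k'_def)
      from sos_conjugate[OF star_subalg_block_mats rA this]
      have p: "complex_of_real c *\<^sub>C (star ?r * ?r) - star ?z * ?z \<in> sos ?A"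
        by (simp add: left_diff_distrib right_diff_distrib rr zz)
      have "\<Phi> (complex_of_real c *\<^sub>C (star ?r * ?r) - star ?z * ?z) + \<Phi> (star ?z * ?z)
          = complex_of_real c * \<Phi> (star ?r * ?r)"
        using \<Phi>_add[OF sos_subset[OF star_subalg_block_mats p], of "star ?z * ?z"] zA rA
        by (simp add: A_alg \<Phi>_scale)
      then have "Re (\<Phi> (star ?z * ?z)) \<le> c * Re (\<Phi> (star ?r * ?r))"
        using \<Phi>_pos[OF p] by (auto simp: nonneg_Reals_iff complex_eq_iff)
      also have "\<dots> \<le> c * (norm h)\<^sup>2" using c(1) unit_row by (rule mult_left_mono[rotated])
      finally have 2: "Re (\<Phi> (star ?z * ?z)) \<le> c * (norm h)\<^sup>2" .
      have "0 \<le> Re (\<Phi> (star ?z * ?z))"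
        using \<Phi>_pos[OF sos_square[OF zA]] by (simp add: nonneg_Reals_iff)
      then have "Re (\<Phi> (star ?y * ?y)) * Re (\<Phi> (star ?z * ?z)) \<le> (norm g)\<^sup>2 * (c * (norm h)\<^sup>2)"
        using 2 unit_row by (intro mult_mono) auto
      with 1 have "(cmod (B x N g h))\<^sup>2 \<le> (sqrt c * norm g * norm h)\<^sup>2"
        using c(1) by (simp add: yz power_mult_distrib mult_ac)
      then show ?thesis by (rule power2_le_imp_le) (simp add: c(1))
    qed
    then show ?thesis using c(1) by (intro exI[of _ "sqrt c"]) simp
  qed
  have "\<exists>T. \<forall>i j. cinner (e i) (ap T (e j)) = \<Phi> (sing i j x)" if x: "x \<in> ?M" for x
  proof -
    obtain K where K: "0 \<le> K" "\<And>N g h. cmod (B x N g h) \<le> K * norm g * norm h" using bound[OF x] by blast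
    obtain T where "\<And>i j. cinner (e i) (ap T (e j)) = \<Phi> (sing i j x)"
      using operator_of_bounded_form[OF e K(1), where b="\<lambda>i j. \<Phi> (sing i j x)"] K(2)
      unfolding B_def by blast
    then show ?thesis by blast
  qed
  then obtain \<Psi> where \<Psi>: "\<And>x i j. x \<in> ?M \<Longrightarrow> cinner (e i) (ap (\<Psi> x) (e j)) = \<Phi> (sing i j x)" by metis
  show thesis
  proof (rule that[of \<Psi>])
    show "\<Psi> (x + y) = \<Psi> x + \<Psi> y" if "x \<in> ?M" "y \<in> ?M" for x y
      by (rule bop_form_eqI[OF e])
        (use that in \<open>simp add: \<Psi> M_alg plus_bop.rep_eq cinner_add_right sing_add \<Phi>_add sing_A\<close>)
    show "\<Psi> (c *\<^sub>C x) = c *\<^sub>C \<Psi> x" if "x \<in> ?M" for c x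
      by (rule bop_form_eqI[OF e])
        (use that in \<open>simp add: \<Psi> M_alg scaleC_bop.rep_eq cinner_scaleC_right sing_scaleC \<Phi>_scale sing_A\<close>)
    show "\<Psi> x = \<psi> x" if "x \<in> S" for x
    proof -
      have "x \<in> ?M" using that S by (auto simp: operator_subsystem_def)
      then show ?thesis using that by (intro bop_form_eqI[OF e]) (simp add: \<Psi> \<Phi>_ext)
    qed
    fix n :: nat and x :: "nat \<Rightarrow> 'a fmat" and h :: "nat \<Rightarrow> 'h"
    assume x: "\<And>r. r < n \<Longrightarrow> x r \<in> ?M"
    define P where "P N h = (\<Sum>i<N. cinner (e i) h *\<^sub>C e i)" for N :: nat and h
    define Q where "Q g = (\<Sum>r<n. \<Sum>q<n. cinner (g r) (ap (\<Psi> (star (x r) * x q)) (g q)))" for g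
    have "Q (\<lambda>r. P N (h r)) \<in> \<real>\<^sub>\<ge>\<^sub>0" for N
    proof -
      define y where "y = (\<Sum>r<n. row N (h r) (x r))"
      have yA: "y \<in> ?A" unfolding y_def by (intro A_alg row_A x) simp
      have "cinner (P N (h r)) (ap (\<Psi> (star (x r) * x q)) (P N (h q))) = \<Phi> (star (row N (h r) (x r)) * row N (h q) (x q))"
        if "r < n" "q < n" for r q
      proof -
        have M: "star (x r) * x q \<in> ?M" using x that by (intro M_alg) auto
        have "cinner (P N (h r)) (ap (\<Psi> (star (x r) * x q)) (P N (h q))) = B (star (x r) * x q) N (h r) (h q)"
          unfolding P_def B_def ap_sum_right ap_scaleC cinner_sum_left cinner_scaleC_left
          by (intro sum.cong refl) (simp add: cinner_sum_right cinner_scaleC_right \<Psi>[OF M]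
              cinner_commute[of "h r"] sum_distrib_left mult.assoc)
        then show ?thesis using \<Phi>_row x that by simp
      qed
      then have "Q (\<lambda>r. P N (h r)) = (\<Sum>r<n. \<Sum>q<n. \<Phi> (star (row N (h r) (x r)) * row N (h q) (x q)))"
        unfolding Q_def by (intro sum.cong refl) simp
      also have "\<dots> = \<Phi> (star y * y)"
      proof -
        have "star y * y = (\<Sum>r<n. \<Sum>q<n. star (row N (h r) (x r)) * row N (h q) (x q))"
          by (simp add: y_def star_sum sum_product)
        moreover have "star (row N (h r) (x r)) * row N (h q) (x q) \<in> ?A" if "r < n" "q < n" for r q
          using that x by (intro A_alg row_A) auto
        ultimately show ?thesis
          by (simp, subst \<Phi>_sum) (auto intro!: A_alg(7) sum.cong \<Phi>_sum[symmetric])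
      qed
      also have "\<dots> \<in> \<real>\<^sub>\<ge>\<^sub>0" using \<Phi>_pos sos_square[OF yA] by blast
      finally show ?thesis .
    qed
    moreover have "(\<lambda>N. Q (\<lambda>r. P N (h r))) \<longlonglongrightarrow> Q h"
      unfolding Q_def P_def
      by (intro tendsto_sum tendsto_cinner tendsto_ap basis_expansion[OF e])
    ultimately have "Q h \<in> \<real>\<^sub>\<ge>\<^sub>0" 
      using closed_sequentially[OF closed_nonneg_Reals_complex, of "\<lambda>N. Q (\<lambda>r. P N (h r))" "Q h"] by simp
    then show "(\<Sum>r<n. \<Sum>q<n. cinner (h r) (ap (\<Psi> (star (x r) * x q)) (h q))) \<in> \<real>\<^sub>\<ge>\<^sub>0"
      by (simp add: Q_def)
  qed
qed

section \<open>The defect of multiplicativity\<close>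

text \<open>The estimate makes the image of the unit ball totally bounded: a finite net for the image under
  \<open>C\<close> yields one for the image under \<open>R\<close>.\<close>

lemma compact_op_dominated:
  fixes R :: "'h::chilbert_space bop"
  assumes dom: "\<And>\<epsilon>. \<epsilon> > 0 \<Longrightarrow> \<exists>C. compact_op C \<and> (\<forall>h. norm (ap R h) \<le> \<epsilon> * norm h + norm (ap C h))"
  shows "compact_op R"
  unfolding compact_op_def compact_eq_totally_bounded
proof (intro conjI allI impI)
  show "complete (closure (ap R ` cball 0 1))" by (simp add: complete_eq_closed)
  fix r :: real assume r: "r > 0"
  obtain C where C: "compact_op C" "\<And>h. norm (ap R h) \<le> r / 8 * norm h + norm (ap C h)"
    using dom[of "r / 8"] r by auto
  then obtain k where k: "finite k" "closure (ap C ` cball 0 1) \<subseteq> (\<Union>x\<in>k. ball x (r / 8))"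
    unfolding compact_op_def compact_eq_totally_bounded using r by (metis divide_pos_pos zero_less_numeral)
  define f where "f c = (SOME h. h \<in> cball 0 1 \<and> ap C h \<in> ball c (r / 8))" for c
  have "ap R ` cball 0 1 \<subseteq> (\<Union>x\<in>(\<lambda>c. ap R (f c)) ` k. cball x (r / 2))"
  proof
    fix y assume "y \<in> ap R ` cball 0 1"
    then obtain h where h: "y = ap R h" "h \<in> cball 0 1" by blast
    then have "ap C h \<in> (\<Union>x\<in>k. ball x (r / 8))"
      using k(2) closure_subset[of "ap C ` cball 0 1"] by blast
    then obtain c where c: "c \<in> k" "ap C h \<in> ball c (r / 8)" by blast
    have fc: "f c \<in> cball 0 1 \<and> ap C (f c) \<in> ball c (r / 8)"
      unfolding f_def by (rule someI[of _ h]) (use h c in blast)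
    have "norm (h - f c) \<le> 2"
      using norm_triangle_ineq4[of h "f c"] h fc by simp
    then have 1: "r / 8 * norm (h - f c) \<le> r / 8 * 2" using r by (intro mult_left_mono) auto
    have "dist (ap C h) (ap C (f c)) \<le> dist c (ap C h) + dist c (ap C (f c))"
      by (metis dist_commute dist_triangle)
    then have 2: "norm (ap C (h - f c)) \<le> r / 4" using c fc by (simp add: dist_norm ap_diff_right)
    have "norm (ap R (h - f c)) \<le> r / 2" using C(2)[of "h - f c"] 1 2 by linarith
    then have "dist (ap R (f c)) y \<le> r / 2" by (simp add: h dist_norm norm_minus_commute ap_diff_right)
    then show "y \<in> (\<Union>x\<in>(\<lambda>c. ap R (f c)) ` k. cball x (r / 2))" using c by auto
  qed
  then have "closure (ap R ` cball 0 1) \<subseteq> (\<Union>x\<in>(\<lambda>c. ap R (f c)) ` k. cball x (r / 2))"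
    by (rule closure_minimal) (use k(1) in auto)
  also have "\<dots> \<subseteq> (\<Union>x\<in>(\<lambda>c. ap R (f c)) ` k. ball x r)" using r by (intro UN_mono) auto
  finally show "\<exists>k. finite k \<and> closure (ap R ` cball 0 1) \<subseteq> (\<Union>x\<in>k. ball x r)"
    using k(1) by (intro exI[of _ "(\<lambda>c. ap R (f c)) ` k"]) auto
qed

text \<open>What remains of complete positivity of a map on the matrices is the positivity of its kernel; it
  implies the Schwarz inequality and its consequences.\<close>

locale cp_extension =
  fixes m :: nat and \<Psi> :: "'a::unital_cstar_algebra fmat \<Rightarrow> 'h::chilbert_space bop"
  assumes add: "\<And>x y. x \<in> Mat m UNIV \<Longrightarrow> y \<in> Mat m UNIV \<Longrightarrow> \<Psi> (x + y) = \<Psi> x + \<Psi> y"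
    and scale: "\<And>c x. x \<in> Mat m UNIV \<Longrightarrow> \<Psi> (c *\<^sub>C x) = c *\<^sub>C \<Psi> x"
    and unit: "\<Psi> (mat_one m) = 1"
    and pos: "\<And>n x h. (\<And>r. r < n \<Longrightarrow> x r \<in> Mat m UNIV) \<Longrightarrow>
      (\<Sum>r<n::nat. \<Sum>q<n. cinner (h r) (ap (\<Psi> (star (x r) * x q)) (h q))) \<in> \<real>\<^sub>\<ge>\<^sub>0"
begin

lemmas M_alg = star_subalgD[OF star_subalg_Mat[where ?'a='a and m=m]]

lemma star_hom:
  assumes x: "x \<in> Mat m UNIV" shows "\<Psi> (star x) = star (\<Psi> x)"
proof (rule bop_eqI, rule cinner_ext)
  fix k h
  let ?E = "mat_one m :: 'a fmat"
  have "cnj s * s * cinner k k + cnj s * t * cinner k (ap (\<Psi> x) h)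
      + cnj t * s * cinner h (ap (\<Psi> (star x)) k) + cnj t * t * cinner h (ap (\<Psi> (star x * x)) h) \<in> \<real>\<^sub>\<ge>\<^sub>0" for s t
  proof -
    have "(\<Sum>r<2::nat. \<Sum>q<2::nat. cinner (if r = 0 then s *\<^sub>C k else t *\<^sub>C h)
        (ap (\<Psi> (star (if r = 0 then ?E else x) * (if q = 0 then ?E else x))) (if q = 0 then s *\<^sub>C k else t *\<^sub>C h))) \<in> \<real>\<^sub>\<ge>\<^sub>0"
      by (rule pos) (simp add: x mat_one_in_Mat)
    then show ?thesis using x
      by (simp add: numeral_2_eq_2 star_mat_one mat_one_mult mat_one_in_Mat M_alg unit one_bop.rep_eq
          cinner_scaleC_left cinner_scaleC_right ap_scaleC mult_ac add_ac)
  qed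
  from psd_form_2(1)[OF this] have "cinner h (ap (\<Psi> (star x)) k) = cnj (cinner k (ap (\<Psi> x) h))" .
  then show "cinner h (ap (\<Psi> (star x)) k) = cinner h (ap (star (\<Psi> x)) k)"
    by (simp add: cinner_star_right cinner_commute[of "ap (\<Psi> x) h"])
qed

text \<open>The defect of multiplicativity. The Schwarz inequality says that it is a positive
  operator-valued form.\<close>

definition defect :: "'a fmat \<Rightarrow> 'a fmat \<Rightarrow> 'h bop" where
  "defect x y = \<Psi> (star x * y) - star (\<Psi> x) * \<Psi> y"

lemma defect_form:
  "cinner k (ap (defect x y) h) = cinner k (ap (\<Psi> (star x * y)) h) - cinner (ap (\<Psi> x) k) (ap (\<Psi> y) h)"
  by (simp add: defect_def ap_minus_left cinner_diff_right times_bop.rep_eq cinner_star_right)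

text \<open>The positivity of the kernel at \<open>1\<close>, \<open>x\<close>, \<open>y\<close> and the vectors \<open>z\<close>, \<open>k\<close>, \<open>h\<close>, where
  \<open>z\<close> is chosen to complete the square.\<close>

lemma defect_psd:
  assumes x: "x \<in> Mat m UNIV" and y: "y \<in> Mat m UNIV"
  shows "cinner k (ap (defect x x) k) + cinner k (ap (defect x y) h) + cinner h (ap (defect y x) k)
    + cinner h (ap (defect y y) h) \<in> \<real>\<^sub>\<ge>\<^sub>0"
proof -
  let ?E = "mat_one m :: 'a fmat"
  define z where "z = - (ap (\<Psi> x) k + ap (\<Psi> y) h)"
  define X where "X r = (if r = 0 then ?E else if r = Suc 0 then x else y)" for r :: nat
  define H where "H r = (if r = 0 then z else if r = Suc 0 then k else h)" for r :: nat
  have adj: "cinner u (ap (star T) v) = cinner (ap T u) v" for u v and T :: "'h bop" by (rule cinner_star_right)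
  have "(\<Sum>r<3::nat. \<Sum>q<3::nat. cinner (H r) (ap (\<Psi> (star (X r) * X q)) (H q))) \<in> \<real>\<^sub>\<ge>\<^sub>0"
    by (rule pos) (simp add: X_def x y mat_one_in_Mat)
  also have "(\<Sum>r<3::nat. \<Sum>q<3::nat. cinner (H r) (ap (\<Psi> (star (X r) * X q)) (H q)))
     = cinner z z + cinner z (ap (\<Psi> x) k) + cinner z (ap (\<Psi> y) h)
      + cinner (ap (\<Psi> x) k) z + cinner (ap (\<Psi> y) h) z
      + (cinner k (ap (\<Psi> (star x * x)) k) + cinner k (ap (\<Psi> (star x * y)) h)
        + cinner h (ap (\<Psi> (star y * x)) k) + cinner h (ap (\<Psi> (star y * y)) h))"
    using x y
    by (simp add: numeral_3_eq_3 X_def H_def star_mat_one mat_one_mult mat_one_in_Mat M_alg unit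
        one_bop.rep_eq star_hom adj add_ac)
  also have "\<dots> = cinner k (ap (defect x x) k) + cinner k (ap (defect x y) h) + cinner h (ap (defect y x) k)
    + cinner h (ap (defect y y) h)"
    unfolding z_def defect_form
    by (simp add: cinner_add_left cinner_add_right cinner_minus_right cinner_diff_left cinner_diff_right
        cinner_diff_left[of 0, simplified] algebra_simps)
  finally show ?thesis .
qed

lemma defect_scale:
  "cinner (s *\<^sub>C k) (ap (defect x y) (t *\<^sub>C h)) = cnj s * t * cinner k (ap (defect x y) h)"
  by (simp add: ap_scaleC cinner_scaleC_left cinner_scaleC_right)

lemma defect_cauchy_schwarz:
  assumes x: "x \<in> Mat m UNIV" and y: "y \<in> Mat m UNIV"
  shows "(cmod (cinner k (ap (defect x y) h)))\<^sup>2 \<le> Re (cinner k (ap (defect x x) k)) * Re (cinner h (ap (defect y y) h))"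
proof (rule psd_form_2(2))
  fix s t
  show "cnj s * s * cinner k (ap (defect x x) k) + cnj s * t * cinner k (ap (defect x y) h)
    + cnj t * s * cinner h (ap (defect y x) k) + cnj t * t * cinner h (ap (defect y y) h) \<in> \<real>\<^sub>\<ge>\<^sub>0"
    using defect_psd[OF x y, of "s *\<^sub>C k" "t *\<^sub>C h"] by (simp only: defect_scale)
qed

text \<open>By the Cauchy-Schwarz inequality, \<open>defect x y\<close> is dominated by \<open>defect y y\<close> in the sense of
  \<open>compact_op_dominated\<close>.\<close>

lemma defect_compact:
  assumes x: "x \<in> Mat m UNIV" and y: "y \<in> Mat m UNIV" and c: "compact_op (defect y y)"
  shows "compact_op (defect x y)"
proof (rule compact_op_dominated)
  fix \<epsilon> :: real assume \<epsilon>: "\<epsilon> > 0"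
  obtain K where K: "K > 0" "\<And>h. norm (ap (defect x x) h) \<le> K * norm h" using ap_bounded_pos by blast
  let ?C = "complex_of_real (K / \<epsilon>) *\<^sub>C defect y y"
  have "norm (ap (defect x y) h) \<le> \<epsilon> * norm h + norm (ap ?C h)" for h
  proof -
    define k where "k = ap (defect x y) h"
    have "(cmod (cinner k k))\<^sup>2 \<le> Re (cinner k (ap (defect x x) k)) * Re (cinner h (ap (defect y y) h))"
      using defect_cauchy_schwarz[OF x y, of k h] by (simp flip: k_def)
    also have "\<dots> \<le> (K * (norm k)\<^sup>2) * (norm h * norm (ap (defect y y) h))"
    proof (rule mult_mono)
      have "Re (cinner k (ap (defect x x) k)) \<le> norm k * norm (ap (defect x x) k)"
        by (meson cauchy_schwarz complex_Re_le_cmod order_trans)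
      also have "\<dots> \<le> norm k * (K * norm k)" using K by (intro mult_left_mono) auto
      finally show "Re (cinner k (ap (defect x x) k)) \<le> K * (norm k)\<^sup>2" by (simp add: power2_eq_square mult_ac)
      show "Re (cinner h (ap (defect y y) h)) \<le> norm h * norm (ap (defect y y) h)"
        by (meson cauchy_schwarz complex_Re_le_cmod order_trans)
      show "0 \<le> Re (cinner h (ap (defect y y) h))"
        using defect_psd[OF x y, of 0 h] by (simp add: nonneg_Reals_iff)
    qed (use K in simp)
    finally have 1: "(norm k)\<^sup>2 \<le> K * (norm h * norm (ap (defect y y) h))"
      by (rule norm_square_le_of_form) (use K in simp)
    have nC: "norm (ap ?C h) = K / \<epsilon> * norm (ap (defect y y) h)"
      using K \<epsilon> by (simp add: scaleC_bop.rep_eq norm_scaleC_hilbert norm_divide)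
    have "K * (norm h * norm (ap (defect y y) h)) = (\<epsilon> * norm h) * norm (ap ?C h)"
      unfolding nC using \<epsilon> by simp
    also have "\<dots> \<le> (\<epsilon> * norm h + norm (ap ?C h))\<^sup>2"
      using \<epsilon> by (simp add: power2_sum add_increasing add_increasing2)
    finally have "(norm k)\<^sup>2 \<le> (\<epsilon> * norm h + norm (ap ?C h))\<^sup>2" using 1 by linarith
    then show ?thesis unfolding k_def by (rule power2_le_imp_le) (use \<epsilon> in simp)
  qed
  then show "\<exists>C. compact_op C \<and> (\<forall>h. norm (ap (defect x y) h) \<le> \<epsilon> * norm h + norm (ap C h))"
    using compact_op_scaleC[OF c] by blast
qed

lemma norm_bound:
  assumes x: "x \<in> Mat m UNIV" and z: "z \<in> Mat m UNIV"
    and xz: "complex_of_real t *\<^sub>C mat_one m = star x * x + star z * z"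
  shows "(norm (ap (\<Psi> x) h))\<^sup>2 \<le> t * (norm h)\<^sup>2"
proof -
  have xx: "star x * x \<in> Mat m UNIV" "star z * z \<in> Mat m UNIV" using x z by (auto intro: M_alg)
  have "complex_of_real t *\<^sub>C 1 = \<Psi> (star x * x) + \<Psi> (star z * z)"
    using scale[OF mat_one_in_Mat, of "complex_of_real t"] by (simp add: unit xz add xx)
  then have "cinner h (ap (complex_of_real t *\<^sub>C 1) h) = cinner h (ap (\<Psi> (star x * x)) h) + cinner h (ap (\<Psi> (star z * z)) h)"
    by (simp add: plus_bop.rep_eq cinner_add_right)
  moreover have "0 \<le> Re (cinner h (ap (\<Psi> (star z * z)) h))"
    using pos[of 1 "\<lambda>_. z" "\<lambda>_. h"] z by (simp add: nonneg_Reals_iff)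
  moreover have "(norm (ap (\<Psi> x) h))\<^sup>2 \<le> Re (cinner h (ap (\<Psi> (star x * x)) h))"
    using defect_psd[OF x x, of 0 h] by (simp add: nonneg_Reals_iff defect_form cinner_self)
  moreover have "Re (cinner h (ap (complex_of_real t *\<^sub>C 1) h)) = t * (norm h)\<^sup>2"
    by (simp add: scaleC_bop.rep_eq one_bop.rep_eq cinner_scaleC_right cinner_self flip: of_real_power)
  ultimately show ?thesis by simp
qed

end

section \<open>Positive operators and positive operator matrices\<close>

definition opnorm :: "'h::chilbert_space bop \<Rightarrow> real" where
  "opnorm T = onorm (ap T)"

lemma norm_ap_le: "norm (ap T x) \<le> opnorm T * norm x"
  unfolding opnorm_def by (rule onorm[OF ap_bounded_linear])

lemma opnorm_le: "0 \<le> b \<Longrightarrow> (\<And>x. norm (ap T x) \<le> b * norm x) \<Longrightarrow> opnorm T \<le> b"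
  unfolding opnorm_def by (rule onorm_bound)

lemma opnorm_nonneg: "0 \<le> opnorm T"
  unfolding opnorm_def by (rule onorm_pos_le[OF ap_bounded_linear])

lemma opnorm_complete:
  fixes X :: "nat \<Rightarrow> 'h::chilbert_space bop"
  assumes X: "\<And>e. e > 0 \<Longrightarrow> \<exists>k. \<forall>p\<ge>k. \<forall>q\<ge>k. opnorm (X p - X q) < e"
  shows "\<exists>L. (\<lambda>n. opnorm (X n - L)) \<longlonglongrightarrow> 0"
proof -
  have d: "norm (ap (X p) x - ap (X q) x) \<le> opnorm (X p - X q) * norm x" for p q x
    using norm_ap_le[of "X p - X q" x] by (simp add: ap_minus_left)
  have "convergent (\<lambda>n. ap (X n) x)" for x
  proof (rule Cauchy_convergent, rule metric_CauchyI)
    fix e :: real assume "e > 0"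
    define t where "t = e / (norm x + 1)"
    have "t > 0" using \<open>e > 0\<close> by (simp add: t_def add_nonneg_pos)
    then obtain k where k: "\<And>p q. p \<ge> k \<Longrightarrow> q \<ge> k \<Longrightarrow> opnorm (X p - X q) < t" using X by blast
    have "dist (ap (X p) x) (ap (X q) x) < e" if "p \<ge> k" "q \<ge> k" for p q
    proof -
      have "dist (ap (X p) x) (ap (X q) x) \<le> opnorm (X p - X q) * norm x" using d by (simp add: dist_norm)
      also have "\<dots> \<le> t * norm x" using k[OF that] by (intro mult_right_mono) auto
      also have "\<dots> < t * (norm x + 1)" using \<open>t > 0\<close> by simp
      also have "\<dots> = e" using norm_ge_zero[of x] by (simp add: t_def add_nonneg_eq_0_iff)
      finally show ?thesis .
    qed
    then show "\<exists>M. \<forall>p\<ge>M. \<forall>q\<ge>M. dist (ap (X p) x) (ap (X q) x) < e" by blast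
  qed
  then obtain L where L: "\<And>x. (\<lambda>n. ap (X n) x) \<longlonglongrightarrow> L x" unfolding convergent_def by metis
  obtain k where k: "\<And>p. p \<ge> k \<Longrightarrow> opnorm (X p - X k) < 1" using X[of 1] by auto
  have "bounded_clinear L" unfolding bounded_clinear_def
  proof (intro conjI allI exI)
    show "L (x + y) = L x + L y" for x y
      using L[of "x + y"] tendsto_add[OF L[of x] L[of y]] LIMSEQ_unique by (simp add: ap_add)
    show "L (c *\<^sub>C x) = c *\<^sub>C L x" for c x
    proof -
      have "(\<lambda>n. ap (c *\<^sub>C 1) (ap (X n) x)) \<longlonglongrightarrow> ap (c *\<^sub>C 1) (L x)" by (intro tendsto_ap L)
      then show ?thesis using L[of "c *\<^sub>C x"] LIMSEQ_unique by (simp add: ap_scaleC scaleC_bop.rep_eq one_bop.rep_eq)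
    qed
    show "norm (L x) \<le> (1 + opnorm (X k)) * norm x" for x
    proof (rule LIMSEQ_le_const2[OF tendsto_norm[OF L]], intro exI allI impI)
      fix p assume "k \<le> p"
      have "norm (ap (X p) x) \<le> norm (ap (X p) x - ap (X k) x) + norm (ap (X k) x)"
        using norm_triangle_ineq[of "ap (X p) x - ap (X k) x" "ap (X k) x"] by simp
      also have "\<dots> \<le> 1 * norm x + opnorm (X k) * norm x"
        using d[of p x k] k[OF \<open>k \<le> p\<close>]
        by (intro add_mono norm_ap_le) (meson less_imp_le mult_right_mono norm_ge_zero order_trans)
      finally show "norm (ap (X p) x) \<le> (1 + opnorm (X k)) * norm x" by (simp add: distrib_right)
    qed
  qed
  then have apL: "ap (Abs_bop L) = L" by (simp add: Abs_bop_inverse)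
  have "(\<lambda>n. opnorm (X n - Abs_bop L)) \<longlonglongrightarrow> 0"
  proof (rule LIMSEQ_I)
    fix e :: real assume "e > 0"
    then obtain k where k: "\<And>p q. p \<ge> k \<Longrightarrow> q \<ge> k \<Longrightarrow> opnorm (X p - X q) < e / 2" using X[of "e / 2"] by auto
    have "opnorm (X n - Abs_bop L) \<le> e / 2" if "n \<ge> k" for n
    proof (rule opnorm_le)
      fix x
      have "(\<lambda>q. norm (ap (X n) x - ap (X q) x)) \<longlonglongrightarrow> norm (ap (X n) x - L x)"
        by (intro tendsto_intros L)
      then have "norm (ap (X n) x - L x) \<le> e / 2 * norm x"
      proof (rule LIMSEQ_le_const2, intro exI allI impI)
        fix q assume "k \<le> q"
        then show "norm (ap (X n) x - ap (X q) x) \<le> e / 2 * norm x"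
          using d[of n x q] k[OF that \<open>k \<le> q\<close>] by (meson less_imp_le mult_right_mono norm_ge_zero order_trans)
      qed
      then show "norm (ap (X n - Abs_bop L) x) \<le> e / 2 * norm x" by (simp add: ap_minus_left apL)
    qed (use \<open>e > 0\<close> in simp)
    then have "norm (opnorm (X n - Abs_bop L) - 0) < e" if "n \<ge> k" for n
      using that \<open>e > 0\<close> opnorm_nonneg[of "X n - Abs_bop L"] by (smt (verit) field_sum_of_halves real_norm_def)
    then show "\<exists>no. \<forall>n\<ge>no. norm (opnorm (X n - Abs_bop L) - 0) < e" by blast
  qed
  then show ?thesis by blast
qed

interpretation bop: complete_star_norm "opnorm :: 'h::chilbert_space bop \<Rightarrow> real"
proof
  fix S T :: "'h bop" and c
  show "opnorm (S + T) \<le> opnorm S + opnorm T"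
  proof (rule opnorm_le)
    show "norm (ap (S + T) x) \<le> (opnorm S + opnorm T) * norm x" for x
      using norm_triangle_ineq[of "ap S x" "ap T x"] norm_ap_le[of S x] norm_ap_le[of T x]
      by (simp add: plus_bop.rep_eq distrib_right)
  qed (simp add: opnorm_nonneg)
  show "opnorm (S * T) \<le> opnorm S * opnorm T"
  proof (rule opnorm_le)
    show "norm (ap (S * T) x) \<le> opnorm S * opnorm T * norm x" for x
      using norm_ap_le[of S "ap T x"] mult_left_mono[OF norm_ap_le[of T x] opnorm_nonneg[of S]]
      by (simp add: times_bop.rep_eq mult.assoc)
  qed (simp add: opnorm_nonneg)
  have scale_le: "opnorm (c *\<^sub>C T) \<le> cmod c * opnorm T" for c and T :: "'h bop"
  proof (rule opnorm_le)
    show "norm (ap (c *\<^sub>C T) x) \<le> cmod c * opnorm T * norm x" for x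
      using mult_left_mono[OF norm_ap_le[of T x], of "cmod c"]
      by (simp add: scaleC_bop.rep_eq norm_scaleC_hilbert mult.assoc)
  qed (simp add: opnorm_nonneg)
  show "opnorm (c *\<^sub>C T) = cmod c * opnorm T"
  proof (cases "c = 0")
    case True
    then show ?thesis using scale_le[of 0 T] opnorm_nonneg[of "0 *\<^sub>C T"] by simp
  next
    case False
    have "opnorm T \<le> cmod (1 / c) * opnorm (c *\<^sub>C T)" using scale_le[of "1 / c" "c *\<^sub>C T"] False by simp
    then have "cmod c * opnorm T \<le> opnorm (c *\<^sub>C T)" using False by (simp add: norm_divide field_simps)
    with scale_le[of c T] show ?thesis by simp
  qed
  have star_le: "opnorm (star T) \<le> opnorm T" for T :: "'h bop"
  proof (rule opnorm_le[OF opnorm_nonneg])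
    fix x
    show "norm (ap (star T) x) \<le> opnorm T * norm x"
    proof (cases "norm (ap (star T) x) = 0")
      case False
      have "norm (ap (star T) x) * norm (ap (star T) x) = cmod (cinner (ap (star T) x) (ap (star T) x))"
        by (simp add: cinner_self power2_eq_square norm_mult)
      also have "\<dots> = cmod (cinner x (ap T (ap (star T) x)))" by (simp add: star_bop_cinner)
      also have "\<dots> \<le> norm x * (opnorm T * norm (ap (star T) x))"
        by (rule order_trans[OF cauchy_schwarz]) (intro mult_left_mono norm_ap_le norm_ge_zero)
      finally have "norm (ap (star T) x) * norm (ap (star T) x) \<le> (opnorm T * norm x) * norm (ap (star T) x)"
        by (simp add: mult_ac)
      with False show ?thesis by simp
    qed (simp add: opnorm_nonneg)
  qed
  show "opnorm (star T) = opnorm T" using star_le[of T] star_le[of "star T"] by simp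
  show "T = 0" if "opnorm T = 0"
    by (rule bop_eqI) (use norm_ap_le[of T] that in \<open>simp add: zero_bop.rep_eq\<close>)
qed (rule opnorm_complete)

lemma positive_form_2:
  fixes T :: "'h::chilbert_space bop"
  assumes T: "\<And>h. cinner h (ap T h) \<in> \<real>\<^sub>\<ge>\<^sub>0"
  shows "cinner h (ap T k) = cnj (cinner k (ap T h))"
    and "(cmod (cinner k (ap T h)))\<^sup>2 \<le> Re (cinner k (ap T k)) * Re (cinner h (ap T h))"
proof -
  have p: "cnj s * s * cinner k (ap T k) + cnj s * t * cinner k (ap T h) + cnj t * s * cinner h (ap T k)
      + cnj t * t * cinner h (ap T h) \<in> \<real>\<^sub>\<ge>\<^sub>0" for s t
    using T[of "s *\<^sub>C k + t *\<^sub>C h"]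
    by (simp add: ap_add ap_scaleC cinner_add_left cinner_add_right cinner_scaleC_left cinner_scaleC_right
        mult_ac distrib_left add_ac)
  show "cinner h (ap T k) = cnj (cinner k (ap T h))" by (rule psd_form_2(1)[OF p])
  show "(cmod (cinner k (ap T h)))\<^sup>2 \<le> Re (cinner k (ap T k)) * Re (cinner h (ap T h))"
    by (rule psd_form_2(2)[OF p])
qed

text \<open>If \<open>T\<close> has norm \<open>t\<close>, then \<open>t - T\<close> is positive, too, and bounded by \<open>t\<close>; so the square
  root of \<open>1 - (t - T) / t\<close> is available.\<close>

lemma positive_operator_sqrt:
  fixes T :: "'h::chilbert_space bop"
  assumes T: "\<And>h. cinner h (ap T h) \<in> \<real>\<^sub>\<ge>\<^sub>0"
  obtains R where "star R = R" "T = R * R"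
proof (cases "opnorm T = 0")
  case True
  then have "T = 0" by (rule bop.N_zero)
  then show thesis by (intro that[of 0]) simp_all
next
  case False
  define t where "t = opnorm T"
  have t: "t > 0" using False opnorm_nonneg[of T] by (simp add: t_def)
  have sT: "star T = T"
    by (rule bop_eqI, rule cinner_ext)
      (metis cinner_commute cinner_star_right positive_form_2(1)[OF T])
  define P where "P = complex_of_real t *\<^sub>C 1 - T"
  have form: "cinner h (ap P h) = complex_of_real (t * (norm h)\<^sup>2) - cinner h (ap T h)" for h
    by (simp add: P_def ap_minus_left scaleC_bop.rep_eq one_bop.rep_eq cinner_diff_right cinner_scaleC_right
        cinner_self)
  have ub: "Re (cinner h (ap T h)) \<le> t * (norm h)\<^sup>2" for h
  proof -
    have "Re (cinner h (ap T h)) \<le> norm h * norm (ap T h)"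
      by (meson cauchy_schwarz complex_Re_le_cmod order_trans)
    also have "\<dots> \<le> norm h * (t * norm h)" unfolding t_def by (intro mult_left_mono norm_ap_le norm_ge_zero)
    finally show ?thesis by (simp add: power2_eq_square mult_ac)
  qed
  have P: "cinner h (ap P h) \<in> \<real>\<^sub>\<ge>\<^sub>0" for h
    unfolding form using T[of h] ub[of h] by (simp add: nonneg_Reals_iff)
  have Pub: "Re (cinner h (ap P h)) \<le> t * (norm h)\<^sup>2" for h
    unfolding form using T[of h] by (simp add: nonneg_Reals_iff)
  have nP: "norm (ap P h) \<le> t * norm h" for h
  proof (rule power2_le_imp_le)
    define k where "k = ap P h"
    have "(cmod (cinner k k))\<^sup>2 \<le> Re (cinner k (ap P k)) * Re (cinner h (ap P h))"
      using positive_form_2(2)[OF P, of k h] by (simp flip: k_def)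
    also have "\<dots> \<le> (t * (norm k)\<^sup>2) * (t * (norm h)\<^sup>2)"
      using Pub P[of h] t by (intro mult_mono) (auto simp: nonneg_Reals_iff)
    finally have "(norm k)\<^sup>2 \<le> t * (t * (norm h)\<^sup>2)"
      by (rule norm_square_le_of_form) (use t in simp)
    then show "(norm (ap P h))\<^sup>2 \<le> (t * norm h)\<^sup>2" by (simp add: k_def power2_eq_square mult_ac)
  qed (use t in simp)
  define z where "z = complex_of_real (1 / t) *\<^sub>C P"
  have z: "opnorm z \<le> 1"
  proof -
    have "opnorm P \<le> t" by (rule opnorm_le) (use t nP in auto)
    then show ?thesis using t by (simp add: z_def bop.N_scaleC norm_divide)
  qed
  have "star z = z" by (simp add: z_def P_def star_scaleC star_diff sT)
  then obtain r where r: "star r = r" "r * r = 1 - z" using z by (rule bop.sqrt_one_minus)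
  have z1: "1 - z = complex_of_real (1 / t) *\<^sub>C T"
    using t by (simp add: z_def P_def scaleC_diff_right)
  show thesis
  proof (rule that[of "complex_of_real (sqrt t) *\<^sub>C r"])
    show "star (complex_of_real (sqrt t) *\<^sub>C r) = complex_of_real (sqrt t) *\<^sub>C r"
      by (simp add: star_scaleC r)
    have "complex_of_real (sqrt t) *\<^sub>C r * complex_of_real (sqrt t) *\<^sub>C r
        = complex_of_real (sqrt t * sqrt t) *\<^sub>C (r * r)"
      by (simp only: mult_scaleC_left mult_scaleC_right scaleC_scaleC of_real_mult)
    also have "\<dots> = T" using t unfolding r(2) z1 by simp
    finally show "T = complex_of_real (sqrt t) *\<^sub>C r * complex_of_real (sqrt t) *\<^sub>C r" by simp
  qed
qed

text \<open>Conjugation with the isometries \<open>W i\<close> makes the matrix a single operator, and the matrix of its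
  square root \<open>R\<close> is the factor \<open>Y\<close>.\<close>

lemma positive_operator_matrix:
  fixes X :: "'h::chilbert_space bop fmat" and e :: "nat \<Rightarrow> 'h"
  assumes e: "hilbert_basis e" and X: "X \<in> Mat k UNIV"
    and psd: "\<And>h. (\<Sum>i<k. \<Sum>j<k. cinner (h i) (ap (entry X i j) (h j))) \<in> \<real>\<^sub>\<ge>\<^sub>0"
  shows "positive_in (Mat k UNIV) X"
proof (cases "k = 0")
  case True
  then have "X = star 0 * 0" using X by (intro fmat_eqI) (simp add: Mat_UNIV zero_fmat.rep_eq)
  moreover have "0 \<in> Mat k (UNIV :: 'h bop set)" by (simp add: Mat_UNIV zero_fmat.rep_eq)
  ultimately show ?thesis unfolding positive_in_def by blast
next
  case False
  then have "k > 0" by simp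
  then obtain W :: "nat \<Rightarrow> 'h bop" where
    W: "\<And>i j. i < k \<Longrightarrow> j < k \<Longrightarrow> star (W i) * W j = (if i = j then 1 else 0)"
    and sum: "(\<Sum>i<k. W i * star (W i)) = 1" using cuntz_isometries[OF e] by blast
  define T where "T = (\<Sum>i<k. \<Sum>j<k. W i * entry X i j * star (W j))"
  have "cinner h (ap T h) = (\<Sum>i<k. \<Sum>j<k. cinner (ap (star (W i)) h) (ap (entry X i j) (ap (star (W j)) h)))" for h
    by (simp add: T_def ap_sum_left cinner_sum_right times_bop.rep_eq star_bop_cinner)
  then have "cinner h (ap T h) \<in> \<real>\<^sub>\<ge>\<^sub>0" for h using psd by simp
  then obtain R where R: "star R = R" "T = R * R" by (rule positive_operator_sqrt)
  define Y where "Y = mk_fmat k (\<lambda>l j. star (W l) * R * W j)"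
  have Y: "Y \<in> Mat k UNIV" by (simp add: Y_def Mat_UNIV mk_fmat.rep_eq)
  have "X = star Y * Y"
  proof (rule fmat_eqI)
    fix i j
    have yy: "entry (star Y * Y) i j = (\<Sum>l<k. star (entry Y l i) * entry Y l j)"
      by (subst entry_times[where N=k]) (auto simp: star_fmat.rep_eq Y_def mk_fmat.rep_eq)
    show "entry X i j = entry (star Y * Y) i j"
    proof (cases "i < k \<and> j < k")
      case True
      have "entry (star Y * Y) i j = (\<Sum>l<k. star (W i) * R * (W l * star (W l)) * (R * W j))"
        unfolding yy by (rule sum.cong) (use True R in \<open>simp_all add: Y_def mk_fmat.rep_eq star_mult mult.assoc\<close>)
      also have "\<dots> = star (W i) * R * (\<Sum>l<k. W l * star (W l)) * (R * W j)"
        by (simp add: sum_distrib_left sum_distrib_right)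
      also have "\<dots> = star (W i) * T * W j" by (simp add: sum R mult.assoc)
      also have "\<dots> = (\<Sum>a<k. \<Sum>b<k. (star (W i) * W a) * entry X a b * (star (W b) * W j))"
        by (simp add: T_def sum_distrib_left sum_distrib_right mult.assoc)
      also have "\<dots> = (\<Sum>a<k. \<Sum>b<k. if b = j then if a = i then entry X i j else 0 else 0)"
        by (intro sum.cong refl) (use True in \<open>auto simp: W\<close>)
      also have "\<dots> = entry X i j" using True by simp
      finally show ?thesis by simp
    next
      case False
      then have "entry (star Y * Y) i j = 0" unfolding yy
        by (intro sum.neutral) (auto simp: Y_def mk_fmat.rep_eq)
      then show ?thesis using X False by (simp add: Mat_UNIV)
    qed
  qed
  with Y show ?thesis unfolding positive_in_def by blast
qed

section \<open>Unitary generators\<close>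

text \<open>The unitary $b+i\sqrt{1-b^2}$ has real part \<open>b\<close>.\<close>

lemma real_part_of_unitary:
  fixes b :: "'a::unital_cstar_algebra"
  assumes b: "star b = b" "norm b \<le> 1"
  obtains u where "unitary u" "b = (1/2) *\<^sub>C (u + star u)"
proof -
  have nb: "norm (b * b) \<le> 1"
    using norm_mult_ineq[of b b] mult_le_one[OF b(2) norm_ge_zero b(2)] by (rule order_trans)
  have "star (1 - b * b) = 1 - b * b" by (simp add: star_diff star_mult b)
  moreover have "norm (1 *\<^sub>R 1 - (1 - b * b)) \<le> 1" using nb by simp
  ultimately obtain s where s: "star s = s" "1 - b * b = s * s"
    "\<forall>c. c * (1 - b * b) = (1 - b * b) * c \<longrightarrow> c * s = s * c" by (rule square_root_sa)
  have bs: "b * s = s * b" using s(3)[rule_format, of b] by (simp add: algebra_simps)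
  have one: "b * b + s * s = 1" using s(2)[symmetric] by simp
  define u where "u = b + \<i> *\<^sub>C s"
  have su: "star u = b - \<i> *\<^sub>C s"
    by (simp add: u_def star_add star_scaleC b s(1) complex_vector.scale_minus_left)
  have "star u * u = 1" unfolding su unfolding u_def using add_i_mult[OF bs] one by simp
  moreover have "u * star u = 1" unfolding su unfolding u_def
    using add_i_mult[of b "- s"] bs one by (simp add: scaleC_minus_right)
  moreover have "b = (1/2) *\<^sub>C (u + star u)"
  proof -
    have "u + star u = (1 + 1) *\<^sub>C b" unfolding scaleC_add_left su by (simp add: u_def)
    then show ?thesis by simp
  qed
  ultimately show thesis by (intro that[of u]) (simp_all add: unitary_def)
qed

lemma unitaries_spanning:
  fixes a :: "'a::unital_cstar_algebra"
  obtains u v where "unitary u" "unitary v" "\<And>B. star_subalg B \<Longrightarrow> u \<in> B \<Longrightarrow> v \<in> B \<Longrightarrow> a \<in> B"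
proof -
  define c where "c = norm a + 1"
  have c: "c > 0" by (simp add: c_def add_nonneg_pos)
  define h k where "h = complex_of_real (1 / (2 * c)) *\<^sub>C (a + star a)"
    and "k = (\<i> * complex_of_real (1 / (2 * c))) *\<^sub>C (star a - a)"
  have sh: "star h = h" by (simp add: h_def star_scaleC star_add add.commute)
  have sk: "star k = k"
    by (simp add: k_def star_scaleC star_diff complex_vector.scale_minus_left scaleC_diff_right)
  have le: "norm a + norm a \<le> 2 * c" by (simp add: c_def)
  have nh: "norm h \<le> 1"
  proof -
    have "norm h = norm (a + star a) / (2 * c)" using c by (simp add: h_def norm_scaleC norm_divide)
    also have "\<dots> \<le> 1" using norm_triangle_ineq[of a "star a"] le c by (simp add: norm_star)
    finally show ?thesis .
  qed
  have nk: "norm k \<le> 1"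
  proof -
    have "norm k = norm (star a - a) / (2 * c)" using c by (simp add: k_def norm_scaleC norm_divide norm_mult)
    also have "\<dots> \<le> 1" using norm_triangle_ineq4[of "star a" a] le c by (simp add: norm_star)
    finally show ?thesis .
  qed
  obtain u where u: "unitary u" "h = (1/2) *\<^sub>C (u + star u)" by (rule real_part_of_unitary[OF sh nh])
  obtain v where v: "unitary v" "k = (1/2) *\<^sub>C (v + star v)" by (rule real_part_of_unitary[OF sk nk])
  have a: "a = complex_of_real c *\<^sub>C (h + \<i> *\<^sub>C k)"
  proof -
    have "\<i> *\<^sub>C k = complex_of_real (1 / (2 * c)) *\<^sub>C (a - star a)"
    proof -
      have "\<i> * (\<i> * complex_of_real (1 / (2 * c))) = - complex_of_real (1 / (2 * c))"
        by (simp flip: mult.assoc)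
      then show ?thesis unfolding k_def scaleC_scaleC
        by (simp add: complex_vector.scale_minus_left scaleC_diff_right)
    qed
    then have "h + \<i> *\<^sub>C k = complex_of_real (1 / (2 * c)) *\<^sub>C ((1 + 1) *\<^sub>C a)"
      unfolding h_def scaleC_add_left scaleC_add_right[symmetric] by (simp flip: scaleC_add_right)
    then show ?thesis using c by simp
  qed
  show thesis
  proof (rule that[OF u(1) v(1)])
    fix B :: "'a set" assume B: "star_subalg B" "u \<in> B" "v \<in> B"
    note alg = star_subalgD[OF B(1)]
    have "h \<in> B" "k \<in> B" using B(2,3) unfolding u(2) v(2) by (auto intro!: alg)
    then show "a \<in> B" by (subst a) (intro alg)
  qed
qed

section \<open>Four-dimensional operator systems\<close>

lemma independent_four:
  fixes x1 x2 x3 x4 :: "'v::complex_vector"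
  assumes lin: "\<And>a b c d. a *\<^sub>C x1 + b *\<^sub>C x2 + c *\<^sub>C x3 + d *\<^sub>C x4 = 0 \<Longrightarrow> a = 0 \<and> b = 0 \<and> c = 0 \<and> d = 0"
  shows "cdim (cspan {x1, x2, x3, x4}) = 4"
proof -
  have ne: "x1 \<noteq> x2" "x1 \<noteq> x3" "x1 \<noteq> x4" "x2 \<noteq> x3" "x2 \<noteq> x4" "x3 \<noteq> x4"
    using lin[of 1 "-1" 0 0] lin[of 1 0 "-1" 0] lin[of 1 0 0 "-1"] lin[of 0 1 "-1" 0] lin[of 0 1 0 "-1"]
      lin[of 0 0 1 "-1"]
    by (auto simp: complex_vector.scale_minus_left)
  have "\<not> cdependent {x1, x2, x3, x4}"
  proof
    assume "cdependent {x1, x2, x3, x4}"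
    then obtain f where f: "\<exists>v\<in>{x1, x2, x3, x4}. f v \<noteq> 0" "(\<Sum>v\<in>{x1, x2, x3, x4}. f v *\<^sub>C v) = 0"
      by (subst (asm) complex_vector.dependent_finite) auto
    have "f x1 *\<^sub>C x1 + f x2 *\<^sub>C x2 + f x3 *\<^sub>C x3 + f x4 *\<^sub>C x4 = 0"
      using f(2) ne by (simp add: add.assoc)
    from lin[OF this] f(1) show False by auto
  qed
  then have "cdim (cspan {x1, x2, x3, x4}) = card {x1, x2, x3, x4}"
    by (simp add: complex_vector.dim_eq_card_independent)
  also have "\<dots> = 4" using ne by simp
  finally show ?thesis .
qed

lemma star_closed_cspan:
  fixes X :: "'b::star_algebra set"
  assumes "\<And>x. x \<in> X \<Longrightarrow> star x \<in> cspan X" "x \<in> cspan X"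
  shows "star x \<in> cspan X"
proof -
  have "csubspace {x. star x \<in> cspan X}"
    by (rule complex_vector.subspaceI)
      (simp_all add: complex_vector.span_zero star_add star_scaleC complex_vector.span_add complex_vector.span_scale)
  then have "cspan X \<subseteq> {x. star x \<in> cspan X}"
    by (rule complex_vector.span_minimal[rotated]) (use assms(1) in blast)
  then show ?thesis using assms(2) by blast
qed

lemma diag_mat_in_Mat: "diag_mat m f \<in> Mat m UNIV"
  by (auto simp: Mat_UNIV entry_diag_mat)

lemma compress_entry:
  fixes x :: "'a::unital_star_algebra fmat"
  assumes x: "x \<in> Mat m UNIV" and ij: "i < m" "j < m"
  shows "sing i i 1 * x * sing j j 1 = sing i j (entry x i j)"
proof -
  have "x = (\<Sum>p<m. \<Sum>q<m. sing p q (entry x p q))"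
    by (rule fmat_eq_sum_sing) (use x in \<open>auto simp: Mat_UNIV\<close>)
  then have "sing i i 1 * x * sing j j 1 = sing i i 1 * (\<Sum>p<m. \<Sum>q<m. sing p q (entry x p q)) * sing j j 1"
    by simp
  also have "\<dots> = (\<Sum>p<m. \<Sum>q<m. if q = j then if p = i then sing i j (entry x i j) else 0 else 0)"
    unfolding sum_distrib_left sum_distrib_right by (intro sum.cong refl) (auto simp: sing_mult)
  also have "\<dots> = sing i j (entry x i j)" using ij by simp
  finally show ?thesis .
qed

text \<open>The Cayley transforms of the natural numbers are distinct numbers of modulus \<open>1\<close> that can be computed with.\<close>

definition cayley :: "nat \<Rightarrow> complex" where
  "cayley j = (1 + \<i> * of_nat j) / (1 - \<i> * of_nat j)"

lemma cayley_denominator: "1 - \<i> * of_nat j \<noteq> (0::complex)" "1 + \<i> * of_nat j \<noteq> (0::complex)"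
  by (auto simp: complex_eq_iff)

lemma cnj_cayley: "cnj (cayley j) * cayley j = 1"
  using cayley_denominator[of j] by (simp add: cayley_def)

lemma cayley_inj: "cayley i = cayley j \<Longrightarrow> i = j"
proof -
  assume "cayley i = cayley j"
  then have "(1 + \<i> * of_nat i) * (1 - \<i> * of_nat j) = (1 + \<i> * of_nat j) * (1 - \<i> * of_nat i)"
    using cayley_denominator by (simp add: cayley_def frac_eq_eq)
  then have "2 * \<i> * of_nat i = 2 * \<i> * (of_nat j :: complex)" by (simp add: algebra_simps)
  then show "i = j" by simp
qed

text \<open>The points \<open>1\<close>, \<open>i\<close> and \<open>(-3 + 4 * i) / 5\<close> of the unit circle are not collinear.\<close>

lemma cayley_independent:
  assumes "\<And>j. j < 3 \<Longrightarrow> a + b * cayley j + c * cnj (cayley j) = 0"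
  shows "a = 0 \<and> b = 0 \<and> c = 0"
proof -
  have w0: "cayley 0 = 1" by (simp add: cayley_def)
  have w1: "cayley 1 = \<i>"
    using cayley_denominator[of 1] by (simp add: cayley_def divide_eq_eq algebra_simps)
  have w2: "5 * cayley 2 = - 3 + 4 * \<i>"
  proof -
    have "cayley 2 * (1 - 2 * \<i>) = 1 + 2 * \<i>"
      using cayley_denominator[of 2] by (simp add: cayley_def mult.commute)
    then have "cayley 2 * (1 - 2 * \<i>) * (1 + 2 * \<i>) = (1 + 2 * \<i>) * (1 + 2 * \<i>)" by simp
    then show ?thesis by (simp add: algebra_simps)
  qed
  have w2': "5 * cnj (cayley 2) = - 3 - 4 * \<i>"
    using arg_cong[OF w2, of cnj] by simp
  have 0: "a + b + c = 0" using assms[of 0] by (simp add: w0)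
  have 1: "a + \<i> * (b - c) = 0" using assms[of 1] unfolding w1 by (simp add: algebra_simps)
  have "5 * (a + b * cayley 2 + c * cnj (cayley 2)) = 0" using assms[of 2] by simp
  then have "5 * a + b * (5 * cayley 2) + c * (5 * cnj (cayley 2)) = 0" by (simp add: algebra_simps)
  then have 2: "5 * a + b * (- 3 + 4 * \<i>) + c * (- 3 - 4 * \<i>) = 0" unfolding w2 w2' .
  have "4 * a = (5 * a + b * (- 3 + 4 * \<i>) + c * (- 3 - 4 * \<i>)) + 3 * (a + b + c) - 4 * (a + \<i> * (b - c))"
    by (simp add: algebra_simps)
  also have "\<dots> = 0" unfolding 0 1 2 by simp
  finally have a: "a = 0" by simp
  then have "b + c = 0" "b - c = 0" using 0 1 by simp_all
  then have "b = 0 \<and> c = 0" by (simp add: complex_eq_iff)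
  with a show ?thesis by simp
qed

text \<open>The ones in the first row and column link all diagonal matrix units to $E_{00}$; the entries next to the diagonal
  carry the generators. If these are unitary, then every nonzero $E_{ii}yE_{jj}$ is a partial isometry whose initial
  and final projections are diagonal matrix units.\<close>

definition linking_mat :: "nat \<Rightarrow> (nat \<Rightarrow> 'a) \<Rightarrow> 'a::unital_star_algebra fmat" where
  "linking_mat m v = mk_fmat m (\<lambda>p q.
     if p = 0 \<and> 0 < q \<or> q = 0 \<and> 0 < p then 1
     else if 0 < p \<and> q = Suc p then v (p - 1)
     else if 0 < q \<and> p = Suc q then star (v (q - 1)) else 0)"

lemma star_linking_mat: "star (linking_mat m v) = linking_mat m v"
  by (rule fmat_eqI) (auto simp: linking_mat_def star_fmat.rep_eq mk_fmat.rep_eq)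

definition cayley_diag :: "nat \<Rightarrow> 'a::unital_star_algebra fmat" where
  "cayley_diag m = diag_mat m (\<lambda>j. cayley j *\<^sub>C 1)"

definition linking_system :: "nat \<Rightarrow> (nat \<Rightarrow> 'a) \<Rightarrow> 'a::unital_star_algebra fmat set" where
  "linking_system m v = cspan {mat_one m, cayley_diag m, star (cayley_diag m), linking_mat m v}"

lemma linking_system_subsystem: "operator_subsystem (Mat m UNIV) (linking_system m v)"
proof -
  let ?X = "{mat_one m, cayley_diag m, star (cayley_diag m), linking_mat m v}"
  have "?X \<subseteq> Mat m UNIV"
    by (auto simp: cayley_diag_def star_diag_mat linking_mat_def Mat_UNIV mk_fmat.rep_eq
        entry_mat_one entry_diag_mat)
  moreover have "csubspace (Mat m (UNIV :: 'a set))"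
    by (rule star_subalg_Mat[unfolded star_subalg_def, THEN conjunct1])
  ultimately have 1: "cspan ?X \<subseteq> Mat m UNIV" by (rule complex_vector.span_minimal)
  have 2: "star x \<in> cspan ?X" if "x \<in> cspan ?X" for x
    by (rule star_closed_cspan[OF _ that])
      (auto simp: star_mat_one star_linking_mat intro: complex_vector.span_base)
  show ?thesis
    unfolding operator_subsystem_def linking_system_def unit_of_Mat_eq
    using 1 2 by (auto intro: complex_vector.span_base)
qed

lemma cdim_linking_system:
  fixes v :: "nat \<Rightarrow> 'a::unital_cstar_algebra"
  assumes m: "3 \<le> m"
  shows "cdim (linking_system m v) = 4"
  unfolding linking_system_def
proof (rule independent_four)
  fix a b c d
  assume eq: "a *\<^sub>C mat_one m + b *\<^sub>C cayley_diag m + c *\<^sub>C star (cayley_diag m) + d *\<^sub>C linking_mat m v = 0"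
  let ?L = "a *\<^sub>C mat_one m + b *\<^sub>C cayley_diag m + c *\<^sub>C star (cayley_diag m) + d *\<^sub>C linking_mat m v"
  have ent: "entry ?L i j = 0" for i j unfolding eq by (simp add: zero_fmat.rep_eq)
  have "d *\<^sub>C (1::'a) = 0"
    using ent[of 0 1] m
    by (simp add: entry_simps entry_mat_one cayley_diag_def entry_diag_mat star_diag_mat linking_mat_def mk_fmat.rep_eq)
  then have d: "d = 0" by (simp add: complex_vector.scale_eq_0_iff)
  have "a + b * cayley j + c * cnj (cayley j) = 0" if "j < 3" for j
  proof -
    have "(a + b * cayley j + c * cnj (cayley j)) *\<^sub>C (1::'a) = 0"
      using ent[of j j] m that
      by (simp add: entry_simps entry_mat_one cayley_diag_def entry_diag_mat star_diag_mat linking_mat_def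
          mk_fmat.rep_eq d scaleC_add_left star_scaleC)
    then show ?thesis by (simp add: complex_vector.scale_eq_0_iff)
  qed
  then have "a = 0 \<and> b = 0 \<and> c = 0" by (rule cayley_independent)
  with d show "a = 0 \<and> b = 0 \<and> c = 0 \<and> d = 0" by simp
qed

lemma cayley_diag_unitary:
  "star (cayley_diag m) * cayley_diag m = mat_one m" "cayley_diag m * star (cayley_diag m) = mat_one m"
  by (simp_all add: cayley_diag_def star_diag_mat diag_mat_mult star_scaleC mult_scaleC_left mult_scaleC_right
      cnj_cayley mult.commute[of "cayley _"] mat_one_def[symmetric])

text \<open>Lagrange interpolation at the eigenvalues of the diagonal unitary.\<close>

lemma diag_units_generated:
  fixes G :: "'a::unital_star_algebra fmat set"
  assumes G: "star_subalg G" and E: "mat_one m \<in> G" and u: "cayley_diag m \<in> G" and k: "k < m"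
  shows "sing k k 1 \<in> G"
proof -
  note alg = star_subalgD[OF G]
  \<comment> \<open>the Lagrange factors, \<open>1\<close> at \<open>k\<close> and \<open>0\<close> at \<open>l\<close>\<close>
  define g where "g l j = (cayley j - cayley l) / (cayley k - cayley l)" for l j
  have g_in: "diag_mat m (\<lambda>j. g l j *\<^sub>C 1) \<in> G" for l
  proof -
    have "diag_mat m (\<lambda>j. g l j *\<^sub>C (1::'a))
        = (1 / (cayley k - cayley l)) *\<^sub>C cayley_diag m - (cayley l / (cayley k - cayley l)) *\<^sub>C mat_one m"
      by (rule fmat_eqI) (auto simp: entry_diag_mat entry_minus scaleC_fmat.rep_eq cayley_diag_def entry_mat_one
          g_def diff_divide_distrib complex_vector.scale_left_diff_distrib)
    also have "\<dots> \<in> G" by (intro alg E u)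
    finally show ?thesis .
  qed
  have prod_in: "diag_mat m (\<lambda>j. (\<Prod>l\<in>J. g l j) *\<^sub>C 1) \<in> G" if "finite J" for J
    using that
  proof (induction J)
    case empty
    then show ?case using E by (simp add: mat_one_def[symmetric])
  next
    case (insert l J)
    have "diag_mat m (\<lambda>j. (\<Prod>l\<in>insert l J. g l j) *\<^sub>C 1)
        = diag_mat m (\<lambda>j. g l j *\<^sub>C (1::'a)) * diag_mat m (\<lambda>j. (\<Prod>l\<in>J. g l j) *\<^sub>C 1)"
      using insert.hyps by (simp add: diag_mat_mult mult_scaleC_left mult_scaleC_right mult.commute)
    also have "\<dots> \<in> G" using g_in insert.IH by (rule alg)
    finally show ?case .
  qed
  have "(\<Prod>l\<in>{..<m} - {k}. g l j) = (if j = k then 1 else 0)" if "j < m" for j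
  proof (cases "j = k")
    case True
    have "g l k = 1" if "l \<noteq> k" for l using cayley_inj[of k l] that by (auto simp: g_def)
    then show ?thesis using True by (simp add: prod.neutral)
  next
    case False
    then have "\<exists>l\<in>{..<m} - {k}. g l j = 0" using that by (intro bexI[of _ j]) (auto simp: g_def)
    then show ?thesis using False by (simp add: prod_zero)
  qed
  then have "diag_mat m (\<lambda>j. (\<Prod>l\<in>{..<m} - {k}. g l j) *\<^sub>C 1) = (sing k k 1 :: 'a fmat)"
    using k by (intro fmat_eqI) (auto simp: entry_diag_mat entry_sing)
  then show ?thesis using prod_in[of "{..<m} - {k}"] by simp
qed

section \<open>The induced *-homomorphism into the Calkin algebra\<close>

lemma unital_star_homD:
  assumes "unital_star_hom f"
  shows "f (x + y) = f x + f y" "f (c *\<^sub>C x) = c *\<^sub>C f x" "f (x * y) = f x * f y"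
    "f (star x) = star (f x)" "f 1 = 1" "f 0 = 0" "f (x - y) = f x - f y" "f (\<Sum>i\<in>I. g i) = (\<Sum>i\<in>I. f (g i))"
proof -
  show add: "f (x + y) = f x + f y" for x y using assms by (simp add: unital_star_hom_def)
  show scale: "f (c *\<^sub>C x) = c *\<^sub>C f x" for c x using assms by (simp add: unital_star_hom_def)
  show "f (x * y) = f x * f y" "f (star x) = star (f x)" "f 1 = 1" using assms by (simp_all add: unital_star_hom_def)
  show zero: "f 0 = 0" using scale[of 0 0] by simp
  show "f (x - y) = f x - f y" using add[of "x - y" y] by (simp add: eq_diff_eq)
  show "f (\<Sum>i\<in>I. g i) = (\<Sum>i\<in>I. f (g i))"
    by (induction I rule: infinite_finite_induct) (simp_all add: add zero)
qed

lemmas proj_hom = unital_star_homD[OF calkin_proj_star_hom]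

text \<open>The map $V(\rho\otimes\mathrm{id}_m)(\cdot)V^*$ in terms of the columns \<open>w i\<close> of \<open>V\<close>.\<close>

definition matrix_conj ::
    "nat \<Rightarrow> (nat \<Rightarrow> 'b::star_algebra) \<Rightarrow> ('a::star_algebra \<Rightarrow> 'b) \<Rightarrow> 'a fmat \<Rightarrow> 'b" where
  "matrix_conj m w \<rho> x = (\<Sum>i<m. \<Sum>j<m. w i * \<rho> (entry x i j) * star (w j))"

lemma conj_calkin_eq_matrix_conj:
  fixes W :: "nat \<Rightarrow> 'h::chilbert_space bop"
  assumes V: "hsum_unitary m (\<lambda>f. \<Sum>i<m. ap (W i) (f i))"
  shows "conj_calkin m (\<lambda>f. \<Sum>i<m. ap (W i) (f i)) (amplify m \<rho> x) = matrix_conj m (\<lambda>i. calkin_proj (W i)) \<rho> x"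
proof -
  let ?V = "\<lambda>f. \<Sum>i<m. ap (W i) (f i)"
  have "amplify m \<rho> x \<in> Mat m UNIV" by (simp add: amplify_def Mat_UNIV mk_fmat.rep_eq)
  then obtain X where X: "X \<in> Mat m UNIV" "amplify m calkin_proj X = amplify m \<rho> x"
    using amplify_calkin_proj_surj by blast
  have XE: "calkin_proj (entry X i j) = \<rho> (entry x i j)" if "i < m" "j < m" for i j
    using arg_cong[OF X(2), of "\<lambda>z. entry z i j"] that by (simp add: amplify_def mk_fmat.rep_eq)
  obtain W' where W': "\<forall>h i. i < m \<longrightarrow> ap (W' i) h = ?V (\<lambda>j. if j = i then h else 0)"
    "\<forall>X. conj_bop m ?V X = (\<Sum>i<m. \<Sum>j<m. W' i * entry X i j * star (W' j))"
    using conj_bop_eq_sum[OF V] by blast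
  have "W' i = W i" if "i < m" for i
  proof (rule bop_eqI)
    fix h
    have "ap (W' i) h = (\<Sum>j<m. ap (W j) (if j = i then h else 0))" using W'(1) that by blast
    also have "\<dots> = (\<Sum>j<m. if j = i then ap (W i) h else 0)" by (rule sum.cong) auto
    finally show "ap (W' i) h = ap (W i) h" using that by simp
  qed
  then have "conj_bop m ?V X = (\<Sum>i<m. \<Sum>j<m. W i * entry X i j * star (W j))"
    unfolding W'(2)[rule_format] by (intro sum.cong refl) simp
  then have "conj_calkin m ?V (amplify m calkin_proj X) = calkin_proj (\<Sum>i<m. \<Sum>j<m. W i * entry X i j * star (W j))"
    using conj_calkin_amplify[OF V X(1)] by simp
  also have "\<dots> = matrix_conj m (\<lambda>i. calkin_proj (W i)) \<rho> x"
    unfolding matrix_conj_def proj_hom by (intro sum.cong refl) (simp add: XE)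
  finally show ?thesis by (simp add: X(2))
qed

lemma matrix_conj_hom:
  fixes w :: "nat \<Rightarrow> 'b::unital_star_algebra" and \<rho> :: "'a::unital_star_algebra \<Rightarrow> 'b"
  assumes \<rho>: "unital_star_hom \<rho>"
    and w: "\<And>i j. i < m \<Longrightarrow> j < m \<Longrightarrow> star (w i) * w j = (if i = j then 1 else 0)"
  shows "matrix_conj m w \<rho> (x + y) = matrix_conj m w \<rho> x + matrix_conj m w \<rho> y"
    and "matrix_conj m w \<rho> (c *\<^sub>C x) = c *\<^sub>C matrix_conj m w \<rho> x"
    and "matrix_conj m w \<rho> (star x) = star (matrix_conj m w \<rho> x)"
    and "x \<in> Mat m UNIV \<Longrightarrow> matrix_conj m w \<rho> (x * y) = matrix_conj m w \<rho> x * matrix_conj m w \<rho> y"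
proof -
  note hom = unital_star_homD[OF \<rho>]
  show "matrix_conj m w \<rho> (x + y) = matrix_conj m w \<rho> x + matrix_conj m w \<rho> y"
    by (simp add: matrix_conj_def plus_fmat.rep_eq hom distrib_left distrib_right sum.distrib)
  show "matrix_conj m w \<rho> (c *\<^sub>C x) = c *\<^sub>C matrix_conj m w \<rho> x"
    by (simp add: matrix_conj_def scaleC_fmat.rep_eq hom scaleC_sum_right mult_scaleC_left mult_scaleC_right)
  show "matrix_conj m w \<rho> (star x) = star (matrix_conj m w \<rho> x)"
    by (simp add: matrix_conj_def star_fmat.rep_eq hom star_sum star_mult mult.assoc) (rule sum.swap)
  assume x: "x \<in> Mat m UNIV"
  have xy: "entry (x * y) i l = (\<Sum>j<m. entry x i j * entry y j l)" for i l
    by (rule entry_times) (use x in \<open>auto simp: Mat_UNIV\<close>)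
  define a b where "a i j = w i * \<rho> (entry x i j)" and "b k l = \<rho> (entry y k l) * star (w l)" for i j k l
  have "matrix_conj m w \<rho> x * matrix_conj m w \<rho> y
      = (\<Sum>i<m. \<Sum>j<m. a i j * star (w j)) * (\<Sum>k<m. \<Sum>l<m. w k * b k l)"
    by (simp add: matrix_conj_def a_def b_def mult.assoc)
  also have "\<dots> = (\<Sum>i<m. \<Sum>j<m. \<Sum>k<m. \<Sum>l<m. a i j * (star (w j) * w k) * b k l)"
    unfolding sum_distrib_right unfolding sum_distrib_left by (simp only: mult.assoc)
  also have "\<dots> = (\<Sum>i<m. \<Sum>j<m. \<Sum>k<m. if k = j then (\<Sum>l<m. a i j * b j l) else 0)"
    by (intro sum.cong refl) (auto simp: w)
  also have "\<dots> = (\<Sum>i<m. \<Sum>j<m. \<Sum>l<m. a i j * b j l)" by simp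
  also have "\<dots> = (\<Sum>i<m. \<Sum>l<m. \<Sum>j<m. a i j * b j l)" by (rule sum.cong[OF refl], rule sum.swap)
  also have "\<dots> = matrix_conj m w \<rho> (x * y)"
    by (simp add: matrix_conj_def xy hom a_def b_def sum_distrib_left sum_distrib_right mult.assoc)
  finally show "matrix_conj m w \<rho> (x * y) = matrix_conj m w \<rho> x * matrix_conj m w \<rho> y" by simp
qed

section \<open>Contractivity modulo the compact operators\<close>

text \<open>Contractivity of *-homomorphisms without a norm on the Calkin algebra: $\delta^2-c^*c$ is a
  square \<open>star d * d\<close>, so that $T^*T+D^*D=\delta^2-K$ with \<open>K\<close> compact.\<close>

lemma star_hom_bound_mod_compact:
  fixes \<theta> :: "'a::unital_cstar_algebra \<Rightarrow> 'h::chilbert_space calkin"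
  assumes \<theta>: "unital_star_hom \<theta>" and T: "calkin_proj T = \<theta> c" and c: "norm c \<le> \<delta>" and \<delta>: "\<delta> > 0"
  obtains K where "compact_op K" "\<And>h. norm (ap T h) \<le> \<delta> * norm h + norm (ap K h)"
proof -
  note hom = unital_star_homD[OF \<theta>]
  have "(norm c)\<^sup>2 \<le> \<delta>\<^sup>2" using c by (simp add: power_mono)
  then obtain d where d: "\<delta>\<^sup>2 *\<^sub>R 1 - star c * c = star d * d" using norm_sq_minus_square by blast
  then have sq: "complex_of_real (\<delta>\<^sup>2) *\<^sub>C 1 = star c * c + star d * d"
    by (simp add: scaleR_eq_scaleC algebra_simps)
  obtain D where D: "calkin_proj D = \<theta> d" by (metis Quotient3_abs_rep[OF Quotient3_calkin])
  define K where "K = complex_of_real (\<delta>\<^sup>2) *\<^sub>C 1 - (star T * T + star D * D)"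
  have "calkin_proj K = \<theta> (complex_of_real (\<delta>\<^sup>2) *\<^sub>C 1 - (star c * c + star d * d))"
    unfolding K_def proj_hom hom T D ..
  then have K: "compact_op K" unfolding sq by (simp add: hom flip: calkin_proj_zero)
  show thesis
  proof (rule that)
    show "compact_op (complex_of_real (1 / \<delta>) *\<^sub>C K)" by (rule compact_op_scaleC[OF K])
    fix h
    let ?C = "complex_of_real (1 / \<delta>) *\<^sub>C K"
    have "cinner h (ap K h) = complex_of_real (\<delta>\<^sup>2 * (norm h)\<^sup>2 - (norm (ap T h))\<^sup>2 - (norm (ap D h))\<^sup>2)"
      by (simp add: K_def ap_minus_left plus_bop.rep_eq scaleC_bop.rep_eq one_bop.rep_eq times_bop.rep_eq
          cinner_diff_right cinner_add_right cinner_scaleC_right cinner_star_right cinner_self)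
    then have "(norm (ap T h))\<^sup>2 = \<delta>\<^sup>2 * (norm h)\<^sup>2 - (norm (ap D h))\<^sup>2 - Re (cinner h (ap K h))" by simp
    also have "\<dots> \<le> (\<delta> * norm h)\<^sup>2 + norm h * norm (ap K h)"
    proof -
      have "- Re (cinner h (ap K h)) \<le> cmod (cinner h (ap K h))"
        using abs_Re_le_cmod[of "cinner h (ap K h)"] by linarith
      also have "\<dots> \<le> norm h * norm (ap K h)" by (rule cauchy_schwarz)
      finally have "- Re (cinner h (ap K h)) \<le> norm h * norm (ap K h)" .
      then show ?thesis using zero_le_power2[of "norm (ap D h)"] unfolding power_mult_distrib by linarith
    qed
    also have "norm h * norm (ap K h) = (\<delta> * norm h) * norm (ap ?C h)"
      using \<delta> by (simp add: scaleC_bop.rep_eq norm_scaleC_hilbert norm_divide)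
    also have "(\<delta> * norm h)\<^sup>2 + (\<delta> * norm h) * norm (ap ?C h) \<le> (\<delta> * norm h + norm (ap ?C h))\<^sup>2"
      using \<delta> by (simp add: power2_sum)
    finally show "norm (ap T h) \<le> \<delta> * norm h + norm (ap ?C h)"
      by (rule power2_le_imp_le) (use \<delta> in simp)
  qed
qed

section \<open>The multiplicative domain modulo the compact operators\<close>

text \<open>Here \<open>\<sigma>\<close> stands for the *-homomorphism that \<open>\<Psi>\<close> is meant to lift.\<close>

locale cp_lift = cp_extension m \<Psi>
  for m and \<Psi> :: "'a::unital_cstar_algebra fmat \<Rightarrow> 'h::chilbert_space bop" +
  fixes \<sigma> :: "'a fmat \<Rightarrow> 'h calkin"
  assumes \<sigma>_add: "\<sigma> (x + y) = \<sigma> x + \<sigma> y"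
    and \<sigma>_scale: "\<sigma> (c *\<^sub>C x) = c *\<^sub>C \<sigma> x"
    and \<sigma>_star: "\<sigma> (star x) = star (\<sigma> x)"
    and \<sigma>_mult: "x \<in> Mat m UNIV \<Longrightarrow> \<sigma> (x * y) = \<sigma> x * \<sigma> y"
    and \<sigma>_unit: "\<sigma> (mat_one m) = 1"
begin

lemmas \<sigma>_hom = \<sigma>_add \<sigma>_scale \<sigma>_star \<sigma>_mult

definition "\<tau> x = calkin_proj (\<Psi> x)"

lemma \<tau>_add: "x \<in> Mat m UNIV \<Longrightarrow> y \<in> Mat m UNIV \<Longrightarrow> \<tau> (x + y) = \<tau> x + \<tau> y"
  and \<tau>_scale: "x \<in> Mat m UNIV \<Longrightarrow> \<tau> (c *\<^sub>C x) = c *\<^sub>C \<tau> x"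
  and \<tau>_star: "x \<in> Mat m UNIV \<Longrightarrow> \<tau> (star x) = star (\<tau> x)"
  by (simp_all add: \<tau>_def add scale star_hom proj_hom)

text \<open>The part of the multiplicative domain of \<open>\<tau>\<close> on which it agrees with \<open>\<sigma>\<close>.\<close>

definition mult_dom :: "'a fmat set" where
  "mult_dom = {x \<in> Mat m UNIV. \<tau> x = \<sigma> x \<and>
     (\<forall>z\<in>Mat m UNIV. \<tau> (z * x) = \<tau> z * \<tau> x \<and> \<tau> (x * z) = \<tau> x * \<tau> z)}"

lemma star_subalg_mult_dom: "star_subalg mult_dom"
  unfolding star_subalg_def
proof (intro conjI ballI)
  show "csubspace mult_dom"
  proof (rule complex_vector.subspaceI)
    have "\<tau> 0 = 0" "\<sigma> 0 = 0" using \<tau>_scale[OF M_alg(1), of 0] \<sigma>_scale[of 0 0] by simp_all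
    then show "0 \<in> mult_dom" by (simp add: mult_dom_def M_alg)
    show "x + y \<in> mult_dom" if "x \<in> mult_dom" "y \<in> mult_dom" for x y
      using that by (simp add: mult_dom_def M_alg \<tau>_add \<sigma>_hom distrib_left distrib_right)
    show "c *\<^sub>C x \<in> mult_dom" if "x \<in> mult_dom" for c x
      using that by (simp add: mult_dom_def M_alg \<tau>_scale \<sigma>_hom mult_scaleC_left mult_scaleC_right)
  qed
next
  fix x y assume x: "x \<in> mult_dom" and y: "y \<in> mult_dom"
  have xM: "x \<in> Mat m UNIV" and yM: "y \<in> Mat m UNIV" using x y by (auto simp: mult_dom_def)
  have xy: "\<tau> (x * y) = \<tau> x * \<tau> y" using x yM by (simp add: mult_dom_def)
  have "\<tau> (x * y) = \<sigma> (x * y)" using xy x y by (simp add: mult_dom_def \<sigma>_hom)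
  moreover have "\<tau> (z * (x * y)) = \<tau> z * \<tau> (x * y)" if "z \<in> Mat m UNIV" for z
  proof -
    have "\<tau> (z * (x * y)) = \<tau> ((z * x) * y)" by (simp add: mult.assoc)
    also have "\<dots> = \<tau> (z * x) * \<tau> y" using y that xM by (simp add: mult_dom_def M_alg)
    also have "\<dots> = \<tau> z * \<tau> (x * y)" using x that by (simp add: mult_dom_def xy mult.assoc)
    finally show ?thesis .
  qed
  moreover have "\<tau> ((x * y) * z) = \<tau> (x * y) * \<tau> z" if "z \<in> Mat m UNIV" for z
  proof -
    have "\<tau> ((x * y) * z) = \<tau> (x * (y * z))" by (simp add: mult.assoc)
    also have "\<dots> = \<tau> x * \<tau> (y * z)" using x that yM by (simp add: mult_dom_def M_alg)
    also have "\<dots> = \<tau> (x * y) * \<tau> z" using y that by (simp add: mult_dom_def xy mult.assoc)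
    finally show ?thesis .
  qed
  ultimately show "x * y \<in> mult_dom" using xM yM by (simp add: mult_dom_def M_alg)
next
  fix x assume x: "x \<in> mult_dom"
  have xM: "x \<in> Mat m UNIV" using x by (simp add: mult_dom_def)
  have "\<tau> (z * star x) = \<tau> z * \<tau> (star x) \<and> \<tau> (star x * z) = \<tau> (star x) * \<tau> z" if z: "z \<in> Mat m UNIV" for z
  proof -
    have sz: "star z \<in> Mat m UNIV" using z by (rule M_alg)
    have "\<tau> (star (star z * x)) = star (\<tau> (star z * x))" "\<tau> (star (x * star z)) = star (\<tau> (x * star z))"
      "\<tau> (star z * x) = \<tau> (star z) * \<tau> x" "\<tau> (x * star z) = \<tau> x * \<tau> (star z)"
      using x xM sz by (auto simp: mult_dom_def \<tau>_star M_alg)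
    then show ?thesis using z xM by (simp add: star_mult \<tau>_star)
  qed
  then show "star x \<in> mult_dom" using x xM by (simp add: mult_dom_def M_alg \<tau>_star \<sigma>_hom)
qed

lemmas mult_dom_alg = star_subalgD[OF star_subalg_mult_dom]

text \<open>The hypotheses say that the defects of \<open>x\<close> and of \<open>star x\<close> vanish modulo compact operators, and
  then so do all defects with second argument \<open>x\<close> or \<open>star x\<close>.\<close>

lemma mult_domI:
  assumes x: "x \<in> Mat m UNIV" "\<tau> x = \<sigma> x" "\<tau> (star x * x) = \<sigma> (star x * x)" "\<tau> (x * star x) = \<sigma> (x * star x)"
  shows "x \<in> mult_dom"
proof -
  have sx: "star x \<in> Mat m UNIV" using x(1) by (rule M_alg)
  have "calkin_proj (defect x x) = 0"
    using x sx by (simp add: defect_def proj_hom \<sigma>_hom flip: \<tau>_def)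
  then have c1: "compact_op (defect x x)" by (simp add: calkin_proj_zero)
  have "calkin_proj (defect (star x) (star x)) = 0"
    using x sx by (simp add: defect_def proj_hom \<sigma>_hom \<tau>_star flip: \<tau>_def)
  then have c2: "compact_op (defect (star x) (star x))" by (simp add: calkin_proj_zero)
  have "\<tau> (z * x) = \<tau> z * \<tau> x \<and> \<tau> (x * z) = \<tau> x * \<tau> z" if z: "z \<in> Mat m UNIV" for z
  proof
    have sz: "star z \<in> Mat m UNIV" using z by (rule M_alg)
    have "calkin_proj (defect (star z) x) = 0" using defect_compact[OF sz x(1) c1] by (simp add: calkin_proj_zero)
    then show "\<tau> (z * x) = \<tau> z * \<tau> x" using z by (simp add: defect_def proj_hom star_hom flip: \<tau>_def)
    have "calkin_proj (defect z (star x)) = 0" using defect_compact[OF z sx c2] by (simp add: calkin_proj_zero)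
    then have "\<tau> (star z * star x) = star (\<tau> z) * star (\<tau> x)"
      using x(1) by (simp add: defect_def proj_hom \<tau>_star flip: \<tau>_def)
    then have "star (\<tau> (star (x * z))) = star (star (\<tau> x * \<tau> z))" by (simp add: star_mult)
    then show "\<tau> (x * z) = \<tau> x * \<tau> z" using x z by (simp add: \<tau>_star M_alg)
  qed
  then show ?thesis using x by (simp add: mult_dom_def)
qed

text \<open>Of \<open>linking_mat m v\<close> only the values under \<open>\<tau>\<close> are known. Cutting it down by diagonal matrix
  units, which are in the multiplicative domain, isolates its entries; they are partial isometries, so
  \<open>mult_domI\<close> applies to them.\<close>

lemma linking_system_mult_dom:
  assumes agree: "\<And>x. x \<in> linking_system m v \<Longrightarrow> \<tau> x = \<sigma> x"
    and v: "\<And>i. i < r \<Longrightarrow> unitary (v i)" and m: "m = r + 3"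
  shows "j < m \<Longrightarrow> sing j 0 1 \<in> mult_dom" and "j < m \<Longrightarrow> sing 0 j 1 \<in> mult_dom"
    and "i < r \<Longrightarrow> sing 0 0 (v i) \<in> mult_dom"
proof -
  have SE: "mat_one m \<in> linking_system m v" and Su: "cayley_diag m \<in> linking_system m v"
    and Sy: "linking_mat m v \<in> linking_system m v"
    unfolding linking_system_def by (auto intro: complex_vector.span_base)
  have SM: "x \<in> Mat m UNIV" if "x \<in> linking_system m v" for x
    using linking_system_subsystem[of m v] that by (auto simp: operator_subsystem_def)
  have EG: "mat_one m \<in> mult_dom"
    by (rule mult_domI) (simp_all add: SE SM agree star_mat_one mat_one_mult mat_one_in_Mat)
  have uG: "cayley_diag m \<in> mult_dom"
    by (rule mult_domI) (simp_all add: Su SE SM agree cayley_diag_unitary)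
  have diagG: "sing k k 1 \<in> mult_dom" if "k < m" for k
    by (rule diag_units_generated[OF star_subalg_mult_dom EG uG that])
  have linkG: "sing i j q \<in> mult_dom"
    if ij: "i < m" "j < m" and q: "entry (linking_mat m v) i j = q" "unitary q" for i j q
  proof (rule mult_domI)
    let ?y = "linking_mat m v"
    have yM: "?y \<in> Mat m UNIV" using Sy by (rule SM)
    have qe: "sing i j q = sing i i 1 * ?y * sing j j 1" using compress_entry[OF yM ij] q by simp
    have "\<tau> (sing i i 1 * (?y * sing j j 1)) = \<tau> (sing i i 1) * \<tau> (?y * sing j j 1)"
      using diagG[OF ij(1)] yM diagG[OF ij(2)] by (simp add: mult_dom_def M_alg)
    also have "\<dots> = \<sigma> (sing i i 1) * (\<sigma> ?y * \<sigma> (sing j j 1))"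
      using diagG[OF ij(1)] diagG[OF ij(2)] yM by (simp add: mult_dom_def agree Sy)
    also have "\<dots> = \<sigma> (sing i i 1 * (?y * sing j j 1))"
      using ij yM by (simp add: \<sigma>_hom sing_in_Mat)
    finally show "\<tau> (sing i j q) = \<sigma> (sing i j q)" by (simp add: qe mult.assoc)
    show "sing i j q \<in> Mat m UNIV" using ij by (rule sing_in_Mat)
    have "star (sing i j q) * sing i j q = sing j j 1" "sing i j q * star (sing i j q) = sing i i 1"
      using q(2) by (simp_all add: star_sing sing_mult unitary_def)
    then show "\<tau> (star (sing i j q) * sing i j q) = \<sigma> (star (sing i j q) * sing i j q)"
      "\<tau> (sing i j q * star (sing i j q)) = \<sigma> (sing i j q * star (sing i j q))"
      using diagG ij by (simp_all add: mult_dom_def)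
  qed
  have rowG: "sing 0 j 1 \<in> mult_dom" if "j < m" for j
  proof (cases "j = 0")
    case False
    then show ?thesis using that by (intro linkG) (auto simp: linking_mat_def mk_fmat.rep_eq unitary_def)
  qed (use diagG that in simp)
  have colG: "sing j 0 1 \<in> mult_dom" if "j < m" for j using mult_dom_alg(6)[OF rowG[OF that]] by (simp add: star_sing)
  show "sing j 0 1 \<in> mult_dom" "sing 0 j 1 \<in> mult_dom" if "j < m" for j using that by (rule colG, rule rowG)
  show "sing 0 0 (v i) \<in> mult_dom" if i: "i < r" for i
  proof -
    have "sing (Suc i) (Suc (Suc i)) (v i) \<in> mult_dom"
      using i m v[OF i] by (intro linkG) (auto simp: linking_mat_def mk_fmat.rep_eq)
    then have "sing 0 (Suc i) 1 * sing (Suc i) (Suc (Suc i)) (v i) * sing (Suc (Suc i)) 0 1 \<in> mult_dom"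
      using i m by (intro mult_dom_alg rowG colG) auto
    then show ?thesis by (simp add: sing_mult)
  qed
qed

text \<open>For \<open>b\<close> close to \<open>a\<close>, the difference of the two maps at \<open>a\<close> is their difference at \<open>a - b\<close>, up
  to compact operators. There both maps are small, \<open>\<Psi>\<close> in norm and \<open>\<sigma>\<close> modulo compact
  operators.\<close>

lemma agree_on_closure:
  assumes agree: "\<And>a. a \<in> N \<Longrightarrow> \<tau> (diag_mat m (\<lambda>_. a)) = \<sigma> (diag_mat m (\<lambda>_. a))" and dense: "closure N = UNIV"
  shows "\<tau> (diag_mat m (\<lambda>_. a)) = \<sigma> (diag_mat m (\<lambda>_. a))"
proof -
  define emb where "emb a = diag_mat m (\<lambda>_. a :: 'a)" for a
  have emb: "emb (a + b) = emb a + emb b" "emb (c *\<^sub>C a) = c *\<^sub>C emb a" "emb (a * b) = emb a * emb b"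
    "emb (star a) = star (emb a)" "emb 1 = mat_one m" "emb a \<in> Mat m UNIV" for a b c
    by (simp_all add: emb_def diag_mat_add diag_mat_scaleC diag_mat_mult star_diag_mat mat_one_def diag_mat_in_Mat)
  define \<theta> where "\<theta> a = \<sigma> (emb a)" for a
  have \<theta>: "unital_star_hom \<theta>"
    by (simp add: unital_star_hom_def \<theta>_def emb \<sigma>_hom \<sigma>_unit)
  obtain T where T: "calkin_proj T = \<theta> a" by (metis Quotient3_abs_rep[OF Quotient3_calkin])
  have "compact_op (\<Psi> (emb a) - T)"
  proof (rule compact_op_dominated)
    fix \<epsilon> :: real assume \<epsilon>: "\<epsilon> > 0"
    define \<delta> where "\<delta> = \<epsilon> / 2"
    have \<delta>: "\<delta> > 0" using \<epsilon> by (simp add: \<delta>_def)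
    have "a \<in> closure N" by (simp add: dense)
    then obtain b where b: "b \<in> N" "dist b a < \<delta>" using \<delta> unfolding closure_approachable by blast
    define c where "c = a - b"
    have nc: "norm c \<le> \<delta>" using b(2) by (simp add: c_def dist_norm norm_minus_commute)
    have embc: "\<Psi> (emb a) = \<Psi> (emb c) + \<Psi> (emb b)"
      using add[OF emb(6) emb(6), of c b] by (simp add: c_def flip: emb(1))
    \<comment> \<open>this representative of \<open>\<theta> c\<close> makes \<open>\<Psi> (emb a) - T\<close> exactly the difference of two small operators\<close>
    define Q where "Q = \<Psi> (emb c) - (\<Psi> (emb a) - T)"
    have "calkin_proj Q = \<theta> a - calkin_proj (\<Psi> (emb b))"
      by (simp add: Q_def embc proj_hom T)
    also have "\<dots> = \<theta> c"
      using agree[OF b(1), folded emb_def] unital_star_homD(7)[OF \<theta>, of a b] by (simp add: c_def \<tau>_def \<theta>_def)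
    finally obtain K where K: "compact_op K" "\<And>h. norm (ap Q h) \<le> \<delta> * norm h + norm (ap K h)"
      using star_hom_bound_mod_compact[OF \<theta> _ nc \<delta>] by metis
    have "(norm c)\<^sup>2 \<le> \<delta>\<^sup>2" using nc by (simp add: power_mono)
    then obtain d where d: "\<delta>\<^sup>2 *\<^sub>R 1 - star c * c = star d * d" using norm_sq_minus_square by blast
    then have "complex_of_real (\<delta>\<^sup>2) *\<^sub>C 1 = star c * c + star d * d"
      by (simp add: scaleR_eq_scaleC algebra_simps)
    then have "complex_of_real (\<delta>\<^sup>2) *\<^sub>C mat_one m = star (emb c) * emb c + star (emb d) * emb d"
      by (simp flip: emb)
    note nb2 = norm_bound[OF emb(6) emb(6) this]
    have nb: "norm (ap (\<Psi> (emb c)) h) \<le> \<delta> * norm h" for h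
    proof (rule power2_le_imp_le)
      show "(norm (ap (\<Psi> (emb c)) h))\<^sup>2 \<le> (\<delta> * norm h)\<^sup>2"
        unfolding power_mult_distrib by (rule nb2)
      show "0 \<le> \<delta> * norm h" using \<delta> by simp
    qed
    have "norm (ap (\<Psi> (emb a) - T) h) \<le> \<epsilon> * norm h + norm (ap K h)" for h
    proof -
      have "ap (\<Psi> (emb a) - T) h = ap (\<Psi> (emb c)) h - ap Q h" by (simp add: Q_def ap_minus_left)
      then have "norm (ap (\<Psi> (emb a) - T) h) \<le> norm (ap (\<Psi> (emb c)) h) + norm (ap Q h)"
        by (metis norm_triangle_ineq4)
      also have "\<dots> \<le> \<delta> * norm h + (\<delta> * norm h + norm (ap K h))" by (intro add_mono nb K)
      finally show ?thesis by (simp add: \<delta>_def)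
    qed
    then show "\<exists>C. compact_op C \<and> (\<forall>h. norm (ap (\<Psi> (emb a) - T) h) \<le> \<epsilon> * norm h + norm (ap C h))"
      using K(1) by blast
  qed
  then have "calkin_proj (\<Psi> (emb a)) = calkin_proj T" by (simp add: calkin_proj_eq_iff)
  then show ?thesis by (simp add: \<tau>_def T \<theta>_def emb_def)
qed

end

section \<open>Lifts on the linking system\<close>

lemma closure_star_subalg:
  fixes A :: "'a::unital_cstar_algebra set"
  assumes A: "star_subalg A"
  shows "cstar_subalgebra (closure A)"
proof -
  note alg = star_subalgD[OF A]
  have scale_lim: "(\<lambda>n. c *\<^sub>C f n) \<longlonglongrightarrow> c *\<^sub>C x" if "f \<longlonglongrightarrow> x" for c f and x :: 'a
    using tendsto_mult_right[OF that, of "c *\<^sub>C 1"] tendsto_mult[OF tendsto_const[of "c *\<^sub>C 1"] that]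
    by (simp add: mult_scaleC_left)
  have star_lim: "(\<lambda>n. star (f n)) \<longlonglongrightarrow> star x" if "f \<longlonglongrightarrow> x" for f and x :: 'a
  proof -
    have "(\<lambda>n. norm (f n - x)) \<longlonglongrightarrow> 0" using that by (simp add: tendsto_norm_zero_iff LIM_zero_iff)
    then have "(\<lambda>n. norm (star (f n) - star x)) \<longlonglongrightarrow> 0" by (simp add: norm_star flip: star_diff)
    then show ?thesis by (simp add: tendsto_norm_zero_iff LIM_zero_iff)
  qed
  have "csubspace (closure A)"
  proof (rule complex_vector.subspaceI)
    show "0 \<in> closure A" using alg(1) closure_subset by blast
    show "x + y \<in> closure A" if "x \<in> closure A" "y \<in> closure A" for x y
    proof -
      obtain f g where "\<forall>n. f n \<in> A" "f \<longlonglongrightarrow> x" "\<forall>n. g n \<in> A" "g \<longlonglongrightarrow> y"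
        using \<open>x \<in> closure A\<close> \<open>y \<in> closure A\<close> by (auto simp: closure_sequential)
      then show ?thesis unfolding closure_sequential
        by (intro exI[of _ "\<lambda>n. f n + g n"]) (simp add: alg tendsto_add)
    qed
    show "c *\<^sub>C x \<in> closure A" if "x \<in> closure A" for c x
    proof -
      obtain f where "\<forall>n. f n \<in> A" "f \<longlonglongrightarrow> x" using \<open>x \<in> closure A\<close> by (auto simp: closure_sequential)
      then show ?thesis unfolding closure_sequential
        by (intro exI[of _ "\<lambda>n. c *\<^sub>C f n"]) (simp add: alg scale_lim)
    qed
  qed
  moreover have "x * y \<in> closure A" if "x \<in> closure A" "y \<in> closure A" for x y
  proof -
    obtain f g where "\<forall>n. f n \<in> A" "f \<longlonglongrightarrow> x" "\<forall>n. g n \<in> A" "g \<longlonglongrightarrow> y"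
      using \<open>x \<in> closure A\<close> \<open>y \<in> closure A\<close> by (auto simp: closure_sequential)
    then show ?thesis unfolding closure_sequential
      by (intro exI[of _ "\<lambda>n. f n * g n"]) (simp add: alg tendsto_mult)
  qed
  moreover have "star x \<in> closure A" if "x \<in> closure A" for x
  proof -
    obtain f where "\<forall>n. f n \<in> A" "f \<longlonglongrightarrow> x" using \<open>x \<in> closure A\<close> by (auto simp: closure_sequential)
    then show ?thesis unfolding closure_sequential
      by (intro exI[of _ "\<lambda>n. star (f n)"]) (simp add: alg star_lim)
  qed
  ultimately show ?thesis by (simp add: cstar_subalgebra_def)
qed

lemma (in cp_extension) ucp_corner:
  fixes e :: "nat \<Rightarrow> 'h" and W :: "'h bop"
  assumes e: "hilbert_basis e" and W: "star W * W = 1"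
  shows "ucp UNIV UNIV (\<lambda>a. star W * \<Psi> (diag_mat m (\<lambda>_. a)) * W)"
proof -
  define emb where "emb a = diag_mat m (\<lambda>_. a :: 'a)" for a
  have emb: "emb (a + b) = emb a + emb b" "emb (c *\<^sub>C a) = c *\<^sub>C emb a" "emb (a * b) = emb a * emb b"
    "emb (star a) = star (emb a)" "emb 1 = mat_one m" "emb a \<in> Mat m UNIV" for a b c
    by (simp_all add: emb_def diag_mat_add diag_mat_scaleC diag_mat_mult star_diag_mat mat_one_def diag_mat_in_Mat)
  define \<psi>' where "\<psi>' a = star W * \<Psi> (emb a) * W" for a
  have "ucp UNIV UNIV \<psi>'" unfolding ucp_def unit_of_UNIV
  proof (intro conjI ballI allI)
    show "\<psi>' (x + y) = \<psi>' x + \<psi>' y" for x y by (simp add: \<psi>'_def emb add distrib_left distrib_right)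
    show "\<psi>' (c *\<^sub>C x) = c *\<^sub>C \<psi>' x" for c x
      by (simp add: \<psi>'_def emb scale mult_scaleC_left mult_scaleC_right)
    show "\<psi>' 1 = 1" using W by (simp add: \<psi>'_def emb unit)
    show "completely_positive UNIV UNIV \<psi>'" unfolding completely_positive_def
    proof (intro allI ballI impI)
      fix k and x :: "'a fmat" assume "positive_in (Mat k UNIV) x"
      then obtain y where y: "y \<in> Mat k UNIV" "x = star y * y" by (auto simp: positive_in_def)
      have xe: "entry x i j = (\<Sum>l<k. star (entry y l i) * entry y l j)" for i j
        unfolding y(2) by (subst entry_times[where N=k]) (use y(1) in \<open>auto simp: star_fmat.rep_eq Mat_UNIV\<close>)
      have emb_sum: "\<Psi> (emb (\<Sum>l\<in>I. f l)) = (\<Sum>l\<in>I. \<Psi> (emb (f l)))" for I :: "nat set" and f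
      proof (induction I rule: infinite_finite_induct)
        case (insert l I)
        then show ?case by (simp add: emb(1) add emb(6))
      qed (use emb(2)[of 0 0] scale[OF emb(6), of 0 0] in simp_all)
      show "positive_in (Mat k UNIV) (amplify k \<psi>' x)"
      proof (rule positive_operator_matrix[OF e])
        show "amplify k \<psi>' x \<in> Mat k UNIV" by (simp add: amplify_def Mat_UNIV mk_fmat.rep_eq)
        fix h :: "nat \<Rightarrow> 'h"
        have "(\<Sum>i<k. \<Sum>j<k. cinner (h i) (ap (entry (amplify k \<psi>' x) i j) (h j)))
            = (\<Sum>i<k. \<Sum>j<k. \<Sum>l<k. cinner (ap (W) (h i))
                (ap (\<Psi> (star (emb (entry y l i)) * emb (entry y l j))) (ap (W) (h j))))"
          by (intro sum.cong refl)
            (simp add: amplify_def mk_fmat.rep_eq \<psi>'_def xe emb_sum times_bop.rep_eq cinner_star_right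
              ap_sum_left cinner_sum_right emb(3,4))
        also have "\<dots> = (\<Sum>l<k. \<Sum>i<k. \<Sum>j<k. cinner (ap (W) (h i))
                (ap (\<Psi> (star (emb (entry y l i)) * emb (entry y l j))) (ap (W) (h j))))"
          by (subst sum.swap[of _ "{..<k}" "{..<k}"], subst (2) sum.swap) (rule refl)
        also have "\<dots> \<in> \<real>\<^sub>\<ge>\<^sub>0"
          by (intro sum_nonneg_Reals pos emb(6))
        finally show "(\<Sum>i<k. \<Sum>j<k. cinner (h i) (ap (entry (amplify k \<psi>' x) i j) (h j))) \<in> \<real>\<^sub>\<ge>\<^sub>0" .
      qed
    qed
  qed
  then show ?thesis unfolding \<psi>'_def emb_def .
qed

text \<open>The elements \<open>a\<close> such that $aE_{00}$ is in the multiplicative domain form a *-algebra that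
  contains all \<open>v i\<close>. For them $a\otimes 1=\sum_j E_{j0}(aE_{00})E_{0j}$ is in the multiplicative
  domain as well, and by density \<open>\<Psi>\<close> lifts \<open>\<sigma>\<close> at every $a\otimes 1$. The map
  $a\mapsto\Psi(a\otimes 1)$ rather than $a\mapsto\Psi(aE_{00})$ is compressed because only the former is
  unital before passing to the quotient.\<close>

lemma lift_from_linking_system:
  fixes \<rho> :: "'a::unital_cstar_algebra \<Rightarrow> 'h::chilbert_space calkin" and e :: "nat \<Rightarrow> 'h"
    and W :: "nat \<Rightarrow> 'h bop"
  assumes e: "hilbert_basis e" and \<rho>: "unital_star_hom \<rho>"
    and v: "\<And>i. i < r \<Longrightarrow> unitary (v i)" and m: "m = r + 3"
    and gen: "\<And>A. star_subalg A \<Longrightarrow> v ` {..<r} \<subseteq> A \<Longrightarrow> closure A = UNIV"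
    and W: "\<And>i j. i < m \<Longrightarrow> j < m \<Longrightarrow> star (W i) * W j = (if i = j then 1 else 0)"
    and sumW: "(\<Sum>i<m. W i * star (W i)) = 1"
    and lift: "has_ucp_lift (Mat m UNIV) (linking_system m v) (matrix_conj m (\<lambda>i. calkin_proj (W i)) \<rho>)"
  shows "has_ucp_lift UNIV UNIV \<rho>"
proof -
  let ?S = "linking_system m v" and ?M = "Mat m UNIV :: 'a fmat set"
  define w where "w i = calkin_proj (W i)" for i
  define \<sigma> where "\<sigma> = matrix_conj m w \<rho>"
  have w: "star (w i) * w j = (if i = j then 1 else 0)" if "i < m" "j < m" for i j
    using arg_cong[OF W[OF that], of calkin_proj] by (auto simp: w_def proj_hom)
  note \<rho>_hom = unital_star_homD[OF \<rho>]
  obtain \<psi> where \<psi>: "ucp ?M ?S \<psi>" "\<And>x. x \<in> ?S \<Longrightarrow> calkin_proj (\<psi> x) = \<sigma> x"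
    using lift unfolding has_ucp_lift_def \<sigma>_def w_def by blast
  have S: "operator_subsystem ?M ?S" by (rule linking_system_subsystem)
  have SE: "mat_one m \<in> ?S" unfolding linking_system_def by (auto intro: complex_vector.span_base)
  obtain \<Psi> where \<Psi>: "\<And>x y. x \<in> ?M \<Longrightarrow> y \<in> ?M \<Longrightarrow> \<Psi> (x + y) = \<Psi> x + \<Psi> y"
    "\<And>c x. x \<in> ?M \<Longrightarrow> \<Psi> (c *\<^sub>C x) = c *\<^sub>C \<Psi> x"
    "\<And>x. x \<in> ?S \<Longrightarrow> \<Psi> x = \<psi> x"
    "\<And>n x h. (\<And>r. r < n \<Longrightarrow> x r \<in> ?M) \<Longrightarrow>
      (\<Sum>r<n::nat. \<Sum>q<n. cinner (h r) (ap (\<Psi> (star (x r) * x q)) (h q))) \<in> \<real>\<^sub>\<ge>\<^sub>0"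
    using arveson_extension[OF S \<psi>(1) e] by blast
  have unit\<Psi>: "\<Psi> (mat_one m) = 1" using \<Psi>(3)[OF SE] \<psi>(1) by (simp add: ucp_def unit_of_Mat_eq)
  have \<sigma>_diag: "\<sigma> (diag_mat m (\<lambda>_. a)) = (\<Sum>j<m. w j * \<rho> a * star (w j))" for a
  proof -
    have "\<sigma> (diag_mat m (\<lambda>_. a)) = (\<Sum>i<m. \<Sum>j<m. if j = i then w i * \<rho> a * star (w i) else 0)"
      unfolding \<sigma>_def matrix_conj_def
      by (intro sum.cong refl) (auto simp: entry_diag_mat \<rho>_hom)
    then show ?thesis by simp
  qed
  interpret cp_lift m \<Psi> \<sigma>
  proof unfold_locales
    fix x y :: "'a fmat" and c
    show "\<sigma> (x + y) = \<sigma> x + \<sigma> y" "\<sigma> (c *\<^sub>C x) = c *\<^sub>C \<sigma> x" "\<sigma> (star x) = star (\<sigma> x)"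
      unfolding \<sigma>_def by (rule matrix_conj_hom[OF \<rho> w]; assumption)+
    show "\<sigma> (x * y) = \<sigma> x * \<sigma> y" if "x \<in> ?M"
      unfolding \<sigma>_def by (rule matrix_conj_hom(4)[OF \<rho> w that])
    show "\<sigma> (mat_one m) = 1"
      using arg_cong[OF sumW, of calkin_proj] \<sigma>_diag[of 1]
      by (simp add: mat_one_def \<rho>_hom proj_hom w_def)
  qed (fact \<Psi>(1) \<Psi>(2) unit\<Psi> \<Psi>(4))+
  have agree: "\<tau> x = \<sigma> x" if "x \<in> ?S" for x using \<psi>(2)[OF that] \<Psi>(3)[OF that] by (simp add: \<tau>_def)
  note link = linking_system_mult_dom[OF agree v m]
  define N where "N = {a. sing 0 0 a \<in> mult_dom}"
  have N_alg: "star_subalg N" unfolding star_subalg_def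
  proof (intro conjI ballI)
    show "csubspace N"
      by (rule complex_vector.subspaceI) (simp_all add: N_def sing_add sing_scaleC mult_dom_alg)
    show "a * b \<in> N" if "a \<in> N" "b \<in> N" for a b
      using mult_dom_alg(5)[of "sing 0 0 a" "sing 0 0 b"] that by (simp add: N_def sing_mult)
    show "star a \<in> N" if "a \<in> N" for a
      using mult_dom_alg(6)[of "sing 0 0 a"] that by (simp add: N_def star_sing)
  qed
  have dense: "closure N = UNIV" by (rule gen[OF N_alg]) (use link(3) in \<open>auto simp: N_def\<close>)
  have agree_N: "\<tau> (diag_mat m (\<lambda>_. a)) = \<sigma> (diag_mat m (\<lambda>_. a))" if "a \<in> N" for a
  proof -
    have "diag_mat m (\<lambda>_. a) = (\<Sum>j<m. sing j 0 1 * sing 0 0 a * sing 0 j 1)"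
      by (simp add: diag_mat_def sing_mult)
    also have "\<dots> \<in> mult_dom" using that by (intro mult_dom_alg link) (auto simp: N_def)
    finally show ?thesis by (simp add: mult_dom_def)
  qed
  have m0: "0 < m" using m by simp
  have "calkin_proj (star (W 0) * \<Psi> (diag_mat m (\<lambda>_. a)) * W 0) = \<rho> a" for a
  proof -
    have "calkin_proj (star (W 0) * \<Psi> (diag_mat m (\<lambda>_. a)) * W 0) = star (w 0) * \<sigma> (diag_mat m (\<lambda>_. a)) * w 0"
      using agree_on_closure[OF agree_N dense, of a] by (simp add: proj_hom w_def \<tau>_def)
    also have "\<dots> = (\<Sum>j<m. (star (w 0) * w j) * \<rho> a * (star (w j) * w 0))"
      by (simp add: \<sigma>_diag sum_distrib_left sum_distrib_right mult.assoc)
    also have "\<dots> = (\<Sum>j<m. if j = 0 then \<rho> a else 0)"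
      by (rule sum.cong) (use m0 in \<open>auto simp: w\<close>)
    also have "\<dots> = \<rho> a" using m0 by simp
    finally show ?thesis .
  qed
  moreover have "ucp UNIV UNIV (\<lambda>a. star (W 0) * \<Psi> (diag_mat m (\<lambda>_. a)) * W 0)"
    using W[OF m0 m0] by (intro ucp_corner[OF e]) simp
  ultimately show ?thesis unfolding has_ucp_lift_def by blast
qed

theorem corollary4:
  fixes \<rho> :: "'a::unital_cstar_algebra \<Rightarrow> 'h::chilbert_space calkin"
  assumes "separable_space (euclidean :: 'h topology)"
    and "\<not> (\<exists>B::'h set. finite B \<and> cspan B = UNIV)"
    and "finitely_generated_cstar TYPE('a)"
    and "\<not> Ext_is_group TYPE('a) TYPE('h)"
    and "unital_star_hom \<rho>" and "inj \<rho>"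
    and "\<not> has_ucp_lift UNIV UNIV \<rho>"
  shows "\<exists>(n::nat) (S :: 'a fmat set) (V :: (nat \<Rightarrow> 'h) \<Rightarrow> 'h).
    operator_subsystem (Mat (n + 1) UNIV) S \<and> cdim S = 4 \<and> hsum_unitary (n + 1) V \<and>
    \<not> has_ucp_lift (Mat (n + 1) UNIV) S (\<lambda>x. conj_calkin (n + 1) V (amplify (n + 1) \<rho> x))"
proof -
  obtain e :: "nat \<Rightarrow> 'h" where e: "hilbert_basis e" using hilbert_basis_exists[OF assms(1,2)] .
  obtain F :: "'a set" where F: "finite F" "cstar_subalgebra hull F = UNIV"
    using assms(3) by (auto simp: finitely_generated_cstar_def)
  have "\<exists>p. unitary (fst p) \<and> unitary (snd p) \<and> (\<forall>B. star_subalg B \<longrightarrow> fst p \<in> B \<longrightarrow> snd p \<in> B \<longrightarrow> a \<in> B)" for a :: 'a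
    by (rule unitaries_spanning[of a]) (metis fst_conv snd_conv)
  then obtain p where p: "\<And>a::'a. unitary (fst (p a))" "\<And>a. unitary (snd (p a))"
    "\<And>a B. star_subalg B \<Longrightarrow> fst (p a) \<in> B \<Longrightarrow> snd (p a) \<in> B \<Longrightarrow> a \<in> B" by metis
  define U where "U = (fst \<circ> p) ` F \<union> (snd \<circ> p) ` F"
  have "finite U" using F(1) by (simp add: U_def)
  then obtain v r where v: "U = v ` {..<r::nat}"
    using finite_imp_nat_seg_image_inj_on[of U] by (auto simp: lessThan_def)
  have unitary_v: "unitary (v i)" if "i < r" for i
  proof -
    have "v i \<in> U" using that v by blast
    then show ?thesis using p by (auto simp: U_def)
  qed
  have gen: "closure A = UNIV" if A: "star_subalg A" "v ` {..<r} \<subseteq> A" for A :: "'a set"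
  proof -
    have "F \<subseteq> A" using A p(3)[OF A(1)] unfolding v[symmetric] U_def by auto
    then have "F \<subseteq> closure A" using closure_subset by blast
    then have "cstar_subalgebra hull F \<subseteq> closure A"
      using closure_star_subalg[OF A(1)] by (rule hull_minimal)
    then show ?thesis using F(2) by auto
  qed
  \<comment> \<open>size \<open>r + 2\<close> has room for the places \<open>(i + 1, i + 2)\<close>; one more gives three distinct eigenvalues even for \<open>r = 0\<close>\<close>
  define m where "m = r + 3"
  have "0 < m" by (simp add: m_def)
  then obtain W :: "nat \<Rightarrow> 'h bop" where
    W: "\<And>i j. i < m \<Longrightarrow> j < m \<Longrightarrow> star (W i) * W j = (if i = j then 1 else 0)"
    and sumW: "(\<Sum>i<m. W i * star (W i)) = 1" using cuntz_isometries[OF e] by blast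
  define V where "V f = (\<Sum>i<m. ap (W i) (f i))" for f
  have V: "hsum_unitary m V" unfolding V_def using W sumW by (rule hsum_unitary_of_isometries)
  have "\<not> has_ucp_lift (Mat m UNIV) (linking_system m v) (\<lambda>x. conj_calkin m V (amplify m \<rho> x))"
  proof
    assume l: "has_ucp_lift (Mat m UNIV) (linking_system m v) (\<lambda>x. conj_calkin m V (amplify m \<rho> x))"
    have "has_ucp_lift UNIV UNIV \<rho>"
    proof (rule lift_from_linking_system[OF e assms(5) unitary_v m_def gen W sumW])
      show "has_ucp_lift (Mat m UNIV) (linking_system m v) (matrix_conj m (\<lambda>i. calkin_proj (W i)) \<rho>)"
        using l conj_calkin_eq_matrix_conj[OF V[unfolded V_def], of \<rho>] unfolding V_def by simp
    qed
    then show False using assms(7) by contradiction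
  qed
  moreover have "cdim (linking_system m v) = 4" by (rule cdim_linking_system) (simp add: m_def)
  moreover have "m = (r + 2) + 1" by (simp add: m_def)
  ultimately show ?thesis using linking_system_subsystem V by metis
qed

end
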